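(* Let $H$ be a real or complex separable Hilbert space, $I=[0,1]$, and let $h:I\times I\rightarrow\mathcal{CF}^{\mathrm{sa}}(H)$ be a homotopy of selfadjoint Fredholm operators (i.e. a map that is continuous with respect to the gap-metric) such that $h(s,0)=h(s,1)$ for all $s\in I$. Then $$\operatorname{sf}(h(0,\cdot))=\operatorname{sf}(h(1,\cdot)).$$
   Context: Let $\mathcal{C}(H)$ be the set of densely defined closed operators on $H$ with the gap-metric $d_G(T,S)=\|P_T-P_S\|$, where $P_T,P_S$ are the orthogonal projections in $H\times H$ onto the graphs of $T,S$. $\mathcal{CF}^{\mathrm{sa}}(H)\subset\mathcal{C}(H)$ is the subspace of (generally unbounded) selfadjoint Fredholm operators. For $T\in\mathcal{CF}^{\mathrm{sa}}(H)$, $\chi_{[a,b]}(T)$ denotes the spectral projection of $T$ for the interval $[a,b]$, and $\sigma(T)$, $\sigma_{ess}(T)$ are the spectrum and the essential spectrum of $T$. Spectral flow: for a (gap-continuous) path $\mathcal{A}=\{\mathcal{A}_\lambda\}_{\lambda\in I}$ in $\mathcal{CF}^{\mathrm{sa}}(H)$ there are a partition $0=\lambda_0<\lambda_1<\dots<\lambda_N=1$ and numbers $a_i>0$ such that $\pm a_i\notin\sigma(\mathcal{A}_\lambda)$ and $[-a_i,a_i]\cap\sigma_{ess}(\mathcal{A}_\lambda)=\emptyset$ for all $\lambda\in[\lambda_{i-1},\lambda_i]$, and $\lambda\mapsto\chi_{[-a_i,a_i]}(\mathcal{A}_\lambda)$ is norm-continuous on $[\lambda_{i-1},\lambda_i]$,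 $i=1,\dots,N$. The spectral flow is the integer $$\operatorname{sf}(\mathcal{A})=\sum_{i=1}^N\left(\dim\operatorname{im}\chi_{[0,a_i]}(\mathcal{A}_{\lambda_i})-\dim\operatorname{im}\chi_{[0,a_i]}(\mathcal{A}_{\lambda_{i-1}})\right),$$ which is independent of the choice of partition and of the numbers $a_i$. *)

theory Defs
  imports "HOL-Analysis.Analysis"
begin

text \<open>The scalar fields \<open>\<real>\<close> and \<open>\<complex>\<close>, treated uniformly: a class member is a normed field with an
  isometric embedding into \<open>\<complex>\<close>. The lemma \<open>range_to_complex\<close> shows that up to isomorphism there
  are no others.\<close>

class real_or_complex = real_normed_field +
  fixes to_complex :: "'a \<Rightarrow> complex"
    and sconj :: "'a \<Rightarrow> 'a"
  assumes to_complex_add: "to_complex (a + b) = to_complex a + to_complex b"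
    and to_complex_mult: "to_complex (a * b) = to_complex a * to_complex b"
    and to_complex_scaleR: "to_complex (r *\<^sub>R a) = r *\<^sub>R to_complex a"
    and norm_to_complex: "norm (to_complex a) = norm a"
    and to_complex_sconj: "to_complex (sconj a) = cnj (to_complex a)"

instantiation real :: real_or_complex
begin
definition "to_complex (a::real) = complex_of_real a"
definition "sconj (a::real) = a"
instance by standard (simp_all add: to_complex_real_def sconj_real_def scaleR_conv_of_real)
end

instantiation complex :: real_or_complex
begin
definition "to_complex (a::complex) = a"
definition "sconj (a::complex) = cnj a"
instance by standard (simp_all add: to_complex_complex_def sconj_complex_def)
end

lemma inj_to_complex: "inj (to_complex :: 'a::real_or_complex \<Rightarrow> complex)"
proof
  fix x y :: 'a assume "to_complex x = to_complex y"
  moreover have "to_complex x = to_complex (x - y) + to_complex y"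
    by (simp flip: to_complex_add)
  ultimately have "norm (to_complex (x - y)) = 0" by simp
  then show "x = y" by (simp add: norm_to_complex)
qed

lemma range_to_complex:
  "range (to_complex :: 'a::real_or_complex \<Rightarrow> complex) = \<real> \<or>
   range (to_complex :: 'a \<Rightarrow> complex) = UNIV"
proof -
  let ?f = "to_complex :: 'a \<Rightarrow> complex"
  have "?f 1 \<noteq> 0" by (metis norm_to_complex norm_one norm_zero zero_neq_one)
  moreover have "?f 1 * ?f 1 = ?f 1" by (simp flip: to_complex_mult)
  ultimately have one: "?f 1 = 1" by simp
  have r: "?f (of_real r) = of_real r" for r
    by (simp add: of_real_def to_complex_scaleR one)
  show ?thesis
  proof (cases "range ?f \<subseteq> \<real>")
    case True
    then show ?thesis by (auto simp: Reals_def) (metis r rangeI)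
  next
    case False
    then obtain w where w: "Im (?f w) \<noteq> 0" by (metis complex_is_Real_iff image_subsetI)
    have "z \<in> range ?f" for z
    proof -
      define b where "b = Im z / Im (?f w)"
      have "?f (of_real (Re z - b * Re (?f w)) + b *\<^sub>R w) = z"
        using w by (simp add: to_complex_add r del: of_real_diff of_real_mult add: to_complex_scaleR complex_eq_iff b_def)
      then show ?thesis by (metis rangeI)
    qed
    then show ?thesis by auto
  qed
qed


text \<open>The inner product \<open>ip\<close> is linear in its first argument. Norm, topology and
  completeness are those of the type \<open>'h\<close>; the last two assumptions tie them to the
  \<open>'k\<close>-Hilbert space structure.\<close>

locale hilbert_space = vector_space scale
  for scale :: "'k::real_or_complex \<Rightarrow> 'h::banach \<Rightarrow> 'h" (infixr "*\<^sub>K" 75) +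
  fixes ip :: "'h \<Rightarrow> 'h \<Rightarrow> 'k"
  assumes ip_add_left: "ip (x + y) z = ip x z + ip y z"
    and ip_scale_left: "ip (c *\<^sub>K x) z = c * ip x z"
    and ip_sconj: "ip y x = sconj (ip x y)"
    and ip_self: "ip x x = of_real ((norm x)\<^sup>2)"
    and scale_of_real: "of_real r *\<^sub>K x = r *\<^sub>R x"

lemma hilbert_space_real: "hilbert_space scaleR (inner :: 'h::{real_inner,banach} \<Rightarrow> _)"
  by unfold_locales
    (simp_all add: inner_add_left inner_commute sconj_real_def algebra_simps power2_norm_eq_inner)

lemma hilbert_space_complex: "hilbert_space (*) (\<lambda>x y :: complex. x * cnj y)"
  by unfold_locales
    (simp_all add: sconj_complex_def algebra_simps scaleR_conv_of_real flip: complex_norm_square)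

text \<open>An operator is identified with its graph.\<close>

type_synonym 'h operator = "('h \<times> 'h) set"

context hilbert_space
begin

definition scale2 :: "'k \<Rightarrow> 'h \<times> 'h \<Rightarrow> 'h \<times> 'h" where
  "scale2 c z = (c *\<^sub>K fst z, c *\<^sub>K snd z)"

definition ip2 :: "'h \<times> 'h \<Rightarrow> 'h \<times> 'h \<Rightarrow> 'k" where
  "ip2 z w = ip (fst z) (fst w) + ip (snd z) (snd w)"

definition closed_operators :: "'h operator set" where
  "closed_operators =
     {T. module.subspace scale2 T \<and> single_valued T \<and> closed T \<and> closure (Domain T) = UNIV}"

definition graph_proj :: "'h operator \<Rightarrow> 'h \<times> 'h \<Rightarrow> 'h \<times> 'h" where
  "graph_proj T z = (THE p. p \<in> T \<and> (\<forall>w\<in>T. ip2 (z - p) w = 0))"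

definition gap_dist :: "'h operator \<Rightarrow> 'h operator \<Rightarrow> real" where
  "gap_dist T S = onorm (\<lambda>z. graph_proj T z - graph_proj S z)"

definition gap_continuous_on :: "'p::topological_space set \<Rightarrow> ('p \<Rightarrow> 'h operator) \<Rightarrow> bool" where
  "gap_continuous_on X f \<longleftrightarrow> (\<forall>p\<in>X. ((\<lambda>q. gap_dist (f q) (f p)) \<longlongrightarrow> 0) (at p within X))"

definition adjoint_op :: "'h operator \<Rightarrow> 'h operator" where
  "adjoint_op T = {(y, z). \<forall>(x, w)\<in>T. ip w y = ip x z}"

definition selfadjoint :: "'h operator \<Rightarrow> bool" where
  "selfadjoint T \<longleftrightarrow> T \<in> closed_operators \<and> adjoint_op T = T"

text \<open>The kernel and the cokernel \<open>H / im T\<close> are finite-dimensional over \<open>'k\<close>, and the range is closed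
  (which for closed operators already follows).\<close>

definition fredholm :: "'h operator \<Rightarrow> bool" where
  "fredholm T \<longleftrightarrow>
     T \<in> closed_operators \<and>
     (\<exists>B. finite B \<and> {x. (x, 0) \<in> T} \<subseteq> local.span B) \<and>
     closed (Range T) \<and>
     (\<exists>B. finite B \<and> local.span (Range T \<union> B) = UNIV)"

definition CFsa :: "'h operator set" where
  "CFsa = {T. selfadjoint T \<and> fredholm T}"

definition shift :: "'h operator \<Rightarrow> 'k \<Rightarrow> 'h operator" where
  "shift T c = {(x, y - c *\<^sub>K x) | x y. (x, y) \<in> T}"

text \<open>\<open>c\<close> is in the resolvent set iff \<open>T - c\<close> is a bijection from its domain onto \<open>H\<close> with bounded
  inverse \<open>R\<close>.\<close>

definition resolvent_set :: "'h operator \<Rightarrow> 'k set" where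
  "resolvent_set T = {c. \<exists>R. bounded_linear R \<and> (shift T c)\<inverse> = {(y, R y) | y. True}}"

definition spectrum :: "'h operator \<Rightarrow> 'k set" where
  "spectrum T = - resolvent_set T"

definition ess_spectrum :: "'h operator \<Rightarrow> 'k set" where
  "ess_spectrum T = {c. \<not> fredholm (shift T c)}"

definition orthogonal_projection :: "('h \<Rightarrow> 'h) \<Rightarrow> bool" where
  "orthogonal_projection P \<longleftrightarrow>
     (\<forall>x y. P (x + y) = P x + P y) \<and> (\<forall>c x. P (c *\<^sub>K x) = c *\<^sub>K P x) \<and>
     (\<forall>x. P (P x) = P x) \<and> (\<forall>x y. ip (P x) y = ip x (P y))"

definition projection_valued_measure :: "(real set \<Rightarrow> 'h \<Rightarrow> 'h) \<Rightarrow> bool" where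
  "projection_valued_measure E \<longleftrightarrow>
     (\<forall>B\<in>sets borel. orthogonal_projection (E B)) \<and>
     E {} = (\<lambda>x. 0) \<and> E UNIV = id \<and>
     (\<forall>B\<in>sets borel. \<forall>C\<in>sets borel. E (B \<inter> C) = E B \<circ> E C) \<and>
     (\<forall>A :: nat \<Rightarrow> real set. range A \<subseteq> sets borel \<longrightarrow> disjoint_family A \<longrightarrow>
        (\<forall>x. (\<lambda>n. E (A n) x) sums E (\<Union>n. A n) x))"

text \<open>The measure \<open>B \<mapsto> \<langle>E(B) x, x\<rangle> = \<parallel>E(B) x\<parallel>\<^sup>2\<close>.\<close>

definition diag_measure :: "(real set \<Rightarrow> 'h \<Rightarrow> 'h) \<Rightarrow> 'h \<Rightarrow> real measure" where
  "diag_measure E x = measure_of UNIV (sets borel) (\<lambda>B. ennreal ((norm (E B x))\<^sup>2))"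

text \<open>\<open>T = \<integral> t dE(t)\<close>: the domain of \<open>T\<close> consists of the \<open>x\<close> with \<open>\<integral> t\<^sup>2 d\<langle>E(t) x, x\<rangle> < \<infinity>\<close>, on which
  \<open>\<langle>T x, x\<rangle> = \<integral> t d\<langle>E(t) x, x\<rangle>\<close>. By polarization these equations determine a symmetric \<open>T\<close>.\<close>

definition spectral_measure_of :: "'h operator \<Rightarrow> (real set \<Rightarrow> 'h \<Rightarrow> 'h) \<Rightarrow> bool" where
  "spectral_measure_of T E \<longleftrightarrow>
     projection_valued_measure E \<and>
     Domain T = {x. integrable (diag_measure E x) (\<lambda>t. t\<^sup>2)} \<and>
     (\<forall>(x, y)\<in>T. ip y x = of_real (\<integral>t. t \<partial>diag_measure E x))"

text \<open>The spectral projection \<open>\<chi>\<^sub>B(T)\<close> of a selfadjoint operator \<open>T\<close> for a Borel set \<open>B\<close>.\<close>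

definition spectral_proj :: "real set \<Rightarrow> 'h operator \<Rightarrow> 'h \<Rightarrow> 'h" where
  "spectral_proj B T = (THE P. \<exists>E. spectral_measure_of T E \<and> P = E B)"

definition sf_partition ::
    "(real \<Rightarrow> 'h operator) \<Rightarrow> nat \<Rightarrow> (nat \<Rightarrow> real) \<Rightarrow> (nat \<Rightarrow> real) \<Rightarrow> bool" where
  "sf_partition \<A> N \<tau> a \<longleftrightarrow>
     \<tau> 0 = 0 \<and> \<tau> N = 1 \<and>
     (\<forall>i\<in>{1..N}. \<tau> (i - 1) < \<tau> i \<and> a i > 0 \<and>
       (\<forall>t\<in>{\<tau> (i - 1)..\<tau> i}.
          of_real (a i) \<notin> spectrum (\<A> t) \<and> of_real (- a i) \<notin> spectrum (\<A> t) \<and>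
          of_real ` {- a i..a i} \<inter> ess_spectrum (\<A> t) = {} \<and>
          ((\<lambda>u. onorm (\<lambda>x. spectral_proj {- a i..a i} (\<A> u) x - spectral_proj {- a i..a i} (\<A> t) x))
             \<longlongrightarrow> 0) (at t within {\<tau> (i - 1)..\<tau> i})))"

text \<open>Dimensions are taken over \<open>'k\<close>. The description is meaningful because every path in \<open>CFsa\<close> has
  such a partition and the sum does not depend on it.\<close>

definition sf :: "(real \<Rightarrow> 'h operator) \<Rightarrow> int" where
  "sf \<A> = (THE n. \<exists>N \<tau> a. sf_partition \<A> N \<tau> a \<and>
     n = (\<Sum>i = 1..N. int (local.dim (range (spectral_proj {0..a i} (\<A> (\<tau> i)))))
                     - int (local.dim (range (spectral_proj {0..a i} (\<A> (\<tau> (i - 1))))))))"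

end

end

theory Submission
  imports Defs "HOL-Probability.Probability"
begin

text \<open>For \<open>\<alpha> < \<beta>\<close> outside the spectrum of \<open>T\<close>, the projection \<open>\<chi>\<^bsub>[\<alpha>,\<beta>]\<^esub>(S)\<close> is Lipschitz close to
  \<open>\<chi>\<^bsub>[\<alpha>,\<beta>]\<^esub>(T)\<close> in the gap distance: \<open>T - m\<close>, with \<open>m\<close> the midpoint, is bounded on the spectral
  subspace and bounded below by a larger constant on its complement, and the gap controls the
  passage from \<open>T\<close> to \<open>S\<close>. Hence, writing \<open>n(T, a) = dim im \<chi>\<^bsub>[0,a]\<^esub>(T)\<close>, the admissible \<open>a\<close> form an
  open condition on \<open>T\<close> and the differences \<open>n(T, a) - n(T, b)\<close> are locally constant. This makes the
  spectral flow independent of the partition. For nearby loops one partition serves all of them,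
  and as the loops are closed, the sum can be regrouped into differences \<open>n(T, a) - n(T, b)\<close> at the
  division points; so the spectral flow is locally constant in the homotopy parameter.

  The spectral measure of a selfadjoint \<open>T\<close> with closed range is the image of the one of its bounded
  pseudo-inverse. For a bounded operator \<open>0 \<le> A \<le> 1\<close> the scalar measures come from the Hausdorff
  moment problem for the moments \<open>\<langle>A\<^sup>n x, x\<rangle>\<close>, and the projections are limits of polynomials in \<open>A\<close>.\<close>


section \<open>Hilbert space geometry\<close>

text \<open>Both \<open>spectral_proj\<close> and \<open>sf\<close> are defined by
  \<open>THE\<close>, so they carry meaning only after existence and uniqueness are shown.
  Uniqueness of the spectral projections of intervals is the gap estimate applied to two spectral
  measures of one operator, where the gap is 0. As the scalars may be real, neither a resolvent at a
  non-real point nor a contour integral for the projections is at hand. A Fredholm operator is known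
  in advance to be invertible only off its kernel, hence the pseudo-inverse; and projections are
  compared through norm bounds for \<open>T - m\<close> with real \<open>m\<close>. That estimate
  sets a closed interval against a strictly larger open one, since the difference of the radii
  absorbs a term; spectral gaps at the end points provide this room. The number
  \<open>n(T, a)\<close> itself jumps when an eigenvalue passes through 0. In
  \<open>n(T, a) - n(T, b)\<close> the end at 0 cancels and only spectrum between two positive
  resolvent points is counted, which is why differences are the locally constant quantity.\<close>

lemma to_complex_0 [simp]: "to_complex 0 = 0"
  using norm_to_complex[of 0] by simp

lemma to_complex_minus: "to_complex (- a) = - to_complex a"
  using to_complex_add[of a "- a"] by (simp add: eq_neg_iff_add_eq_0 add.commute)

lemma to_complex_diff: "to_complex (a - b) = to_complex a - to_complex b"
  using to_complex_add[of a "- b"] by (simp add: to_complex_minus)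

lemma to_complex_1 [simp]: "to_complex 1 = 1"
proof -
  have "to_complex (1::'a) \<noteq> 0" by (metis norm_to_complex norm_one norm_zero zero_neq_one)
  moreover have "to_complex (1::'a) * to_complex (1::'a) = to_complex (1::'a)"
    by (simp flip: to_complex_mult)
  ultimately show ?thesis by simp
qed

lemma to_complex_of_real [simp]: "to_complex (of_real r) = of_real r"
  by (simp add: of_real_def to_complex_scaleR)

lemma to_complex_eq_iff: "to_complex a = to_complex b \<longleftrightarrow> a = b"
  using inj_to_complex by (auto dest: injD)

lemma sconj_add: "sconj (a + b) = sconj a + sconj b"
  and sconj_mult: "sconj (a * b) = sconj a * sconj b"
  and sconj_sconj [simp]: "sconj (sconj a) = a"
  and sconj_of_real [simp]: "sconj (of_real r) = of_real r"
  and sconj_zero [simp]: "sconj 0 = 0"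
  and sconj_diff: "sconj (a - b) = sconj a - sconj b"
  by (simp_all flip: to_complex_eq_iff
      add: to_complex_add to_complex_mult to_complex_sconj to_complex_diff)

lemma norm_sconj [simp]: "norm (sconj a) = norm a"
  by (metis complex_mod_cnj norm_to_complex to_complex_sconj)

lemma mult_sconj:
  fixes a :: "'a::real_or_complex"
  shows "a * sconj a = of_real ((norm a)\<^sup>2)"
proof -
  have "to_complex (a * sconj a) = to_complex (of_real ((norm a)\<^sup>2) :: 'a)"
    using complex_norm_square[of "to_complex a"]
    by (simp only: to_complex_mult to_complex_sconj to_complex_of_real norm_to_complex)
  then show ?thesis by (simp only: to_complex_eq_iff)
qed

context hilbert_space
begin

lemma ip_add_right: "ip x (y + z) = ip x y + ip x z"
  by (metis ip_add_left ip_sconj sconj_add)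

lemma ip_scale_right: "ip x (c *\<^sub>K y) = sconj c * ip x y"
  by (metis ip_scale_left ip_sconj sconj_mult)

lemma ip_scaleR_left: "ip (r *\<^sub>R x) y = r *\<^sub>R ip x y"
  by (metis ip_scale_left scale_of_real scaleR_conv_of_real)

lemma ip_scaleR_right: "ip x (r *\<^sub>R y) = r *\<^sub>R ip x y"
  by (metis ip_scale_right scale_of_real scaleR_conv_of_real sconj_of_real)

lemma ip_zero_left [simp]: "ip 0 y = 0"
  using ip_add_left[of 0 0 y] by simp

lemma ip_zero_right [simp]: "ip x 0 = 0"
  using ip_add_right[of x 0 0] by simp

lemma ip_minus_left: "ip (- x) y = - ip x y"
  using ip_add_left[of x "- x" y] by (simp add: eq_neg_iff_add_eq_0 add.commute)

lemma ip_minus_right: "ip x (- y) = - ip x y"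
  using ip_add_right[of x y "- y"] by (simp add: eq_neg_iff_add_eq_0 add.commute)

lemma ip_diff_left: "ip (x - y) z = ip x z - ip y z"
  using ip_add_left[of x "- y" z] by (simp add: ip_minus_left)

lemma ip_diff_right: "ip x (y - z) = ip x y - ip x z"
  using ip_add_right[of x y "- z"] by (simp add: ip_minus_right)

lemma ip_commute_zero: "ip x y = 0 \<longleftrightarrow> ip y x = 0"
  by (metis ip_sconj sconj_zero)

lemma cauchy_schwarz: "norm (ip x y) \<le> norm x * norm y"
proof (cases "y = 0")
  case False
  define a where "a = ip x y"
  define s where "s = (norm y)\<^sup>2"
  have yx: "ip y x = sconj a" by (simp add: a_def ip_sconj[of y x])
  \<comment> \<open>\<open>?z\<close> is \<open>s\<close> times the component of \<open>x\<close>
    orthogonal to \<open>y\<close>; the factor \<open>s\<close> avoids a division.\<close>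
  let ?z = "of_real s *\<^sub>K x - a *\<^sub>K y"
  have "ip ?z ?z = of_real s * of_real s * of_real ((norm x)\<^sup>2) - of_real s * (a * sconj a)"
    by (simp add: ip_diff_left ip_diff_right ip_scale_left ip_scale_right ip_self[of x] ip_self[of y] yx
        flip: a_def s_def) (simp add: algebra_simps)
  also have "\<dots> = of_real (s * (s * (norm x)\<^sup>2 - (norm a)\<^sup>2))"
    by (simp add: mult_sconj algebra_simps)
  finally have "(norm ?z)\<^sup>2 = s * (s * (norm x)\<^sup>2 - (norm a)\<^sup>2)"
    unfolding ip_self of_real_eq_iff .
  moreover have "s > 0" using False by (simp add: s_def)
  ultimately have "0 \<le> s * (norm x)\<^sup>2 - (norm a)\<^sup>2"
    by (metis mult_less_0_iff not_le zero_le_power2 order_less_imp_not_less)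
  then have "(norm a)\<^sup>2 \<le> (norm x * norm y)\<^sup>2"
    by (simp add: s_def power_mult_distrib algebra_simps)
  then show ?thesis unfolding a_def by (rule power2_le_imp_le) simp
qed simp

lemma bounded_bilinear_ip: "bounded_bilinear ip"
  by (intro bounded_bilinear.intro exI[of _ 1])
     (simp_all add: ip_add_left ip_add_right ip_scaleR_left ip_scaleR_right cauchy_schwarz)

lemmas tendsto_ip [tendsto_intros] = bounded_bilinear.tendsto[OF bounded_bilinear_ip]
lemmas continuous_on_ip [continuous_intros] = bounded_bilinear.continuous_on[OF bounded_bilinear_ip]

text \<open>A real-valued symmetric form for either scalar field, so that norm expansions, order and
  integrals are handled uniformly; \<open>rip_sconj_scale\<close> leads back to
  \<open>ip\<close>.\<close>

definition rip :: "'h \<Rightarrow> 'h \<Rightarrow> real" where "rip x y = Re (to_complex (ip x y))"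

lemma rip_add_left: "rip (x + y) z = rip x z + rip y z"
  and rip_add_right: "rip x (y + z) = rip x y + rip x z"
  and rip_diff_left: "rip (x - y) z = rip x z - rip y z"
  and rip_diff_right: "rip x (y - z) = rip x y - rip x z"
  and rip_scaleR_left: "rip (r *\<^sub>R x) y = r * rip x y"
  and rip_scaleR_right: "rip x (r *\<^sub>R y) = r * rip x y"
  and rip_zero_left [simp]: "rip 0 y = 0"
  and rip_zero_right [simp]: "rip x 0 = 0"
  by (simp_all add: rip_def ip_add_left ip_add_right ip_diff_left ip_diff_right ip_scaleR_left
      ip_scaleR_right to_complex_add to_complex_diff to_complex_scaleR)

lemma rip_self: "rip x x = (norm x)\<^sup>2"
  unfolding rip_def ip_self to_complex_of_real by simp

lemma rip_commute: "rip x y = rip y x"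
  unfolding rip_def by (subst ip_sconj) (simp add: to_complex_sconj)

lemma rip_le: "\<bar>rip x y\<bar> \<le> norm x * norm y"
proof -
  have "\<bar>rip x y\<bar> \<le> norm (ip x y)"
    unfolding rip_def by (metis abs_Re_le_cmod norm_to_complex)
  then show ?thesis using cauchy_schwarz[of x y] by linarith
qed

lemma rip_of_ip_eq: "ip x y = ip z w \<Longrightarrow> rip x y = rip z w"
  by (simp add: rip_def)

lemma rip_of_ip_0: "ip x y = 0 \<Longrightarrow> rip x y = 0"
  by (simp add: rip_def)

lemma bounded_bilinear_rip: "bounded_bilinear rip"
  by (intro bounded_bilinear.intro exI[of _ 1])
     (use rip_le in \<open>simp_all add: rip_add_left rip_add_right rip_scaleR_left rip_scaleR_right\<close>)

lemmas tendsto_rip [tendsto_intros] = bounded_bilinear.tendsto[OF bounded_bilinear_rip]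

lemma norm_add_sq: "(norm (x + y))\<^sup>2 = (norm x)\<^sup>2 + 2 * rip x y + (norm y)\<^sup>2"
  unfolding rip_self[symmetric] by (simp add: rip_add_left rip_add_right rip_commute[of y x])

lemma norm_diff_sq: "(norm (x - y))\<^sup>2 = (norm x)\<^sup>2 - 2 * rip x y + (norm y)\<^sup>2"
  unfolding rip_self[symmetric] by (simp add: rip_diff_left rip_diff_right rip_commute[of y x])

text \<open>Multiplying by the conjugate of \<open>ip x y\<close> lets the real part see the full
  modulus. Real orthogonality to all scalar multiples of a vector thereby becomes orthogonality for
  \<open>ip\<close>.\<close>

lemma rip_sconj_scale: "rip (sconj (ip x y) *\<^sub>K x) y = (norm (ip x y))\<^sup>2"
  unfolding rip_def ip_scale_left
  by (subst mult.commute) (simp add: mult_sconj del: of_real_power)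

lemma norm_scale: "norm (c *\<^sub>K x) = norm c * norm x"
proof -
  have "of_real ((norm (c *\<^sub>K x))\<^sup>2) = c * sconj c * ip x x"
    unfolding ip_self[symmetric] by (simp add: ip_scale_left ip_scale_right)
  also have "\<dots> = of_real ((norm c * norm x)\<^sup>2)"
    by (simp add: mult_sconj ip_self power_mult_distrib)
  finally have "(norm (c *\<^sub>K x))\<^sup>2 = (norm c * norm x)\<^sup>2" unfolding of_real_eq_iff .
  then show ?thesis by (simp add: power2_eq_iff_nonneg)
qed

lemma bounded_linear_scale: "bounded_linear (\<lambda>x. c *\<^sub>K x)"
proof (rule bounded_linear_intro[where K = "norm c"])
  show "c *\<^sub>K (r *\<^sub>R x) = r *\<^sub>R (c *\<^sub>K x)" for r x
    by (metis mult.commute scale_of_real scale_scale)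
qed (simp_all add: scale_right_distrib norm_scale mult.commute)

lemma scale_scaleR_commute: "c *\<^sub>K (r *\<^sub>R x) = r *\<^sub>R (c *\<^sub>K x)"
  using bounded_linear_scale by (rule linear_scale[OF bounded_linear.linear])

lemma subspace_scaleR: "subspace M \<Longrightarrow> x \<in> M \<Longrightarrow> r *\<^sub>R x \<in> M"
  by (metis scale_of_real subspace_scale)

section \<open>Orthogonal projections onto closed subspaces\<close>

theorem projection_exists:
  assumes M: "subspace M" "closed M"
  obtains p where "p \<in> M" "\<forall>w\<in>M. ip (x - p) w = 0"
proof -
  have M0: "M \<noteq> {}" using M(1) subspace_0 by blast
  define d where "d = infdist x M"
  have dle: "d \<le> norm (x - m)" if "m \<in> M" for m
    using infdist_le[OF that, of x] by (simp add: d_def dist_norm)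
  have d0: "d \<ge> 0" by (simp add: d_def infdist_nonneg)
  have "\<exists>m\<in>M. norm (x - m) < d + 1 / Suc n" for n
  proof (rule ccontr)
    assume "\<not> ?thesis"
    then have "d + 1 / Suc n \<le> infdist x M"
      unfolding infdist_notempty[OF M0] using M0 by (intro cINF_greatest) (auto simp: dist_norm not_less)
    then show False by (simp add: d_def)
  qed
  then obtain m where m: "\<And>n. m n \<in> M" "\<And>n. norm (x - m n) < d + 1 / Suc n" by metis
  have lim: "(\<lambda>n. (norm (x - m n))\<^sup>2) \<longlonglongrightarrow> d\<^sup>2"
  proof (rule tendsto_power, rule tendsto_sandwich[where f = "\<lambda>n. d" and h = "\<lambda>n. d + 1 / Suc n"])
    show "(\<lambda>n. d + 1 / Suc n) \<longlonglongrightarrow> d"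
      using tendsto_add[OF tendsto_const[of d] LIMSEQ_inverse_real_of_nat] by (simp add: inverse_eq_divide)
    show "(\<lambda>n. d) \<longlonglongrightarrow> d" by simp
    show "\<forall>\<^sub>F n in sequentially. d \<le> norm (x - m n)"
      using m(1) dle by (intro always_eventually) blast
    show "\<forall>\<^sub>F n in sequentially. norm (x - m n) \<le> d + 1 / Suc n"
      using m(2) by (intro always_eventually) (blast intro: less_imp_le)
  qed
  \<comment> \<open>Parallelogram law for \<open>x - m a\<close> and \<open>x - m b\<close>: their
    mean \<open>x - ?c\<close> has norm at least \<open>d\<close>, as \<open>?c\<close> lies in
    \<open>M\<close>. Hence the minimising sequence is Cauchy.\<close>
  have par: "(norm (m a - m b))\<^sup>2 \<le> 2 * (norm (x - m a))\<^sup>2 + 2 * (norm (x - m b))\<^sup>2 - 4 * d\<^sup>2" for a b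
  proof -
    let ?c = "(1/2) *\<^sub>R (m a + m b)"
    have "?c \<in> M" using m M(1) by (intro subspace_scaleR) (auto intro: subspace_add)
    then have "d\<^sup>2 \<le> (norm (x - ?c))\<^sup>2" using dle d0 by (intro power_mono) auto
    moreover have "x - ?c = (1/2) *\<^sub>R ((x - m a) + (x - m b))" by (simp add: algebra_simps flip: scaleR_add_left)
    then have "(norm (x - ?c))\<^sup>2 = (norm ((x - m a) + (x - m b)))\<^sup>2 / 4"
      by (simp add: power_divide)
    moreover have "m a - m b = (x - m b) - (x - m a)" by simp
    then have "(norm (m a - m b))\<^sup>2 = (norm ((x - m b) - (x - m a)))\<^sup>2" by simp
    ultimately show ?thesis
      unfolding norm_add_sq norm_diff_sq by (simp add: rip_commute[of "x - m b"])
  qed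
  have "Cauchy m"
  proof (rule CauchyI)
    fix e :: real assume "e > 0"
    then have "d\<^sup>2 < d\<^sup>2 + e\<^sup>2 / 4" by simp
    from order_tendstoD(2)[OF lim this]
    obtain N where N: "\<And>n. n \<ge> N \<Longrightarrow> (norm (x - m n))\<^sup>2 < d\<^sup>2 + e\<^sup>2 / 4"
      by (auto simp: eventually_sequentially)
    have "norm (m a - m b) < e" if "a \<ge> N" "b \<ge> N" for a b
      using par[of a b] N[OF that(1)] N[OF that(2)] \<open>e > 0\<close>
      by (intro power2_less_imp_less[of _ e]) auto
    then show "\<exists>N. \<forall>a\<ge>N. \<forall>b\<ge>N. norm (m a - m b) < e" by blast
  qed
  then obtain p where p: "m \<longlonglongrightarrow> p" by (meson Cauchy_convergent convergent_def)
  have pM: "p \<in> M" using closed_sequentially[OF M(2) _ p] m by blast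
  have "(\<lambda>n. (norm (x - m n))\<^sup>2) \<longlonglongrightarrow> (norm (x - p))\<^sup>2" by (intro tendsto_intros p)
  then have dp: "(norm (x - p))\<^sup>2 = d\<^sup>2" using lim LIMSEQ_unique by blast
  have orth: "rip (x - p) w = 0" if w: "w \<in> M" for w
  proof (cases "w = 0")
    case False
    \<comment> \<open>This \<open>r\<close> minimises the norm of \<open>x - p\<close> minus
      \<open>r\<close> times \<open>w\<close>; the minimum would beat \<open>d\<close> unless
      \<open>rip (x - p) w = 0\<close>.\<close>
    define r where "r = rip (x - p) w / (norm w)\<^sup>2"
    have "p + r *\<^sub>R w \<in> M" using pM w M(1) by (auto intro: subspace_add subspace_scaleR)
    then have "d\<^sup>2 \<le> (norm ((x - p) - r *\<^sub>R w))\<^sup>2"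
      using dle d0 by (intro power_mono) (auto simp: algebra_simps)
    also have "\<dots> = d\<^sup>2 - 2 * r * rip (x - p) w + r\<^sup>2 * (norm w)\<^sup>2"
      unfolding norm_diff_sq[of "x - p"] dp rip_scaleR_right by (simp add: power_mult_distrib)
    also have "\<dots> = d\<^sup>2 - (rip (x - p) w)\<^sup>2 / (norm w)\<^sup>2"
      using False by (simp add: r_def power2_eq_square field_simps)
    finally have "(rip (x - p) w)\<^sup>2 / (norm w)\<^sup>2 \<le> 0" by simp
    then have "(rip (x - p) w)\<^sup>2 \<le> 0" using False by (simp add: divide_le_0_iff)
    then show ?thesis by simp
  qed simp
  have "ip (x - p) w = 0" if "w \<in> M" for w
  proof -
    have "rip (sconj (ip w (x - p)) *\<^sub>K w) (x - p) = 0"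
      using orth[of "sconj (ip w (x - p)) *\<^sub>K w"] that M(1) rip_commute subspace_scale by metis
    then show ?thesis unfolding rip_sconj_scale using ip_commute_zero by simp
  qed
  then show ?thesis using that pM by blast
qed

lemma projection_unique:
  assumes "subspace M" "p \<in> M" "\<forall>w\<in>M. ip (x - p) w = 0" "q \<in> M" "\<forall>w\<in>M. ip (x - q) w = 0"
  shows "p = q"
proof -
  have pq: "p - q \<in> M" using assms subspace_diff by blast
  have "ip (p - q) (p - q) = ip (x - q) (p - q) - ip (x - p) (p - q)"
    by (simp add: ip_diff_left)
  also have "\<dots> = 0" using assms pq by simp
  finally have "rip (p - q) (p - q) = 0" by (simp add: rip_def)
  then show ?thesis by (simp add: rip_self)
qed

text \<open>The formula is that of \<open>graph_proj\<close>, so the latter becomes an instance once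
  \<open>H \<times> H\<close> is known to be a Hilbert space.\<close>

definition proj :: "'h set \<Rightarrow> 'h \<Rightarrow> 'h" where
  "proj M x = (THE p. p \<in> M \<and> (\<forall>w\<in>M. ip (x - p) w = 0))"

lemma proj_eqI:
  assumes "subspace M" "p \<in> M" "\<And>w. w \<in> M \<Longrightarrow> ip (x - p) w = 0"
  shows "proj M x = p"
  unfolding proj_def using assms projection_unique by (intro the_equality) blast+

lemma
  assumes "subspace M" "closed M"
  shows proj_in: "proj M x \<in> M" and proj_orth: "w \<in> M \<Longrightarrow> ip (x - proj M x) w = 0"
proof -
  obtain p where p: "p \<in> M" "\<forall>w\<in>M. ip (x - p) w = 0" using projection_exists[OF assms] by blast
  have "proj M x = p" using p assms(1) by (intro proj_eqI) auto
  then show "proj M x \<in> M" "w \<in> M \<Longrightarrow> ip (x - proj M x) w = 0" using p by auto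
qed

lemma orthogonal_projection_proj:
  assumes M: "subspace M" "closed M"
  shows "orthogonal_projection (proj M)"
  unfolding orthogonal_projection_def
proof (intro conjI allI)
  note pin = proj_in[OF M] and po = proj_orth[OF M]
  show "proj M (x + y) = proj M x + proj M y" for x y
  proof (rule proj_eqI[OF M(1)])
    show "proj M x + proj M y \<in> M" using pin M(1) subspace_add by blast
    have "x + y - (proj M x + proj M y) = (x - proj M x) + (y - proj M y)" by simp
    then show "w \<in> M \<Longrightarrow> ip (x + y - (proj M x + proj M y)) w = 0" for w
      using po by (simp only: ip_add_left) simp
  qed
  show "proj M (c *\<^sub>K x) = c *\<^sub>K proj M x" for c x
  proof (rule proj_eqI[OF M(1)])
    show "c *\<^sub>K proj M x \<in> M" using pin M(1) subspace_scale by blast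
    show "w \<in> M \<Longrightarrow> ip (c *\<^sub>K x - c *\<^sub>K proj M x) w = 0" for w
      using po by (simp add: ip_scale_left flip: scale_right_diff_distrib)
  qed
  show "proj M (proj M x) = proj M x" for x
    using pin by (intro proj_eqI[OF M(1)]) auto
  show "ip (proj M x) y = ip x (proj M y)" for x y
  proof -
    have "ip (x - proj M x) (proj M y) = 0" using po pin by blast
    moreover have "ip (proj M x) (y - proj M y) = 0" using po pin ip_commute_zero by blast
    ultimately show ?thesis by (simp add: ip_diff_left ip_diff_right)
  qed
qed

lemma proj_id: "subspace M \<Longrightarrow> x \<in> M \<Longrightarrow> proj M x = x"
  by (intro proj_eqI) auto

section \<open>Algebra of a single orthogonal projection\<close>

context
  fixes P :: "'h \<Rightarrow> 'h"
  assumes P: "orthogonal_projection P"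
begin

lemma op_add: "P (x + y) = P x + P y"
  and op_scale: "P (c *\<^sub>K x) = c *\<^sub>K P x"
  and op_idem [simp]: "P (P x) = P x"
  and op_sym: "ip (P x) y = ip x (P y)"
  using P unfolding orthogonal_projection_def by blast+

lemma op_scaleR: "P (r *\<^sub>R x) = r *\<^sub>R P x"
  by (metis op_scale scale_of_real)

lemma op_diff: "P (x - y) = P x - P y"
  using op_add[of "x - y" y] by simp

lemma op_0 [simp]: "P 0 = 0"
  using op_diff[of 0 0] by simp

lemma op_rsym: "rip (P x) y = rip x (P y)"
  using op_sym by (rule rip_of_ip_eq)

lemma op_orth: "ip (P x) (y - P y) = 0"
  by (simp add: op_sym op_diff)

lemma op_pythagoras: "(norm x)\<^sup>2 = (norm (P x))\<^sup>2 + (norm (x - P x))\<^sup>2"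
  using norm_add_sq[of "P x" "x - P x"] rip_of_ip_0[OF op_orth[of x x]] by simp

lemma op_norm_sq: "(norm (P x))\<^sup>2 = rip (P x) x"
  by (metis op_idem op_rsym rip_self rip_commute)

lemma op_norm_le: "norm (P x) \<le> norm x"
  by (rule power2_le_imp_le) (use op_pythagoras[of x] in auto)

lemma op_co_norm_le: "norm (x - P x) \<le> norm x"
  by (rule power2_le_imp_le) (use op_pythagoras[of x] in auto)

lemma op_bounded_linear: "bounded_linear P"
  by (rule bounded_linear_intro[where K = 1]) (simp_all add: op_add op_scaleR op_norm_le)

lemma op_range: "range P = {x. P x = x}"
proof (intro set_eqI iffI)
  show "x \<in> {x. P x = x} \<Longrightarrow> x \<in> range P" for x using rangeI[of P x] by simp
qed auto

lemma op_range_subspace: "subspace (range P)"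
  unfolding op_range by (rule subspaceI) (simp_all add: op_add op_scale)

lemma op_co: "orthogonal_projection (\<lambda>x. x - P x)"
  unfolding orthogonal_projection_def
  by (simp add: op_add op_diff scale_right_diff_distrib op_scale ip_diff_left ip_diff_right op_sym)

end

text \<open>Equal ranges give \<open>P Q = Q\<close> and \<open>Q P = P\<close>; taking adjoints in
  the second gives \<open>P Q = P\<close>.\<close>

lemma orthogonal_projection_eqI:
  assumes P: "orthogonal_projection P" and Q: "orthogonal_projection Q" and "range P = range Q"
  shows "P = Q"
proof
  fix x
  have 1: "P (Q y) = Q y" "Q (P y) = P y" for y
    using op_range[OF P] op_range[OF Q] assms(3) by blast+
  have "ip (P x) w = ip (Q x) w" for w
  proof -
    have "ip (P x) w = ip x (Q (P w))" by (simp add: 1 op_sym[OF P])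
    also have "\<dots> = ip (P (Q x)) w" by (simp only: op_sym[OF P] op_sym[OF Q])
    finally show ?thesis by (simp add: 1)
  qed
  then have "ip (P x - Q x) (P x - Q x) = 0" by (simp add: ip_diff_left)
  then show "P x = Q x" using rip_of_ip_0[of "P x - Q x" "P x - Q x"] by (simp add: rip_self)
qed

lemma hilbert_space_product: "hilbert_space scale2 ip2"
proof (unfold_locales)
  show "scale2 c (x + y) = scale2 c x + scale2 c y" for c x y
    by (simp add: scale2_def scale_right_distrib)
  show "scale2 (c + d) x = scale2 c x + scale2 d x" for c d x
    by (simp add: scale2_def scale_left_distrib)
  show "scale2 c (scale2 d x) = scale2 (c * d) x" "scale2 1 x = x" for c d x
    by (simp_all add: scale2_def)
  show "ip2 (x + y) z = ip2 x z + ip2 y z" for x y z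
    by (simp add: ip2_def ip_add_left)
  show "ip2 (scale2 c x) z = c * ip2 x z" for c x z
    by (simp add: ip2_def scale2_def ip_scale_left distrib_left)
  show "ip2 y x = sconj (ip2 x y)" for x y
    unfolding ip2_def sconj_add by (simp only: ip_sconj[symmetric])
  show "ip2 x x = of_real ((norm x)\<^sup>2)" for x
    by (simp add: ip2_def norm_prod_def ip_self)
  show "scale2 (of_real r) x = r *\<^sub>R x" for r x
    by (simp add: scale2_def scale_of_real scaleR_prod_def)
qed

end


section \<open>The Hausdorff moment problem\<close>

lemma poly_continuous_on: "continuous_on X (poly (p :: real poly))"
  by (intro continuous_at_imp_continuous_on ballI poly_isCont)

lemma borel_measurable_poly [measurable]: "poly (p :: real poly) \<in> borel_measurable borel"
  by (intro borel_measurable_continuous_onI poly_continuous_on)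

lemma poly_bounded_unit:
  obtains B where "B \<ge> 0" "\<And>t. t \<in> {0..1} \<Longrightarrow> \<bar>poly (p :: real poly) t\<bar> \<le> B"
proof -
  have "bounded (poly p ` {0..1})"
    by (intro compact_imp_bounded compact_continuous_image poly_continuous_on compact_Icc)
  then obtain b where "b > 0" "\<forall>x\<in>{0..1}. \<bar>poly p x\<bar> \<le> b" by (auto simp: bounded_pos)
  then show ?thesis by (intro that[of b]) auto
qed

abbreviation (input) bern :: "nat \<Rightarrow> nat \<Rightarrow> real poly" where
  "bern k l \<equiv> [:0, 1:] ^ k * [:1, - 1:] ^ l"

text \<open>The binomial theorem for the power \<open>n - j\<close> of
  \<open>X + (1 - X) = 1\<close>, multiplied by \<open>X^j\<close>. The weights
  \<open>(k choose j) / (n choose j)\<close> are nearly \<open>(k / n)^j\<close>, so this is an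
  exact version of the Bernstein approximation of \<open>X^j\<close>.\<close>

lemma sum_bern:
  assumes "j \<le> n"
  shows "(\<Sum>k\<le>n. smult (real (n choose k) * (real (k choose j) / real (n choose j))) (bern k (n - k)))
     = [:0, 1:] ^ j"
proof -
  have nj: "real (n choose j) \<noteq> 0" using assms by simp
  have "(\<Sum>k\<le>n. smult (real (n choose k) * (real (k choose j) / real (n choose j))) (bern k (n - k)))
     = (\<Sum>k\<in>{j..n}. smult (real (n choose k) * (real (k choose j) / real (n choose j))) (bern k (n - k)))"
    by (rule sum.mono_neutral_right) (auto simp: not_le binomial_eq_0)
  also have "\<dots> = (\<Sum>k\<in>{j..n}. smult (real ((n - j) choose (k - j))) (bern k (n - k)))"
  proof (intro sum.cong refl)
    fix k assume k: "k \<in> {j..n}"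
    have "real (n choose k) * real (k choose j) = real (n choose j) * real ((n - j) choose (k - j))"
      using choose_mult[of j k n] k by (metis atLeastAtMost_iff of_nat_mult)
    then have "real (n choose k) * (real (k choose j) / real (n choose j)) = real ((n - j) choose (k - j))"
      using nj by (simp add: field_simps)
    then show "smult (real (n choose k) * (real (k choose j) / real (n choose j))) (bern k (n - k))
      = smult (real ((n - j) choose (k - j))) (bern k (n - k))" by simp
  qed
  also have "\<dots> = (\<Sum>i\<le>n - j. smult (real ((n - j) choose i)) (bern (i + j) (n - (i + j))))"
    using assms by (intro sum.reindex_bij_witness[of _ "\<lambda>i. i + j" "\<lambda>k. k - j"]) auto
  also have "\<dots> = [:0, 1:] ^ j * (\<Sum>i\<le>n - j. of_nat ((n - j) choose i) * [:0, 1:] ^ i * [:1, - 1:] ^ (n - j - i))"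
    unfolding sum_distrib_left
    by (intro sum.cong refl) (simp add: power_add of_nat_poly algebra_simps)
  also have "\<dots> = [:0, 1:] ^ j * ([:0, 1:] + [:1, - 1:]) ^ (n - j)"
    by (simp only: binomial_ring)
  also have "[:0, 1:] + [:1, - 1:] = (1 :: real poly)" by (simp add: one_pCons)
  finally show ?thesis by simp
qed

text \<open>The ratio is the product over \<open>i < j\<close> of \<open>(k - i) / (n - i)\<close>,
  each factor being within \<open>j / (n - j)\<close> of \<open>k / n\<close>; products of numbers
  of modulus at most 1 differ by at most the sum of the differences of the factors.\<close>

lemma binomial_ratio_close:
  assumes kn: "k \<le> n" and jn: "2 * j < n"
  shows "\<bar>(real k / real n) ^ j - real (k choose j) / real (n choose j)\<bar> \<le> real j * (real j / (real n - real j))"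
proof -
  have "real (k choose j) / real (n choose j) = (\<Prod>i\<in>{0..<j}. (real k - real i) / (real n - real i))"
    unfolding binomial_gbinomial gbinomial_altdef_of_nat prod_dividef[symmetric]
    by (intro prod.cong refl) (auto simp: divide_simps)
  then have "\<bar>(real k / real n) ^ j - real (k choose j) / real (n choose j)\<bar>
     = norm ((\<Prod>i\<in>{0..<j}. real k / real n) - (\<Prod>i\<in>{0..<j}. (real k - real i) / (real n - real i)))"
    by simp
  \<comment> \<open>For \<open>k < i\<close> the factor is negative; \<open>2 * j < n\<close> keeps
    its modulus at most 1.\<close>
  also have "\<dots> \<le> (\<Sum>i\<in>{0..<j}. norm (real k / real n - (real k - real i) / (real n - real i)))"
    using kn jn by (intro norm_prod_diff) (auto simp: divide_simps abs_if)
  also have "\<dots> \<le> (\<Sum>i\<in>{0..<j}. real j / (real n - real j))"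
  proof (intro sum_mono)
    fix i assume "i \<in> {0..<j}"
    then have i: "i < j" by simp
    have pos: "real n > 0" "real n - real i > 0" "real n - real j > 0" using i jn by auto
    have "real k / real n - (real k - real i) / (real n - real i)
        = (real i * (real n - real k)) / (real n * (real n - real i))"
      using pos by (simp add: divide_simps) (simp add: algebra_simps)
    then have "norm (real k / real n - (real k - real i) / (real n - real i))
        = (real i * (real n - real k)) / (real n * (real n - real i))"
      using pos kn by simp
    also have "\<dots> \<le> (real i * real n) / (real n * (real n - real i))"
      using pos by (intro divide_right_mono mult_left_mono) auto
    also have "\<dots> = real i / (real n - real i)" using pos by simp
    also have "\<dots> \<le> real j / (real n - real j)"
      using pos i by (intro frac_le) auto
    finally show "norm (real k / real n - (real k - real i) / (real n - real i)) \<le> real j / (real n - real j)" .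
  qed
  also have "\<dots> = real j * (real j / (real n - real j))" by simp
  finally show ?thesis .
qed

text \<open>The Hausdorff moment problem: the measures with mass \<open>(n choose k) L (X^k (1 - X)^(n-k))\<close> at
  \<open>k / n\<close> have the right moments in the limit, and Helly's theorem provides a limit measure.\<close>

theorem hausdorff_moment:
  fixes L :: "real poly \<Rightarrow> real"
  assumes L_add: "\<And>p q. L (p + q) = L p + L q" and L_smult: "\<And>c p. L (smult c p) = c * L p"
    and L_pos: "\<And>k l. 0 \<le> L (bern k l)" and L_1: "L 1 = 1"
  shows "\<exists>M. prob_space M \<and> sets M = sets borel \<and> (AE t in M. t \<in> {0..1}) \<and>
    (\<forall>p. integral\<^sup>L M (poly p) = L p)"
proof -
  have L_0: "L 0 = 0" using L_smult[of 0 0] by simp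
  have L_sum: "L (\<Sum>i\<in>I. p i) = (\<Sum>i\<in>I. L (p i))" if "finite I" for I :: "nat set" and p
    using that by (induction rule: finite_induct) (simp_all add: L_0 L_add)
  define w where "w n k = real (n choose k) * L (bern k (n - k))" for n k
  have w0: "w n k \<ge> 0" for n k by (simp add: w_def L_pos)
  have mom: "(\<Sum>k\<le>n. w n k * (real (k choose j) / real (n choose j))) = L ([:0, 1:] ^ j)" if "j \<le> n" for n j
    unfolding sum_bern[OF that, symmetric]
    by (subst L_sum) (simp_all add: L_smult w_def mult_ac)
  have w1: "(\<Sum>k\<le>n. w n k) = 1" for n using mom[of 0 n] L_1 by simp
  define N where "N n = distr (point_measure {..n} (\<lambda>k. ennreal (w n k))) borel (\<lambda>k. real k / real n)" for n
  have intN: "integral\<^sup>L (N n) f = (\<Sum>k\<le>n. w n k * f (real k / real n))"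
    if "f \<in> borel_measurable borel" for n and f :: "real \<Rightarrow> real"
    unfolding N_def using that w0
    by (subst integral_distr) (auto simp: lebesgue_integral_point_measure_finite sets_point_measure)
  have emN: "emeasure (N n) X = 1" if "X \<in> sets borel" "{0..1} \<subseteq> X" for n X
  proof -
    have "(\<lambda>k. real k / real n) -` X \<inter> {..n} = {..n}"
      by (auto intro!: subsetD[OF that(2)] simp: divide_le_eq_1)
    then show ?thesis
      unfolding N_def using that(1) w0 w1[of n]
      by (subst emeasure_distr) (auto simp: space_point_measure emeasure_point_measure_finite sum_ennreal)
  qed
  have rd: "real_distribution (N n)" for n
    by (auto simp: real_distribution_def real_distribution_axioms_def intro!: prob_spaceI)
       (use emN[of UNIV n] in \<open>simp_all add: N_def\<close>)
  have "tight N"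
    unfolding tight_def
  proof (intro conjI allI impI rd)
    fix e :: real assume "e > 0"
    have "measure (N n) {- 1<..2} = 1" for n using emN[of "{- 1<..2}" n] by (auto simp: measure_def subset_iff)
    then show "\<exists>a b. a < b \<and> (\<forall>n. 1 - e < measure (N n) {a<..b})"
      using \<open>e > 0\<close> by (intro exI[of _ "- 1"] exI[of _ 2]) simp
  qed
  from tight_imp_convergent_subsubsequence[OF this strict_mono_id]
  obtain r M where r: "strict_mono r" and M: "real_distribution M"
    and wc: "weak_conv_m (N \<circ> r) M" by (auto simp: o_def)
  interpret M: real_distribution M by (rule M)
  have lim: "(\<lambda>n. integral\<^sup>L (N (r n)) f) \<longlonglongrightarrow> integral\<^sup>L M f"
    if "\<And>x. isCont f x" "\<And>x. norm (f x) \<le> B" for f :: "real \<Rightarrow> real" and B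
    using weak_conv_imp_integral_bdd_continuous_conv[of "N \<circ> r" M f B] rd M wc that
    by (simp add: o_def)
  \<comment> \<open>Clamping to \<open>{0..1}\<close> makes powers bounded and continuous on the
    whole line, as weak convergence requires, without changing them at the atoms
    \<open>k / n\<close>.\<close>
  define cl where "cl t = max 0 (min 1 t)" for t :: real
  have cl: "isCont cl t" "0 \<le> cl t" "cl t \<le> 1" for t
    unfolding cl_def by (auto intro!: continuous_intros)
  have clm [measurable]: "cl \<in> borel_measurable borel"
    using cl(1) by (intro borel_measurable_continuous_onI continuous_at_imp_continuous_on) auto
  have clk: "cl (real k / real n) = real k / real n" if "k \<le> n" for k n
  proof -
    have "real k / real n \<le> 1" using that by (auto simp: divide_le_eq_1)
    then show ?thesis by (simp add: cl_def)
  qed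
  have AE: "AE t in M. t \<in> {0..1}"
  proof -
    let ?f = "\<lambda>t. min 1 \<bar>t - cl t\<bar>"
    have "(\<lambda>n. integral\<^sup>L (N (r n)) ?f) \<longlonglongrightarrow> integral\<^sup>L M ?f"
      by (rule lim[of _ 1]) (auto intro!: continuous_intros cl)
    moreover have "integral\<^sup>L (N (r n)) ?f = 0" for n
      by (subst intN) (auto simp: clk)
    ultimately have "integral\<^sup>L M ?f = 0" by (simp add: LIMSEQ_const_iff)
    moreover have "integrable M ?f"
      by (rule M.integrable_const_bound[where B = 1]) auto
    ultimately have "AE t in M. ?f t = 0"
      by (subst (asm) integral_nonneg_eq_0_iff_AE) auto
    then show ?thesis by (rule AE_mp) (auto intro!: AE_I2 simp: cl_def min_def max_def split: if_splits)
  qed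
  have intg: "integrable M (poly p)" for p
  proof -
    obtain B where "\<And>t. t \<in> {0..1} \<Longrightarrow> \<bar>poly p t\<bar> \<le> B" using poly_bounded_unit by blast
    then show ?thesis using AE by (intro M.integrable_const_bound[where B = B]) auto
  qed
  have pow: "integral\<^sup>L M (\<lambda>t. t ^ j) = L ([:0, 1:] ^ j)" for j
  proof -
    have "(\<lambda>n. integral\<^sup>L (N (r n)) (\<lambda>t. cl t ^ j)) \<longlonglongrightarrow> integral\<^sup>L M (\<lambda>t. cl t ^ j)"
      by (rule lim[of _ 1]) (use cl in \<open>auto intro!: continuous_intros power_le_one simp: power_abs abs_of_nonneg\<close>)
    moreover have "(\<lambda>n. integral\<^sup>L (N n) (\<lambda>t. cl t ^ j)) \<longlonglongrightarrow> L ([:0, 1:] ^ j)"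
    proof (subst Lim_null)
      let ?b = "\<lambda>n. real j * (real j / (real n - real j))"
      show "(\<lambda>n. integral\<^sup>L (N n) (\<lambda>t. cl t ^ j) - L ([:0, 1:] ^ j)) \<longlonglongrightarrow> 0"
      proof (rule Lim_null_comparison)
        \<comment> \<open>By \<open>mom\<close> the functional value is the same sum with
          \<open>(k choose j) / (n choose j)\<close> in place of \<open>(k / n)^j\<close>; the
          weights \<open>w n k\<close> sum to 1.\<close>
        have bn: "\<bar>integral\<^sup>L (N n) (\<lambda>t. cl t ^ j) - L ([:0, 1:] ^ j)\<bar> \<le> ?b n" if n: "n > 2 * j" for n
        proof -
          have "integral\<^sup>L (N n) (\<lambda>t. cl t ^ j) - L ([:0, 1:] ^ j)
             = (\<Sum>k\<le>n. w n k * ((real k / real n) ^ j - real (k choose j) / real (n choose j)))"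
            using n mom[of j n] by (subst intN) (auto simp: clk sum_subtractf right_diff_distrib)
          also have "\<bar>\<dots>\<bar> \<le> (\<Sum>k\<le>n. w n k * ?b n)"
          proof (intro sum_abs[THEN order_trans] sum_mono)
            fix k assume "k \<in> {..n}"
            then show "\<bar>w n k * ((real k / real n) ^ j - real (k choose j) / real (n choose j))\<bar> \<le> w n k * ?b n"
              unfolding abs_mult abs_of_nonneg[OF w0]
              using n by (intro mult_left_mono binomial_ratio_close w0) auto
          qed
          also have "\<dots> = ?b n" by (simp only: sum_distrib_right[symmetric] w1)
          finally show ?thesis .
        qed
        show "\<forall>\<^sub>F n in sequentially. norm (integral\<^sup>L (N n) (\<lambda>t. cl t ^ j) - L ([:0, 1:] ^ j)) \<le> ?b n"
          by (rule eventually_mono[OF eventually_gt_at_top[of "2 * j"]]) (use bn in auto)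
        have "filterlim (\<lambda>n. real n - real j) at_top sequentially"
          using filterlim_tendsto_add_at_top[OF tendsto_const[of "- real j"] filterlim_real_sequentially]
          by simp
        then have "(\<lambda>n. real j * (real j / (real n - real j))) \<longlonglongrightarrow> real j * 0"
          by (intro tendsto_mult tendsto_const tendsto_divide_0[OF tendsto_const])
             (rule filterlim_at_top_imp_at_infinity)
        then show "?b \<longlonglongrightarrow> 0" by simp
      qed
    qed
    then have "(\<lambda>n. integral\<^sup>L (N (r n)) (\<lambda>t. cl t ^ j)) \<longlonglongrightarrow> L ([:0, 1:] ^ j)"
      using LIMSEQ_subseq_LIMSEQ[OF _ r] by (simp add: o_def)
    moreover have "AE t in M. cl t ^ j = t ^ j"
      using AE by (rule AE_mp) (auto intro!: AE_I2 simp: cl_def)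
    then have "integral\<^sup>L M (\<lambda>t. cl t ^ j) = integral\<^sup>L M (\<lambda>t. t ^ j)"
      by (intro integral_cong_AE) auto
    ultimately show ?thesis using LIMSEQ_unique by metis
  qed
  have "integral\<^sup>L M (\<lambda>t. t ^ j * poly p t) = L ([:0, 1:] ^ j * p)" for j p
  \<comment> \<open>The extra power \<open>t ^ j\<close> absorbs the factor \<open>X\<close> that
    \<open>pCons\<close> splits off.\<close>
  proof (induction p arbitrary: j rule: pCons_induct)
    case 0
    show ?case by (simp add: L_0)
  next
    case (pCons a p)
    have "(\<lambda>t. a * t ^ j) = poly (smult a ([:0, 1:] ^ j))"
      "(\<lambda>t. t ^ Suc j * poly p t) = poly ([:0, 1:] ^ Suc j * p)"
      by (simp_all add: fun_eq_iff poly_power)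
    then have i1: "integrable M (\<lambda>t. a * t ^ j)" and i2: "integrable M (\<lambda>t. t ^ Suc j * poly p t)"
      by (simp_all only: intg)
    have "integral\<^sup>L M (\<lambda>t. t ^ j * poly (pCons a p) t) = integral\<^sup>L M (\<lambda>t. a * t ^ j + t ^ Suc j * poly p t)"
      by (simp add: algebra_simps)
    also have "\<dots> = a * L ([:0, 1:] ^ j) + L ([:0, 1:] ^ Suc j * p)"
      unfolding Bochner_Integration.integral_add[OF i1 i2] pCons.IH[of "Suc j"] by (simp add: pow)
    also have "\<dots> = L (smult a ([:0, 1:] ^ j) + [:0, 1:] ^ Suc j * p)" by (simp only: L_add L_smult)
    also have "smult a ([:0, 1:] ^ j) + [:0, 1:] ^ Suc j * p = [:0, 1:] ^ j * pCons a p"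
    proof -
      have "pCons a p = smult a 1 + [:0, 1:] * p" by simp
      then show ?thesis by (simp add: distrib_left mult.assoc power_commutes flip: mult.assoc)
    qed
    finally show ?case .
  qed
  from this[of 0] have "integral\<^sup>L M (poly p) = L p" for p by simp
  then show ?thesis using AE M.prob_space_axioms M.events_eq_borel by blast
qed


section \<open>Projection-valued measures\<close>

context hilbert_space
begin

context
  fixes E :: "real set \<Rightarrow> 'h \<Rightarrow> 'h"
  assumes E: "projection_valued_measure E"
begin

lemma pvm_op: "B \<in> sets borel \<Longrightarrow> orthogonal_projection (E B)"
  using E by (simp add: projection_valued_measure_def)

lemma pvm_Int: "B \<in> sets borel \<Longrightarrow> C \<in> sets borel \<Longrightarrow> E B (E C x) = E (B \<inter> C) x"
  using E by (simp add: projection_valued_measure_def)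

lemma pvm_empty [simp]: "E {} x = 0" and pvm_UNIV [simp]: "E UNIV x = x"
  using E by (simp_all add: projection_valued_measure_def)

lemma pvm_sums: "range A \<subseteq> sets borel \<Longrightarrow> disjoint_family A \<Longrightarrow> (\<lambda>n. E (A n) x) sums E (\<Union>n. A n) x"
  for A :: "nat \<Rightarrow> real set"
  using E by (simp add: projection_valued_measure_def)

text \<open>Pair the series of vectors with its own sum: \<open>E (A n)\<close> absorbs
  \<open>E\<close> of the union, so each term becomes a squared norm. This is countable additivity
  of \<open>diag_measure\<close>.\<close>

lemma pvm_norm_sums:
  fixes A :: "nat \<Rightarrow> real set"
  assumes "range A \<subseteq> sets borel" "disjoint_family A"
  shows "(\<lambda>n. (norm (E (A n) x))\<^sup>2) sums (norm (E (\<Union>n. A n) x))\<^sup>2"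
proof -
  let ?U = "\<Union>n. A n"
  have m: "A n \<in> sets borel" "?U \<in> sets borel" for n using assms(1) by auto
  have "(\<lambda>n. rip (E (A n) x) (E ?U x)) sums rip (E ?U x) (E ?U x)"
    by (rule bounded_linear.sums[OF bounded_bilinear.bounded_linear_left[OF bounded_bilinear_rip]])
       (rule pvm_sums[OF assms])
  moreover have "rip (E (A n) x) (E ?U x) = (norm (E (A n) x))\<^sup>2" for n
  proof -
    have "A n \<inter> ?U = A n" by blast
    then have "E (A n) (E ?U x) = E (A n) x" using pvm_Int m by simp
    then show ?thesis using op_norm_sq[OF pvm_op[OF m(1)[of n]], of x] op_rsym[OF pvm_op[OF m(1)[of n]]]
      by (metis op_idem[OF pvm_op[OF m(1)[of n]]] rip_self)
  qed
  ultimately show ?thesis by (simp add: rip_self)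
qed

lemma space_diag_measure [simp]: "space (diag_measure E x) = UNIV"
  and sets_diag_measure [simp, measurable_cong]: "sets (diag_measure E x) = sets borel"
  by (simp_all add: diag_measure_def sets.sigma_sets_eq[of borel, simplified])

lemma emeasure_diag_measure:
  assumes "B \<in> sets borel"
  shows "emeasure (diag_measure E x) B = ennreal ((norm (E B x))\<^sup>2)"
  unfolding diag_measure_def
proof (rule emeasure_measure_of_sigma[OF _ _ _ assms])
  show "sigma_algebra UNIV (sets borel)" using sets.sigma_algebra_axioms[of borel] by simp
  show "positive (sets borel) (\<lambda>B. ennreal ((norm (E B x))\<^sup>2))" by (simp add: positive_def)
  show "countably_additive (sets borel) (\<lambda>B. ennreal ((norm (E B x))\<^sup>2))"
    unfolding countably_additive_def
  proof (intro allI impI)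
    fix A :: "nat \<Rightarrow> real set" assume "range A \<subseteq> sets borel" "disjoint_family A"
    then show "(\<Sum>i. ennreal ((norm (E (A i) x))\<^sup>2)) = ennreal ((norm (E (\<Union> (range A)) x))\<^sup>2)"
      using pvm_norm_sums by (intro suminf_ennreal_eq) auto
  qed
qed

lemma finite_measure_diag: "finite_measure (diag_measure E x)"
  by (rule finite_measureI) (simp add: emeasure_diag_measure)

lemma measure_diag: "B \<in> sets borel \<Longrightarrow> measure (diag_measure E x) B = (norm (E B x))\<^sup>2"
  by (simp add: measure_def emeasure_diag_measure)

lemma measure_diag_UNIV: "measure (diag_measure E x) UNIV = (norm x)\<^sup>2"
  by (simp add: measure_diag)

text \<open>Projecting the vector cuts the measure off to \<open>C\<close>, since
  \<open>E B (E C x) = E (B \<inter> C) x\<close>. Integrals on spectral subspaces are thus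
  integrals over parts of the line.\<close>

lemma diag_measure_proj:
  assumes [measurable]: "C \<in> sets borel"
  shows "diag_measure E (E C x) = density (diag_measure E x) (\<lambda>t. ennreal (indicator C t))"
proof (rule measure_eqI)
  fix B assume "B \<in> sets (diag_measure E (E C x))"
  then have [measurable]: "B \<in> sets borel" by simp
  have "emeasure (density (diag_measure E x) (\<lambda>t. ennreal (indicator C t))) B
      = (\<integral>\<^sup>+t. ennreal (indicator C t) * indicator B t \<partial>diag_measure E x)"
    by (rule emeasure_density) auto
  also have "\<dots> = (\<integral>\<^sup>+t. indicator (B \<inter> C) t \<partial>diag_measure E x)"
    by (rule nn_integral_cong) (auto split: split_indicator)
  finally show "emeasure (diag_measure E (E C x)) B
      = emeasure (density (diag_measure E x) (\<lambda>t. ennreal (indicator C t))) B"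
    by (simp add: emeasure_diag_measure pvm_Int)
qed simp

lemma integrable_diag_proj:
  fixes f :: "real \<Rightarrow> real"
  assumes [measurable]: "C \<in> sets borel" "f \<in> borel_measurable borel"
  shows "integrable (diag_measure E (E C x)) f \<longleftrightarrow> integrable (diag_measure E x) (\<lambda>t. indicator C t * f t)"
  unfolding diag_measure_proj[OF assms(1)]
  by (subst integrable_density) auto

lemma integral_diag_proj:
  fixes f :: "real \<Rightarrow> real"
  assumes [measurable]: "C \<in> sets borel" "f \<in> borel_measurable borel"
  shows "integral\<^sup>L (diag_measure E (E C x)) f = integral\<^sup>L (diag_measure E x) (\<lambda>t. indicator C t * f t)"
  unfolding diag_measure_proj[OF assms(1)]
  by (subst integral_density) auto

lemma AE_diag_proj:
  assumes [measurable]: "C \<in> sets borel"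
  shows "AE t in diag_measure E (E C x). t \<in> C"
  unfolding diag_measure_proj[OF assms] by (subst AE_density) (auto split: split_indicator)

lemma pvm_Un:
  assumes "B \<in> sets borel" "C \<in> sets borel" "B \<inter> C = {}"
  shows "E (B \<union> C) x = E B x + E C x"
proof -
  let ?A = "binaryset B C"
  have r: "range ?A \<subseteq> sets borel" "disjoint_family ?A"
    using assms by (auto simp: range_binaryset_eq disjoint_family_on_def binaryset_def)
  have "(\<lambda>n. E (?A n) x) sums (\<Sum>n<2. E (?A n) x)"
    by (rule sums_finite) (auto simp: binaryset_def)
  moreover have "(\<Sum>n<2. E (?A n) x) = E B x + E C x"
    by (simp add: binaryset_def numeral_2_eq_2)
  ultimately show ?thesis
    using pvm_sums[OF r, of x] sums_unique2 by (metis UN_binaryset_eq)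
qed

lemma pvm_Compl: "B \<in> sets borel \<Longrightarrow> E (- B) x = x - E B x"
  using pvm_Un[of B "- B" x] by (simp add: Compl_eq_Diff_UNIV[symmetric] borel_comp add.commute eq_diff_eq)

lemma pvm_Diff:
  assumes "B \<in> sets borel" "C \<in> sets borel" "C \<subseteq> B"
  shows "E (B - C) x = E B x - E C x"
  using pvm_Un[of C "B - C" x] assms by (simp add: Un_absorb1)

lemma pvm_mono:
  assumes "B \<in> sets borel" "C \<in> sets borel" "B \<subseteq> C" "E B x = x"
  shows "E C x = x"
  using pvm_Int[of C B x] assms by (simp add: Int_absorb1)

text \<open>The squared distance of \<open>E (A n) x\<close> from the limit is the measure of
  \<open>A n\<close> minus the intersection, so continuity from above of a finite measure
  applies.\<close>

lemma pvm_decseq: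
  fixes A :: "nat \<Rightarrow> real set"
  assumes "range A \<subseteq> sets borel" "decseq A"
  shows "(\<lambda>n. E (A n) x) \<longlonglongrightarrow> E (\<Inter>n. A n) x"
proof -
  let ?I = "\<Inter>n. A n"
  have m [measurable]: "A n \<in> sets borel" "?I \<in> sets borel" for n using assms(1) by auto
  interpret finite_measure "diag_measure E x" by (rule finite_measure_diag)
  have "(\<lambda>n. measure (diag_measure E x) (A n) - measure (diag_measure E x) ?I) \<longlonglongrightarrow> 0"
    using finite_Lim_measure_decseq[of A] assms by (simp add: Lim_null[symmetric])
  moreover have "measure (diag_measure E x) (A n) - measure (diag_measure E x) ?I = (norm (E (A n) x - E ?I x))\<^sup>2" for n
  proof -
    have "?I \<subseteq> A n" by blast
    then have "measure (diag_measure E x) (A n) - measure (diag_measure E x) ?I = measure (diag_measure E x) (A n - ?I)"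
      by (intro finite_measure_Diff[symmetric]) auto
    also have "\<dots> = (norm (E (A n) x - E ?I x))\<^sup>2"
      using \<open>?I \<subseteq> A n\<close> m by (simp only: measure_diag pvm_Diff sets.Diff)
    finally show ?thesis .
  qed
  ultimately have "(\<lambda>n. sqrt ((norm (E (A n) x - E ?I x))\<^sup>2)) \<longlonglongrightarrow> sqrt 0"
    by (intro tendsto_real_sqrt) simp
  then show ?thesis by (subst LIM_zero_iff[symmetric]) (simp add: tendsto_norm_zero_iff)
qed

lemma pvm_incseq:
  fixes A :: "nat \<Rightarrow> real set"
  assumes "range A \<subseteq> sets borel" "incseq A"
  shows "(\<lambda>n. E (A n) x) \<longlonglongrightarrow> E (\<Union>n. A n) x"
proof -
  have m: "A n \<in> sets borel" "(\<Union>n. A n) \<in> sets borel" for n using assms(1) by auto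
  have "(\<lambda>n. E (- A n) x) \<longlonglongrightarrow> E (\<Inter>n. - A n) x"
    using assms by (intro pvm_decseq) (auto simp: decseq_def incseq_def borel_comp)
  then have "(\<lambda>n. x - E (A n) x) \<longlonglongrightarrow> x - E (\<Union>n. A n) x"
    using m by (simp only: pvm_Compl Compl_UN[symmetric])
  from tendsto_diff[OF tendsto_const[of x] this] show ?thesis by simp
qed

end

end

text \<open>Regularity gives a compact and an open set for each measure; the union of the former and
  the intersection of the latter admit one Urysohn function for all of them, which Bernstein
  polynomials replace on \<open>{0..1}\<close>. Finitely many measures are treated at once because
  measures of different vectors have no simple relation, yet one polynomial has to serve several
  vectors.\<close>

lemma indicator_approx:
  assumes F: "finite F" and fin: "\<And>M. M \<in> F \<Longrightarrow> finite_measure M"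
    and sets: "\<And>M. M \<in> F \<Longrightarrow> sets M = sets (borel :: real measure)"
    and AE: "\<And>M. M \<in> F \<Longrightarrow> AE t in M. t \<in> {0..1}"
    and B: "B \<in> sets borel" and e: "e > 0"
  shows "\<exists>p. (\<forall>t\<in>{0..1}. \<bar>poly p t\<bar> \<le> 2) \<and>
    (\<forall>M\<in>F. integral\<^sup>L M (\<lambda>t. \<bar>poly p t - indicator B t\<bar>) < (e :: real))"
proof -
  have "\<exists>K U. compact K \<and> open U \<and> K \<subseteq> B \<and> B \<subseteq> U \<and> measure M (U - K) < e / 2" if M: "M \<in> F" for M
  proof -
    interpret finite_measure M by (rule fin[OF M])
    note s [measurable_cong] = sets[OF M]
    have fm: "emeasure M (space M) \<noteq> \<infinity>" using emeasure_finite by simp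
    have "{K. K \<subseteq> B \<and> compact K} \<noteq> {}" by (auto intro: exI[of _ "{}"])
    then obtain K where K: "K \<subseteq> B" "compact K" "emeasure M B < emeasure M K + ennreal (e / 4)"
      using SUP_approx_ennreal[OF _ _ inner_regular[OF s fm B], of "e / 4"] e by auto
    obtain U where U: "B \<subseteq> U" "open U" "emeasure M U < emeasure M B + ennreal (e / 4)"
      using INF_approx_ennreal[OF _ outer_regular[OF s fm B], of "e / 4"] e by auto
    have m: "K \<in> sets M" "U \<in> sets M" using K U s by (auto intro: borel_compact)
    have "measure M B < measure M K + e / 4" "measure M U < measure M B + e / 4"
      using K(3) U(3) e by (simp_all add: emeasure_eq_measure ennreal_less_iff flip: ennreal_plus)
    then have "measure M (U - K) < e / 2"
      using m K(1) U(1) by (subst finite_measure_Diff) auto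
    then show ?thesis using K U by blast
  qed
  then obtain K U where KU: "\<And>M. M \<in> F \<Longrightarrow> compact (K M) \<and> open (U M) \<and> K M \<subseteq> B \<and> B \<subseteq> U M \<and> measure M (U M - K M) < e / 2"
    by metis
  define KK where "KK = (\<Union>M\<in>F. K M)"
  define UU where "UU = (\<Inter>M\<in>F. U M)"
  have KK: "closed KK" "KK \<subseteq> B" and UU: "open UU" "B \<subseteq> UU"
    unfolding KK_def UU_def using F KU by (auto intro: compact_imp_closed)
  have "KK \<inter> - UU = {}" using KK UU by blast
  then obtain f :: "real \<Rightarrow> real" where f: "continuous_on UNIV f" "\<And>x. f x \<in> closed_segment 1 0"
    "\<And>x. x \<in> KK \<Longrightarrow> f x = 1" "\<And>x. x \<in> - UU \<Longrightarrow> f x = 0"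
    using Urysohn[of KK "- UU" 1 0] KK UU by (metis closed_Compl)
  \<comment> \<open>Exceeds every total mass; the summand 1 keeps it positive for empty
    \<open>F\<close>.\<close>
  define C where "C = 1 + (\<Sum>M\<in>F. measure M (space M))"
  have C: "C > 0" "M \<in> F \<Longrightarrow> measure M (space M) < C" for M
  proof -
    have "(\<Sum>M\<in>F. measure M (space M)) \<ge> 0" by (intro sum_nonneg) auto
    then show "C > 0" by (simp add: C_def)
    show "measure M (space M) < C" if "M \<in> F"
      using member_le_sum[OF that, of "\<lambda>M. measure M (space M)"] F by (simp add: C_def)
  qed
  \<comment> \<open>The bound 1 yields the bound 2 for the polynomial, as \<open>f\<close> takes
    values in \<open>{0..1}\<close>. The bound \<open>e / (2 * C)\<close> leaves half of
    \<open>e\<close> for the measure of \<open>U M - K M\<close>.\<close>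
  define d where "d = min 1 (e / (2 * C))"
  have d: "d > 0" "d \<le> 1" using e C by (simp_all add: d_def)
  obtain n where n: "\<And>x. x \<in> {0..1} \<Longrightarrow> \<bar>f x - (\<Sum>k\<le>n. f (k / n) * Bernstein n k x)\<bar> < d"
    using Bernstein_Weierstrass[of f d] f(1) d(1) continuous_on_subset by blast
  define p where "p = (\<Sum>k\<le>n. smult (f (k / n) * real (n choose k)) (bern k (n - k)))"
  have p: "poly p x = (\<Sum>k\<le>n. f (k / n) * Bernstein n k x)" for x
    by (simp add: p_def poly_sum poly_power Bernstein_def mult_ac)
  have fb: "0 \<le> f x" "f x \<le> 1" for x using f(2)[of x] by (auto simp: closed_segment_eq_real_ivl split: if_splits)
  have pd: "\<bar>poly p x - f x\<bar> < d" if "x \<in> {0..1}" for x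
    using n[OF that] by (simp add: p abs_minus_commute)
  have "\<bar>poly p x\<bar> \<le> 2" if "x \<in> {0..1}" for x
    using pd[OF that] fb[of x] d(2) by linarith
  moreover have "integral\<^sup>L M (\<lambda>t. \<bar>poly p t - indicator B t\<bar>) < e" if M: "M \<in> F" for M
  proof -
    interpret finite_measure M by (rule fin[OF M])
    note s [measurable_cong] = sets[OF M]
    have [measurable]: "B \<in> sets M" "U M - K M \<in> sets M" using B KU[OF M] s by (auto intro!: sets.Diff intro: borel_compact)
    have pm [measurable]: "poly p \<in> borel_measurable M" using s borel_measurable_poly[of p] measurable_cong_sets by blast
    have le: "\<bar>poly p t - indicator B t\<bar> \<le> d + indicator (U M - K M) t" if "t \<in> {0..1}" for t
    proof -
      have "\<bar>f t - indicator B t\<bar> \<le> indicator (U M - K M) t"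
      proof (cases "t \<in> U M - K M")
        case True
        then show ?thesis using fb[of t] by (auto split: split_indicator)
      next
        case False
        then have "t \<in> K M \<or> t \<notin> U M" by blast
        then show ?thesis using M f(3)[of t] f(4)[of t] KK UU False
          by (auto simp: KK_def UU_def split: split_indicator)
      qed
      then show ?thesis using pd[OF that] by linarith
    qed
    have i: "integrable M (\<lambda>t. d + indicator (U M - K M) t)"
      by (intro Bochner_Integration.integrable_add integrable_const integrable_real_indicator) (auto simp: less_top[symmetric])
    have "integral\<^sup>L M (\<lambda>t. \<bar>poly p t - indicator B t\<bar>) \<le> integral\<^sup>L M (\<lambda>t. d + indicator (U M - K M) t)"
    proof (rule integral_mono_AE[OF _ i])
      show "AE t in M. \<bar>poly p t - indicator B t\<bar> \<le> d + indicator (U M - K M) t"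
        using AE[OF M] by (rule AE_mp) (use le in auto)
      then show "integrable M (\<lambda>t. \<bar>poly p t - indicator B t\<bar>)"
        by (intro Bochner_Integration.integrable_bound[OF i]) auto
    qed
    also have "\<dots> = d * measure M (space M) + measure M (U M - K M)"
      by (subst Bochner_Integration.integral_add) (auto simp: less_top[symmetric])
    also have "d * measure M (space M) \<le> e / (2 * C) * C"
      using C(2)[OF M] C(1) e by (intro mult_mono) (auto simp: d_def)
    also have "e / (2 * C) * C = e / 2" using C(1) by simp
    finally show ?thesis using KU[OF M] by auto
  qed
  ultimately show ?thesis by blast
qed


section \<open>The spectral theorem for bounded operators\<close>

lemma abs_square_le: "\<bar>y\<bar> \<le> c \<Longrightarrow> y\<^sup>2 \<le> c\<^sup>2" for y c :: real
  by (metis abs_ge_zero power2_abs power_mono)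

lemma squeeze_zero:
  fixes a b :: "nat \<Rightarrow> real"
  assumes "\<And>n. a n \<le> b n" "b \<longlonglongrightarrow> 0" "\<And>n. 0 \<le> a n"
  shows "a \<longlonglongrightarrow> 0"
  using assms by (intro tendsto_sandwich[of "\<lambda>_. 0" a sequentially b]) auto

text \<open>The normalisation \<open>0 \<le> A \<le> 1\<close>, stated through the quadratic form,
  puts the moments on \<open>{0..1}\<close>. Boundedness of \<open>A\<close> is a consequence,
  \<open>norm_A_le\<close>.\<close>

locale unit_selfadjoint = hilbert_space scale ip
  for scale :: "'k::real_or_complex \<Rightarrow> 'h::banach \<Rightarrow> 'h" (infixr "*\<^sub>K" 75)
    and ip :: "'h \<Rightarrow> 'h \<Rightarrow> 'k" +
  fixes A :: "'h \<Rightarrow> 'h"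
  assumes A_add: "A (x + y) = A x + A y"
    and A_scale: "A (c *\<^sub>K x) = c *\<^sub>K A x"
    and A_sym: "ip (A x) y = ip x (A y)"
    and A_nonneg: "0 \<le> rip (A x) x"
    and A_le: "rip (A x) x \<le> (norm x)\<^sup>2"
begin

lemma A_scaleR: "A (r *\<^sub>R x) = r *\<^sub>R A x"
  by (metis A_scale scale_of_real)

lemma A_0 [simp]: "A 0 = 0"
  using A_scaleR[of 0 0] by simp

lemma A_minus: "A (- x) = - A x"
  using A_scaleR[of "- 1" x] by simp

section \<open>Polynomial calculus and positivity\<close>

definition pA :: "real poly \<Rightarrow> 'h \<Rightarrow> 'h" where
  "pA p x = fold_coeffs (\<lambda>a y. a *\<^sub>R x + A y) p 0"

lemma pA_0 [simp]: "pA 0 x = 0"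
  by (simp add: pA_def)

lemma pA_pCons: "pA (pCons a p) x = a *\<^sub>R x + A (pA p x)"
  by (cases "p = 0"; cases "a = 0") (auto simp: pA_def)

lemma pA_1 [simp]: "pA 1 x = x"
  by (simp add: one_pCons pA_pCons)

lemma pA_X: "pA [:0, 1:] x = A x"
  by (simp add: pA_pCons)

lemma pA_add: "pA (p + q) x = pA p x + pA q x"
  by (induction p q rule: poly_induct2) (simp_all add: pA_pCons A_add scaleR_left_distrib)

lemma pA_smult: "pA (smult c p) x = c *\<^sub>R pA p x"
  by (induction p rule: pCons_induct) (simp_all add: pA_pCons A_scaleR scaleR_right_distrib)

lemma pA_diff: "pA (p - q) x = pA p x - pA q x"
  using pA_add[of "p - q" q x] by simp

lemma pA_mult: "pA (p * q) x = pA p (pA q x)"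
  by (induction p rule: pCons_induct) (simp_all add: pA_pCons pA_add pA_smult)

lemma pA_vec_add: "pA p (x + y) = pA p x + pA p y"
  by (induction p rule: pCons_induct) (simp_all add: pA_pCons A_add scaleR_right_distrib)

lemma pA_vec_scale: "pA p (c *\<^sub>K x) = c *\<^sub>K pA p x"
  by (induction p rule: pCons_induct)
     (simp_all add: pA_pCons A_scale scale_right_distrib scale_scaleR_commute)

lemma pA_A: "pA p (A x) = A (pA p x)"
  using pA_mult[of p "[:0, 1:]" x] pA_mult[of "[:0, 1:]" p x] by (simp add: pA_X mult.commute)

lemma pA_sym: "ip (pA p x) y = ip x (pA p y)"
  by (induction p arbitrary: x y rule: pCons_induct)
     (simp_all add: pA_pCons ip_add_left ip_add_right ip_scaleR_left ip_scaleR_right A_sym pA_A)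

lemma pA_rsym: "rip (pA p x) y = rip x (pA p y)"
  using pA_sym by (rule rip_of_ip_eq)

definition nonneg_poly :: "real poly \<Rightarrow> bool" where
  "nonneg_poly p \<longleftrightarrow> (\<forall>x. 0 \<le> rip (pA p x) x)"

lemma nonneg_poly_add: "nonneg_poly p \<Longrightarrow> nonneg_poly q \<Longrightarrow> nonneg_poly (p + q)"
  by (simp add: nonneg_poly_def pA_add rip_add_left)

lemma nonneg_poly_mult_square: "nonneg_poly p \<Longrightarrow> nonneg_poly (q * q * p)"
proof -
  assume p: "nonneg_poly p"
  have "pA (q * q * p) x = pA q (pA p (pA q x))" for x
    by (metis mult.assoc mult.commute pA_mult)
  then have "rip (pA (q * q * p) x) x = rip (pA p (pA q x)) (pA q x)" for x
    by (simp only: pA_rsym[of q "pA p (pA q x)" x])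
  then show ?thesis using p by (simp add: nonneg_poly_def)
qed

text \<open>Splitting off squares leaves exponents modulo 2. The mixed case is
  \<open>X (1 - X) = X^2 (1 - X) + (1 - X)^2 X\<close>, again a sum of squares times nonnegative
  polynomials, so no square root of an operator enters.\<close>

lemma nonneg_poly_bern: "nonneg_poly (bern k l)"
proof -
  let ?X = "[:0, 1:] :: real poly" and ?Y = "[:1, - 1:] :: real poly"
  have 1: "nonneg_poly 1" by (simp add: nonneg_poly_def rip_self)
  have X: "nonneg_poly ?X" by (simp add: nonneg_poly_def pA_X A_nonneg)
  have Y: "nonneg_poly ?Y"
  proof -
    have "pA ?Y x = x - A x" for x by (simp add: pA_pCons A_minus)
    then show ?thesis using A_le by (simp add: nonneg_poly_def rip_diff_left rip_self)
  qed
  have XY: "nonneg_poly (?X * ?Y)"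
  proof -
    have "?X * ?Y = ?X * ?X * ?Y + ?Y * ?Y * ?X" by simp
    then show ?thesis using nonneg_poly_add nonneg_poly_mult_square X Y by metis
  qed
  have "nonneg_poly (?X ^ (k mod 2) * ?Y ^ (l mod 2))"
    using 1 X Y XY by (cases "k mod 2 = 0"; cases "l mod 2 = 0") (simp_all add: not_mod_2_eq_0_eq_1 del: mult_pCons_left mult_pCons_right)
  from nonneg_poly_mult_square[OF this, of "?X ^ (k div 2) * ?Y ^ (l div 2)"]
  have "nonneg_poly (?X ^ (2 * (k div 2) + k mod 2) * ?Y ^ (2 * (l div 2) + l mod 2))"
    by (simp only: power_add mult_2 mult_ac)
  then show ?thesis by simp
qed

lemma moment_measure_exists:
  "\<exists>M. finite_measure M \<and> sets M = sets borel \<and> (AE t in M. t \<in> {0..1}) \<and>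
    (\<forall>p. integral\<^sup>L M (poly p) = rip (pA p x) x)"
proof (cases "x = 0")
  case True
  then show ?thesis
    by (intro exI[of _ "null_measure borel"])
       (auto intro!: finite_measureI AE_I'[of UNIV] simp: null_sets_def)
next
  case False
  \<comment> \<open>The moment problem is posed for mass 1, so the functional is divided by
    \<open>c\<close> and the resulting measure multiplied by it.\<close>
  define c where "c = (norm x)\<^sup>2"
  have c: "c > 0" using False by (simp add: c_def)
  have "\<exists>M. prob_space M \<and> sets M = sets borel \<and> (AE t in M. t \<in> {0..1}) \<and>
    (\<forall>p. integral\<^sup>L M (poly p) = rip (pA p x) x / c)"
  proof (rule hausdorff_moment)
    show "0 \<le> rip (pA (bern k l) x) x / c" for k l
      using nonneg_poly_bern[of k l] c by (simp add: nonneg_poly_def)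
    show "rip (pA 1 x) x / c = 1" using c by (simp add: rip_self c_def)
  qed (simp_all add: pA_add pA_smult rip_add_left rip_scaleR_left add_divide_distrib)
  then obtain M where M: "prob_space M" and s [measurable_cong]: "sets M = sets borel"
    and AE: "AE t in M. t \<in> {0..1}" and int: "\<And>p. integral\<^sup>L M (poly p) = rip (pA p x) x / c" by blast
  interpret prob_space M by (rule M)
  let ?N = "density M (\<lambda>_. ennreal c)"
  have pm: "poly p \<in> borel_measurable M" for p :: "real poly" by measurable
  have "finite_measure ?N"
    by (rule finite_measureI) (simp add: emeasure_density nn_integral_cmult emeasure_space_1 less_top[symmetric])
  moreover have "AE t in ?N. t \<in> {0..1}" using AE by (subst AE_density) auto
  moreover have "integral\<^sup>L ?N (poly p) = rip (pA p x) x" for p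
    using c pm[of p] int[of p] by (subst integral_density) auto
  ultimately show ?thesis using s by (intro exI[of _ ?N]) auto
qed

definition mom :: "'h \<Rightarrow> real measure" where
  "mom x = (SOME M. finite_measure M \<and> sets M = sets borel \<and> (AE t in M. t \<in> {0..1}) \<and>
    (\<forall>p. integral\<^sup>L M (poly p) = rip (pA p x) x))"

lemma finite_measure_mom: "finite_measure (mom x)"
  and sets_mom [simp, measurable_cong]: "sets (mom x) = sets borel"
  and AE_mom: "AE t in mom x. t \<in> {0..1}"
  and integral_poly_mom: "integral\<^sup>L (mom x) (poly p) = rip (pA p x) x"
  using someI_ex[OF moment_measure_exists[of x]] unfolding mom_def by blast+

lemma space_mom [simp]: "space (mom x) = UNIV"
  using sets_eq_imp_space_eq[OF sets_mom] by simp

lemma integrable_mom: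
  fixes f :: "real \<Rightarrow> real"
  assumes [measurable]: "f \<in> borel_measurable borel" and "\<And>t. t \<in> {0..1} \<Longrightarrow> \<bar>f t\<bar> \<le> c"
  shows "integrable (mom x) f"
  using AE_mom[of x] assms(2)
  by (intro finite_measure.integrable_const_bound[OF finite_measure_mom, of _ c]) (auto elim!: AE_mp)

lemma integral_mom_mono:
  fixes f g :: "real \<Rightarrow> real"
  assumes "integrable (mom x) f" "integrable (mom x) g" "\<And>t. t \<in> {0..1} \<Longrightarrow> f t \<le> g t"
  shows "integral\<^sup>L (mom x) f \<le> integral\<^sup>L (mom x) g"
  using AE_mom[of x] assms by (intro integral_mono_AE) (auto elim!: AE_mp)

lemma norm_pA: "(norm (pA p x))\<^sup>2 = integral\<^sup>L (mom x) (\<lambda>t. (poly p t)\<^sup>2)"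
proof -
  have "(\<lambda>t. (poly p t)\<^sup>2) = poly (p * p)" by (simp add: fun_eq_iff power2_eq_square)
  then show ?thesis
    by (simp only: integral_poly_mom pA_mult rip_self[symmetric] pA_rsym)
qed

definition dist1 :: "real set \<Rightarrow> real poly \<Rightarrow> 'h \<Rightarrow> real" where
  "dist1 B p x = integral\<^sup>L (mom x) (\<lambda>t. \<bar>poly p t - indicator B t\<bar>)"

lemma integrable_dist1:
  assumes [measurable]: "B \<in> sets borel"
  shows "integrable (mom x) (\<lambda>t. \<bar>poly p t - indicator B t\<bar>)"
proof -
  obtain c where "\<And>t. t \<in> {0..1} \<Longrightarrow> \<bar>poly p t\<bar> \<le> c" using poly_bounded_unit by blast
  then show ?thesis
    by (intro integrable_mom[of _ "c + 1"]) (force split: split_indicator)+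
qed

lemma dist1_nonneg: "dist1 B p x \<ge> 0"
  unfolding dist1_def by (rule integral_nonneg_AE) simp

text \<open>By \<open>norm_pA\<close> the left side is an \<open>L^2\<close> distance squared, hence
  at most the sup bound \<open>c + 2\<close> times an \<open>L^1\<close> distance; the latter passes
  through the indicator of \<open>B\<close> by the triangle inequality.\<close>

lemma norm_pA_diff_le:
  assumes B: "B \<in> sets borel" and p: "\<And>t. t \<in> {0..1} \<Longrightarrow> \<bar>poly p t\<bar> \<le> c"
    and q: "\<And>t. t \<in> {0..1} \<Longrightarrow> \<bar>poly q t\<bar> \<le> 2"
  shows "(norm (pA p x - pA q x))\<^sup>2 \<le> (c + 2) * (dist1 B p x + dist1 B q x)"
proof -
  have c: "c \<ge> 0" using p[of 0] by simp
  have "(norm (pA p x - pA q x))\<^sup>2 = integral\<^sup>L (mom x) (\<lambda>t. (poly (p - q) t)\<^sup>2)"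
    by (simp only: norm_pA[symmetric] pA_diff)
  also have "\<dots> \<le> integral\<^sup>L (mom x)
      (\<lambda>t. (c + 2) * (\<bar>poly p t - indicator B t\<bar> + \<bar>poly q t - indicator B t\<bar>))"
  proof (rule integral_mom_mono)
    have le: "\<bar>poly (p - q) t\<bar> \<le> c + 2" if "t \<in> {0..1}" for t
      using p[OF that] q[OF that] by simp
    show "integrable (mom x) (\<lambda>t. (poly (p - q) t)\<^sup>2)"
      by (rule integrable_mom[of _ "(c + 2)\<^sup>2"]) (use le in \<open>auto intro: abs_square_le\<close>)
    show "integrable (mom x) (\<lambda>t. (c + 2) * (\<bar>poly p t - indicator B t\<bar> + \<bar>poly q t - indicator B t\<bar>))"
      by (intro integrable_mult_right Bochner_Integration.integrable_add integrable_dist1 B)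
    show "(poly (p - q) t)\<^sup>2 \<le> (c + 2) * (\<bar>poly p t - indicator B t\<bar> + \<bar>poly q t - indicator B t\<bar>)"
      if "t \<in> {0..1}" for t
    proof -
      have "(poly (p - q) t)\<^sup>2 = \<bar>poly (p - q) t\<bar> * \<bar>poly (p - q) t\<bar>" by (simp add: power2_eq_square)
      also have "\<dots> \<le> (c + 2) * (\<bar>poly p t - indicator B t\<bar> + \<bar>poly q t - indicator B t\<bar>)"
        using le[OF that] by (intro mult_mono) auto
      finally show ?thesis .
    qed
  qed
  also have "\<dots> = (c + 2) * (dist1 B p x + dist1 B q x)"
    unfolding dist1_def using B by (simp add: integrable_dist1)
  finally show ?thesis .
qed

lemma approx_exists:
  assumes "finite X" "B \<in> sets borel" "e > 0"
  shows "\<exists>p. (\<forall>t\<in>{0..1}. \<bar>poly p t\<bar> \<le> 2) \<and> (\<forall>x\<in>X. dist1 B p x < e)"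
proof -
  have "\<exists>p. (\<forall>t\<in>{0..1}. \<bar>poly p t\<bar> \<le> 2) \<and>
      (\<forall>M\<in>mom ` X. integral\<^sup>L M (\<lambda>t. \<bar>poly p t - indicator B t\<bar>) < e)"
  proof (rule indicator_approx)
    show "M \<in> mom ` X \<Longrightarrow> AE t in M. t \<in> {0..1}" for M using AE_mom by blast
  qed (use assms finite_measure_mom in auto)
  then show ?thesis by (simp add: dist1_def)
qed

lemma approx_seq:
  assumes "finite X" "B \<in> sets borel"
  obtains p where "\<And>n t. t \<in> {0..1} \<Longrightarrow> \<bar>poly (p n) t\<bar> \<le> 2" "\<And>n x. x \<in> X \<Longrightarrow> dist1 B (p n) x < 1 / Suc n"
  using approx_exists[OF assms, of "1 / Suc n" for n] by (metis of_nat_0_less_iff zero_less_Suc zero_less_divide_1_iff)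

text \<open>\<open>v\<close> is the indicator of \<open>B\<close>, taken at \<open>A\<close>,
  applied to \<open>x\<close>. The estimate covers all polynomials and bounds at once, so that
  \<open>v\<close> is the limit along every bounded approximating sequence, not only along the one
  constructed here.\<close>

lemma spectral_vector_exists:
  assumes B: "B \<in> sets borel"
  shows "\<exists>v. \<forall>c p. (\<forall>t\<in>{0..1}. \<bar>poly p t\<bar> \<le> c) \<longrightarrow> (norm (pA p x - v))\<^sup>2 \<le> (c + 2) * dist1 B p x"
proof -
  obtain p where p: "\<And>n t. t \<in> {0..1} \<Longrightarrow> \<bar>poly (p n) t\<bar> \<le> 2"
    "\<And>n. dist1 B (p n) x < 1 / Suc n"
    using approx_seq[of "{x}" B] B by (metis finite.emptyI finite.insertI insertI1)
  have d0: "(\<lambda>n. dist1 B (p n) x) \<longlonglongrightarrow> 0"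
    by (rule tendsto_sandwich[OF _ _ tendsto_const LIMSEQ_inverse_real_of_nat])
       (use p(2) dist1_nonneg in \<open>auto intro!: always_eventually less_imp_le simp: inverse_eq_divide\<close>)
  have "Cauchy (\<lambda>n. pA (p n) x)"
  proof (rule CauchyI)
    fix e :: real assume e: "e > 0"
    from order_tendstoD(2)[OF d0, of "e\<^sup>2 / 8"] e
    obtain N where N: "\<And>n. n \<ge> N \<Longrightarrow> dist1 B (p n) x < e\<^sup>2 / 8"
      by (auto simp: eventually_sequentially)
    have "norm (pA (p m) x - pA (p n) x) < e" if "m \<ge> N" "n \<ge> N" for m n
      using norm_pA_diff_le[of B "p m" 2 "p n" x, OF B p(1) p(1)] N[OF that(1)] N[OF that(2)] e
      by (intro power2_less_imp_less[of _ e]) auto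
    then show "\<exists>N. \<forall>m\<ge>N. \<forall>n\<ge>N. norm (pA (p m) x - pA (p n) x) < e" by blast
  qed
  then obtain v where v: "(\<lambda>n. pA (p n) x) \<longlonglongrightarrow> v" by (meson Cauchy_convergent convergent_def)
  have "(norm (pA q x - v))\<^sup>2 \<le> (c + 2) * dist1 B q x" if q: "\<forall>t\<in>{0..1}. \<bar>poly q t\<bar> \<le> c" for c q
  proof (rule LIMSEQ_le)
    show "(\<lambda>n. (norm (pA q x - pA (p n) x))\<^sup>2) \<longlonglongrightarrow> (norm (pA q x - v))\<^sup>2"
      by (intro tendsto_intros v)
    show "(\<lambda>n. (c + 2) * (dist1 B q x + dist1 B (p n) x)) \<longlonglongrightarrow> (c + 2) * dist1 B q x"
      using tendsto_mult[OF tendsto_const tendsto_add[OF tendsto_const d0], of "c + 2" "dist1 B q x"] by simp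
    show "\<exists>N. \<forall>n\<ge>N. (norm (pA q x - pA (p n) x))\<^sup>2 \<le> (c + 2) * (dist1 B q x + dist1 B (p n) x)"
      using norm_pA_diff_le[OF B _ p(1)] q by blast
  qed
  then show ?thesis by blast
qed

section \<open>Spectral projections as limits of polynomials\<close>

definition spm :: "real set \<Rightarrow> 'h \<Rightarrow> 'h" where
  "spm B x = (SOME v. \<forall>c p. (\<forall>t\<in>{0..1}. \<bar>poly p t\<bar> \<le> c) \<longrightarrow> (norm (pA p x - v))\<^sup>2 \<le> (c + 2) * dist1 B p x)"

lemma spm_bound:
  assumes "B \<in> sets borel" "\<And>t. t \<in> {0..1} \<Longrightarrow> \<bar>poly p t\<bar> \<le> c"
  shows "(norm (pA p x - spm B x))\<^sup>2 \<le> (c + 2) * dist1 B p x"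
  using someI_ex[OF spectral_vector_exists[OF assms(1), of x]] assms(2) unfolding spm_def by blast

lemma spm_lim:
  assumes B: "B \<in> sets borel" and p: "\<And>n t. t \<in> {0..1} \<Longrightarrow> \<bar>poly (p n) t\<bar> \<le> c"
    and d: "(\<lambda>n. dist1 B (p n) x) \<longlonglongrightarrow> 0"
  shows "(\<lambda>n. pA (p n) x) \<longlonglongrightarrow> spm B x"
proof -
  have "(\<lambda>n. (norm (pA (p n) x - spm B x))\<^sup>2) \<longlonglongrightarrow> 0"
  proof (rule tendsto_sandwich[OF _ _ tendsto_const])
    show "\<forall>\<^sub>F n in sequentially. (norm (pA (p n) x - spm B x))\<^sup>2 \<le> (c + 2) * dist1 B (p n) x"
      by (intro always_eventually allI spm_bound B p)
    show "(\<lambda>n. (c + 2) * dist1 B (p n) x) \<longlonglongrightarrow> 0"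
      using tendsto_mult[OF tendsto_const d, of "c + 2"] by simp
  qed simp
  from tendsto_real_sqrt[OF this] show ?thesis
    by (subst LIM_zero_iff[symmetric]) (simp add: tendsto_norm_zero_iff)
qed

lemma spm_approx:
  assumes "finite X" and B: "B \<in> sets borel"
  obtains p where "\<And>n t. t \<in> {0..1} \<Longrightarrow> \<bar>poly (p n) t\<bar> \<le> 2"
    "\<And>x. x \<in> X \<Longrightarrow> (\<lambda>n. dist1 B (p n) x) \<longlonglongrightarrow> 0" "\<And>x. x \<in> X \<Longrightarrow> (\<lambda>n. pA (p n) x) \<longlonglongrightarrow> spm B x"
proof -
  obtain p where p: "\<And>n t. t \<in> {0..1} \<Longrightarrow> \<bar>poly (p n) t\<bar> \<le> 2"
    "\<And>n x. x \<in> X \<Longrightarrow> dist1 B (p n) x < 1 / Suc n"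
    using approx_seq[OF assms] by blast
  have d0: "(\<lambda>n. dist1 B (p n) x) \<longlonglongrightarrow> 0" if "x \<in> X" for x
    by (rule tendsto_sandwich[OF _ _ tendsto_const LIMSEQ_inverse_real_of_nat])
       (use p(2)[OF that] dist1_nonneg in \<open>auto intro!: always_eventually less_imp_le simp: inverse_eq_divide\<close>)
  show ?thesis using that[OF p(1) d0] spm_lim[OF B p(1) d0] by blast
qed

lemma norm_pA_le:
  assumes "\<And>t. t \<in> {0..1} \<Longrightarrow> \<bar>poly p t\<bar> \<le> c"
  shows "norm (pA p x) \<le> c * norm x"
proof (rule power2_le_imp_le)
  have c: "c \<ge> 0" using assms[of 0] by simp
  then show "0 \<le> c * norm x" by simp
  have "(norm (pA p x))\<^sup>2 \<le> integral\<^sup>L (mom x) (\<lambda>t. c\<^sup>2 * poly 1 t)"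
    unfolding norm_pA using assms c
    by (intro integral_mom_mono integrable_mom[of _ "c\<^sup>2"]) (auto intro: abs_square_le simp: abs_le_square_iff[symmetric])
  also have "\<dots> = c\<^sup>2 * integral\<^sup>L (mom x) (\<lambda>t. poly 1 t)" by (rule integral_mult_right_zero)
  also have "\<dots> = (c * norm x)\<^sup>2"
    by (simp only: integral_poly_mom pA_1 rip_self power_mult_distrib)
  finally show "(norm (pA p x))\<^sup>2 \<le> (c * norm x)\<^sup>2" .
qed

lemma norm_A_le: "norm (A x) \<le> norm x"
  using norm_pA_le[of "[:0, 1:]" 1 x] by (simp add: pA_X)

lemma bounded_linear_A: "bounded_linear A"
  by (rule bounded_linear_intro[where K = 1]) (simp_all add: A_add A_scaleR norm_A_le)

text \<open>Identifies the measure chosen for \<open>x\<close> with the diagonal measure of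
  \<open>spm\<close>; countable additivity of \<open>spm\<close> is then read off from it.\<close>

lemma norm_spm:
  assumes [measurable]: "B \<in> sets borel"
  shows "(norm (spm B x))\<^sup>2 = measure (mom x) B"
proof -
  obtain p where p: "\<And>n t. t \<in> {0..1} \<Longrightarrow> \<bar>poly (p n) t\<bar> \<le> 2"
    "(\<lambda>n. dist1 B (p n) x) \<longlonglongrightarrow> 0" "(\<lambda>n. pA (p n) x) \<longlonglongrightarrow> spm B x"
    using spm_approx[of "{x}" B] assms by (metis finite.emptyI finite.insertI insertI1)
  have mB: "measure (mom x) B = integral\<^sup>L (mom x) (indicator B)" by simp
  have "(\<lambda>n. (norm (pA (p n) x))\<^sup>2 - measure (mom x) B) \<longlonglongrightarrow> 0"
  proof (rule Lim_null_comparison)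
    show "(\<lambda>n. 3 * dist1 B (p n) x) \<longlonglongrightarrow> 0" using tendsto_mult[OF tendsto_const p(2), of 3] by simp
    \<comment> \<open>As an indicator is its own square, the difference of squares factors; the sum
      in it is at most 2 + 1 in modulus.\<close>
    have "norm ((norm (pA (p n) x))\<^sup>2 - measure (mom x) B) \<le> 3 * dist1 B (p n) x" for n
    proof -
      have i1: "integrable (mom x) (\<lambda>t. (poly (p n) t)\<^sup>2)"
        by (rule integrable_mom[of _ "2\<^sup>2"]) (use p(1) in \<open>auto intro!: abs_square_le[of _ 2, simplified]\<close>)
      have i2: "integrable (mom x) (indicator B :: real \<Rightarrow> real)"
        by (rule integrable_mom[of _ 1]) (auto split: split_indicator)
      have "(norm (pA (p n) x))\<^sup>2 - measure (mom x) B = integral\<^sup>L (mom x) (\<lambda>t. (poly (p n) t)\<^sup>2 - indicator B t)"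
        unfolding norm_pA mB using i1 i2 by (rule Bochner_Integration.integral_diff[symmetric])
      also have "norm \<dots> \<le> integral\<^sup>L (mom x) (\<lambda>t. norm ((poly (p n) t)\<^sup>2 - indicator B t))"
        by (rule integral_norm_bound)
      also have "\<dots> \<le> integral\<^sup>L (mom x) (\<lambda>t. 3 * \<bar>poly (p n) t - indicator B t\<bar>)"
      proof (rule integral_mom_mono)
        show "integrable (mom x) (\<lambda>t. norm ((poly (p n) t)\<^sup>2 - indicator B t))" using i1 i2 by simp
        show "integrable (mom x) (\<lambda>t. 3 * \<bar>poly (p n) t - indicator B t\<bar>)"
          by (intro integrable_mult_right integrable_dist1 assms)
        fix t :: real assume t: "t \<in> {0..1}"
        have "(poly (p n) t)\<^sup>2 - indicator B t = (poly (p n) t + indicator B t) * (poly (p n) t - indicator B t)"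
          by (auto simp: power2_eq_square algebra_simps split: split_indicator)
        moreover have "\<bar>poly (p n) t + indicator B t\<bar> \<le> 3"
          using p(1)[OF t, of n] by (auto split: split_indicator)
        ultimately show "norm ((poly (p n) t)\<^sup>2 - indicator B t) \<le> 3 * \<bar>poly (p n) t - indicator B t\<bar>"
          by (simp add: abs_mult mult_right_mono)
      qed
      also have "\<dots> = 3 * dist1 B (p n) x" by (simp add: dist1_def)
      finally show ?thesis .
    qed
    then show "\<forall>\<^sub>F n in sequentially. norm ((norm (pA (p n) x))\<^sup>2 - measure (mom x) B) \<le> 3 * dist1 B (p n) x"
      by simp
  qed
  then have "(\<lambda>n. (norm (pA (p n) x))\<^sup>2) \<longlonglongrightarrow> measure (mom x) B" by (simp add: Lim_null[symmetric])
  moreover have "(\<lambda>n. (norm (pA (p n) x))\<^sup>2) \<longlonglongrightarrow> (norm (spm B x))\<^sup>2" by (intro tendsto_intros p)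
  ultimately show ?thesis using LIMSEQ_unique by blast
qed

text \<open>One polynomial sequence approximates at \<open>x\<close>, \<open>y\<close> and
  \<open>x + y\<close> simultaneously, so additivity of the polynomials passes to the limit. The
  same device gives \<open>spm_scale\<close>, \<open>spm_A\<close> and
  \<open>spm_sym\<close>.\<close>

lemma spm_add:
  assumes "B \<in> sets borel"
  shows "spm B (x + y) = spm B x + spm B y"
proof -
  obtain p where p: "\<And>z. z \<in> {x, y, x + y} \<Longrightarrow> (\<lambda>n. pA (p n) z) \<longlonglongrightarrow> spm B z"
    using spm_approx[of "{x, y, x + y}" B] assms by (metis finite.emptyI finite.insertI)
  have "(\<lambda>n. pA (p n) (x + y)) \<longlonglongrightarrow> spm B x + spm B y"
    unfolding pA_vec_add by (intro tendsto_add p) auto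
  then show ?thesis using p[of "x + y"] LIMSEQ_unique by blast
qed

lemma spm_scale:
  assumes "B \<in> sets borel"
  shows "spm B (c *\<^sub>K x) = c *\<^sub>K spm B x"
proof -
  obtain p where p: "\<And>z. z \<in> {x, c *\<^sub>K x} \<Longrightarrow> (\<lambda>n. pA (p n) z) \<longlonglongrightarrow> spm B z"
    using spm_approx[of "{x, c *\<^sub>K x}" B] assms by (metis finite.emptyI finite.insertI)
  have "(\<lambda>n. pA (p n) (c *\<^sub>K x)) \<longlonglongrightarrow> c *\<^sub>K spm B x"
    unfolding pA_vec_scale by (intro bounded_linear.tendsto[OF bounded_linear_scale] p) auto
  then show ?thesis using p[of "c *\<^sub>K x"] LIMSEQ_unique by blast
qed

lemma spm_A:
  assumes "B \<in> sets borel"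
  shows "spm B (A x) = A (spm B x)"
proof -
  obtain p where p: "\<And>z. z \<in> {x, A x} \<Longrightarrow> (\<lambda>n. pA (p n) z) \<longlonglongrightarrow> spm B z"
    using spm_approx[of "{x, A x}" B] assms by (metis finite.emptyI finite.insertI)
  have "(\<lambda>n. pA (p n) (A x)) \<longlonglongrightarrow> A (spm B x)"
    unfolding pA_A by (intro bounded_linear.tendsto[OF bounded_linear_A] p) auto
  then show ?thesis using p[of "A x"] LIMSEQ_unique by blast
qed

lemma spm_sym:
  assumes "B \<in> sets borel"
  shows "ip (spm B x) y = ip x (spm B y)"
proof -
  obtain p where p: "\<And>z. z \<in> {x, y} \<Longrightarrow> (\<lambda>n. pA (p n) z) \<longlonglongrightarrow> spm B z"
    using spm_approx[of "{x, y}" B] assms by (metis finite.emptyI finite.insertI)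
  have "(\<lambda>n. ip (pA (p n) x) y) \<longlonglongrightarrow> ip (spm B x) y"
    by (intro tendsto_intros p) auto
  moreover have "(\<lambda>n. ip (pA (p n) x) y) \<longlonglongrightarrow> ip x (spm B y)"
    unfolding pA_sym by (intro tendsto_intros p) auto
  ultimately show ?thesis using LIMSEQ_unique by blast
qed

lemma spm_Int:
  assumes B [measurable]: "B \<in> sets borel" and C [measurable]: "C \<in> sets borel"
  shows "spm (B \<inter> C) x = spm B (spm C x)"
proof -
  obtain p where p: "\<And>n t. t \<in> {0..1} \<Longrightarrow> \<bar>poly (p n) t\<bar> \<le> 2"
    "\<And>z. z \<in> {x, spm C x} \<Longrightarrow> (\<lambda>n. dist1 B (p n) z) \<longlonglongrightarrow> 0" "\<And>z. z \<in> {x, spm C x} \<Longrightarrow> (\<lambda>n. pA (p n) z) \<longlonglongrightarrow> spm B z"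
    using spm_approx[of "{x, spm C x}" B] B by (metis finite.emptyI finite.insertI)
  obtain q where q: "\<And>n t. t \<in> {0..1} \<Longrightarrow> \<bar>poly (q n) t\<bar> \<le> 2"
    "(\<lambda>n. dist1 C (q n) x) \<longlonglongrightarrow> 0" "(\<lambda>n. pA (q n) x) \<longlonglongrightarrow> spm C x"
    using spm_approx[of "{x}" C] C by (metis finite.emptyI finite.insertI insertI1)
  have "(\<lambda>n. pA (p n * q n) x) \<longlonglongrightarrow> spm (B \<inter> C) x"
  proof (rule spm_lim[where c = "2 * 2"])
    show "\<bar>poly (p n * q n) t\<bar> \<le> 2 * 2" if "t \<in> {0..1}" for n t
      using p(1)[OF that] q(1)[OF that] unfolding poly_mult abs_mult by (intro mult_mono) auto
    have "dist1 (B \<inter> C) (p n * q n) x \<le> 2 * dist1 B (p n) x + dist1 C (q n) x" for n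
    proof -
      have "dist1 (B \<inter> C) (p n * q n) x
        \<le> integral\<^sup>L (mom x) (\<lambda>t. 2 * \<bar>poly (p n) t - indicator B t\<bar> + \<bar>poly (q n) t - indicator C t\<bar>)"
        unfolding dist1_def
      proof (rule integral_mom_mono)
        show "integrable (mom x) (\<lambda>t. 2 * \<bar>poly (p n) t - indicator B t\<bar> + \<bar>poly (q n) t - indicator C t\<bar>)"
          by (intro Bochner_Integration.integrable_add integrable_mult_right integrable_dist1 B C)
        fix t :: real assume t: "t \<in> {0..1}"
        \<comment> \<open>Product rule: change one factor at a time, bounding the other by 2 or by
          1.\<close>
        have "poly (p n * q n) t - indicator (B \<inter> C) t
          = poly (q n) t * (poly (p n) t - indicator B t) + indicator B t * (poly (q n) t - indicator C t)"
          by (simp add: algebra_simps indicator_inter_arith)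
        also have "\<bar>\<dots>\<bar> \<le> \<bar>poly (q n) t\<bar> * \<bar>poly (p n) t - indicator B t\<bar> + \<bar>indicator B t\<bar> * \<bar>poly (q n) t - indicator C t\<bar>"
          using abs_triangle_ineq by (metis abs_mult)
        also have "\<dots> \<le> 2 * \<bar>poly (p n) t - indicator B t\<bar> + 1 * \<bar>poly (q n) t - indicator C t\<bar>"
          by (intro add_mono mult_right_mono q t) (auto split: split_indicator)
        finally show "\<bar>poly (p n * q n) t - indicator (B \<inter> C) t\<bar>
          \<le> 2 * \<bar>poly (p n) t - indicator B t\<bar> + \<bar>poly (q n) t - indicator C t\<bar>" by simp
      qed (intro integrable_dist1 sets.Int sets.Un B C)
      also have "\<dots> = 2 * dist1 B (p n) x + dist1 C (q n) x"
        unfolding dist1_def using B C by (simp add: integrable_dist1)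
      finally show ?thesis .
    qed
    moreover have "(\<lambda>n. 2 * dist1 B (p n) x + dist1 C (q n) x) \<longlonglongrightarrow> 0"
      using tendsto_add[OF tendsto_mult[OF tendsto_const p(2)] q(2), of x 2] by simp
    ultimately show "(\<lambda>n. dist1 (B \<inter> C) (p n * q n) x) \<longlonglongrightarrow> 0"
      by (rule squeeze_zero) (rule dist1_nonneg)
  qed simp
  moreover have "(\<lambda>n. pA (p n * q n) x) \<longlonglongrightarrow> spm B (spm C x)"
  proof -
    \<comment> \<open>Both the operators and the vectors move; the uniform bound 2 on the operators
      separates the two limits. This is why \<open>p\<close> approximates at \<open>spm C x\<close>
      as well as at \<open>x\<close>.\<close>
    have "(\<lambda>n. pA (p n) (pA (q n) x - spm C x)) \<longlonglongrightarrow> 0"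
    proof (rule Lim_null_comparison)
      show "\<forall>\<^sub>F n in sequentially. norm (pA (p n) (pA (q n) x - spm C x)) \<le> 2 * norm (pA (q n) x - spm C x)"
        by (intro always_eventually allI norm_pA_le p)
      show "(\<lambda>n. 2 * norm (pA (q n) x - spm C x)) \<longlonglongrightarrow> 0"
        using tendsto_mult[OF tendsto_const tendsto_norm_zero[OF LIM_zero[OF q(3)]], of 2] by simp
    qed
    moreover have "(\<lambda>n. pA (p n) (spm C x)) \<longlonglongrightarrow> spm B (spm C x)" using p by simp
    ultimately have "(\<lambda>n. pA (p n) (pA (q n) x - spm C x) + pA (p n) (spm C x)) \<longlonglongrightarrow> 0 + spm B (spm C x)"
      by (rule tendsto_add)
    then show ?thesis by (simp add: pA_mult flip: pA_vec_add)
  qed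
  ultimately show ?thesis using LIMSEQ_unique by blast
qed

lemma spm_UNIV: "spm UNIV x = x"
proof -
  have "(norm (pA 1 x - spm UNIV x))\<^sup>2 \<le> (1 + 2) * dist1 UNIV 1 x"
    by (rule spm_bound) auto
  then show ?thesis by (simp add: dist1_def)
qed

lemma spm_Un:
  assumes B [measurable]: "B \<in> sets borel" and C [measurable]: "C \<in> sets borel" and BC: "B \<inter> C = {}"
  shows "spm (B \<union> C) x = spm B x + spm C x"
proof -
  obtain p where p: "\<And>n t. t \<in> {0..1} \<Longrightarrow> \<bar>poly (p n) t\<bar> \<le> 2"
    "(\<lambda>n. dist1 B (p n) x) \<longlonglongrightarrow> 0" "(\<lambda>n. pA (p n) x) \<longlonglongrightarrow> spm B x"
    using spm_approx[of "{x}" B] B by (metis finite.emptyI finite.insertI insertI1)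
  obtain q where q: "\<And>n t. t \<in> {0..1} \<Longrightarrow> \<bar>poly (q n) t\<bar> \<le> 2"
    "(\<lambda>n. dist1 C (q n) x) \<longlonglongrightarrow> 0" "(\<lambda>n. pA (q n) x) \<longlonglongrightarrow> spm C x"
    using spm_approx[of "{x}" C] C by (metis finite.emptyI finite.insertI insertI1)
  have "(\<lambda>n. pA (p n + q n) x) \<longlonglongrightarrow> spm (B \<union> C) x"
  proof (rule spm_lim[where c = "2 + 2"])
    show "\<bar>poly (p n + q n) t\<bar> \<le> 2 + 2" if "t \<in> {0..1}" for n t
      using p(1)[OF that, of n] q(1)[OF that, of n] by simp
    have "dist1 (B \<union> C) (p n + q n) x \<le> dist1 B (p n) x + dist1 C (q n) x" for n
    proof -
      have "dist1 (B \<union> C) (p n + q n) x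
        \<le> integral\<^sup>L (mom x) (\<lambda>t. \<bar>poly (p n) t - indicator B t\<bar> + \<bar>poly (q n) t - indicator C t\<bar>)"
        unfolding dist1_def
      proof (rule integral_mom_mono)
        show "integrable (mom x) (\<lambda>t. \<bar>poly (p n) t - indicator B t\<bar> + \<bar>poly (q n) t - indicator C t\<bar>)"
          by (intro Bochner_Integration.integrable_add integrable_dist1 B C)
        have "(indicator (B \<union> C) t :: real) = indicator B t + indicator C t" for t
          using BC by (auto split: split_indicator)
        then show "\<bar>poly (p n + q n) t - indicator (B \<union> C) t\<bar>
          \<le> \<bar>poly (p n) t - indicator B t\<bar> + \<bar>poly (q n) t - indicator C t\<bar>" for t by simp
      qed (intro integrable_dist1 sets.Int sets.Un B C)
      also have "\<dots> = dist1 B (p n) x + dist1 C (q n) x"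
        unfolding dist1_def using B C by (simp add: integrable_dist1)
      finally show ?thesis .
    qed
    moreover have "(\<lambda>n. dist1 B (p n) x + dist1 C (q n) x) \<longlonglongrightarrow> 0"
      using tendsto_add[OF p(2) q(2)] by simp
    ultimately show "(\<lambda>n. dist1 (B \<union> C) (p n + q n) x) \<longlonglongrightarrow> 0"
      by (rule squeeze_zero) (rule dist1_nonneg)
  qed simp
  moreover have "(\<lambda>n. pA (p n + q n) x) \<longlonglongrightarrow> spm B x + spm C x"
    unfolding pA_add by (intro tendsto_intros p q)
  ultimately show ?thesis using LIMSEQ_unique by blast
qed

lemma spm_empty: "spm {} x = 0"
  using spm_Un[of "{}" "{}" x] by simp

lemma projection_valued_measure_spm: "projection_valued_measure spm"
  unfolding projection_valued_measure_def
proof (intro conjI ballI allI impI)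
  show "orthogonal_projection (spm B)" if "B \<in> sets borel" for B
    unfolding orthogonal_projection_def
    using that spm_Int[OF that that] by (simp add: spm_add spm_scale spm_sym)
  show "spm {} = (\<lambda>x. 0)" "spm UNIV = id" by (simp_all add: fun_eq_iff spm_empty spm_UNIV)
  show "spm (B \<inter> C) = spm B \<circ> spm C" if "B \<in> sets borel" "C \<in> sets borel" for B C
    using spm_Int[OF that] by (simp add: fun_eq_iff)
  fix F :: "nat \<Rightarrow> real set" and x
  assume F: "range F \<subseteq> sets borel" "disjoint_family F"
  let ?U = "\<Union>n. F n"
  let ?R = "\<lambda>n. ?U - (\<Union>i<n. F i)"
  have m [measurable]: "F n \<in> sets borel" "(\<Union>i<n. F i) \<in> sets borel" "?U \<in> sets borel" "?R n \<in> sets borel" for n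
    using F(1) by auto
  have part: "spm (\<Union>i<n. F i) x = (\<Sum>i<n. spm (F i) x)" for n
  proof (induction n)
    case (Suc n)
    have "(\<Union>i<n. F i) \<inter> F n = {}"
      using F(2) by (auto simp: disjoint_family_on_def) (metis disjoint_iff less_irrefl)
    moreover have "(\<Union>i<Suc n. F i) = (\<Union>i<n. F i) \<union> F n" by (auto simp: lessThan_Suc)
    ultimately show ?case using spm_Un[of "\<Union>i<n. F i" "F n" x] m Suc by simp
  qed (simp add: spm_empty)
  have rest: "spm (?R n) x = spm ?U x - (\<Sum>i<n. spm (F i) x)" for n
  proof -
    have "?U = ?R n \<union> (\<Union>i<n. F i)" "?R n \<inter> (\<Union>i<n. F i) = {}" by auto
    then show ?thesis using spm_Un[OF m(4)[of n] m(2)[of n], of x] part by (metis add_diff_cancel_right')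
  qed
  interpret finite_measure "mom x" by (rule finite_measure_mom)
  \<comment> \<open>The tails decrease to the empty set, and their measure is the squared norm of
    the remainder of the series.\<close>
  have "(\<lambda>n. measure (mom x) (?R n)) \<longlonglongrightarrow> measure (mom x) (\<Inter>n. ?R n)"
    using m(4) by (intro finite_Lim_measure_decseq) (fastforce simp: decseq_def image_subset_iff)+
  moreover have "(\<Inter>n. ?R n) = {}" by blast
  ultimately have "(\<lambda>n. (norm (spm (?R n) x))\<^sup>2) \<longlonglongrightarrow> 0" using m(4) by (simp only: norm_spm measure_empty)
  from tendsto_real_sqrt[OF this] have "(\<lambda>n. spm ?U x - (\<Sum>i<n. spm (F i) x)) \<longlonglongrightarrow> 0"
    by (simp only: rest real_sqrt_abs abs_norm_cancel real_sqrt_zero tendsto_norm_zero_iff)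
  from tendsto_diff[OF tendsto_const[of "spm ?U x"] this]
  show "(\<lambda>n. spm (F n) x) sums spm ?U x" by (simp add: sums_def)
qed

lemma diag_measure_spm: "diag_measure spm x = mom x"
proof (rule measure_eqI)
  interpret finite_measure "mom x" by (rule finite_measure_mom)
  fix B assume "B \<in> sets (diag_measure spm x)"
  then have "B \<in> sets borel" using sets_diag_measure[OF projection_valued_measure_spm] by simp
  then show "emeasure (diag_measure spm x) B = emeasure (mom x) B"
    by (simp add: emeasure_diag_measure[OF projection_valued_measure_spm] norm_spm emeasure_eq_measure)
qed (simp add: sets_diag_measure[OF projection_valued_measure_spm])

theorem spectral_theorem_unit:
  "\<exists>E. projection_valued_measure E \<and> (\<forall>B\<in>sets borel. \<forall>x. E B (A x) = A (E B x)) \<and>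
    (\<forall>x. (AE t in diag_measure E x. t \<in> {0..1}) \<and>
      (\<forall>p. integral\<^sup>L (diag_measure E x) (poly p) = rip (pA p x) x))"
  by (intro exI[of _ spm] conjI ballI allI)
     (simp_all only: projection_valued_measure_spm spm_A diag_measure_spm AE_mom integral_poly_mom)

end


section \<open>Selfadjoint operators and their bounded pseudo-inverses\<close>

context hilbert_space
begin

lemma ip_self_adjoint_real:
  assumes "ip x y = ip y x"
  shows "ip x y = of_real (rip x y)"
proof -
  have "sconj (ip x y) = ip x y" using assms ip_sconj[of y x] by simp
  then have "cnj (to_complex (ip x y)) = to_complex (ip x y)" by (metis to_complex_sconj)
  then have "to_complex (ip x y) = complex_of_real (rip x y)"
    by (simp add: rip_def complex_eq_iff)
  then show ?thesis by (metis to_complex_eq_iff to_complex_of_real)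
qed

text \<open>Uniform boundedness by Baire category. By symmetry every \<open>z\<close> gives a
  functional \<open>rip (S y) z\<close> bounded for \<open>y\<close> in the unit ball, so the closed
  sets \<open>C n\<close> cover the space and one of them contains a ball.\<close>

theorem hellinger_toeplitz:
  assumes add: "\<And>x y. S (x + y) = S x + S y" and sc: "\<And>r x. S (r *\<^sub>R x) = r *\<^sub>R S x"
    and sym: "\<And>x y. rip (S x) y = rip x (S y)"
  shows "bounded_linear S"
proof -
  define C where "C n = {z. \<forall>y. norm y \<le> 1 \<longrightarrow> \<bar>rip (S y) z\<bar> \<le> real n}" for n :: nat
  have clC: "closed (C n)" for n
  proof -
    have "C n = (\<Inter>y\<in>{y. norm y \<le> 1}. {z. \<bar>rip (S y) z\<bar> \<le> real n})" by (auto simp: C_def)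
    also have "closed \<dots>"
      by (intro closed_INT ballI closed_Collect_le continuous_intros
          linear_continuous_on[OF bounded_bilinear.bounded_linear_right[OF bounded_bilinear_rip]])
    finally show ?thesis .
  qed
  have "(\<Union>n. C n) = UNIV"
  proof -
    have "z \<in> C (nat \<lceil>norm (S z)\<rceil>)" for z
    proof -
      have "\<bar>rip (S y) z\<bar> \<le> norm (S z)" if "norm y \<le> 1" for y
      proof -
        have "\<bar>rip (S y) z\<bar> \<le> norm y * norm (S z)" using rip_le[of y "S z"] by (simp add: sym)
        also have "\<dots> \<le> 1 * norm (S z)" using that by (intro mult_right_mono) auto
        finally show ?thesis by simp
      qed
      moreover have "norm (S z) \<le> real (nat \<lceil>norm (S z)\<rceil>)" by linarith
      ultimately show ?thesis unfolding C_def using order_trans by blast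
    qed
    then show ?thesis by blast
  qed
  have "\<exists>n. interior (C n) \<noteq> {}"
  proof (rule ccontr)
    assume "\<not> ?thesis"
    then have "euclidean interior_of (\<Union>(range C)) = {}"
      using clC by (intro Baire_category_alt) (auto simp: completely_metrizable_space_euclidean)
    then show False using \<open>(\<Union>n. C n) = UNIV\<close> by simp
  qed
  then obtain n z where "z \<in> interior (C n)" by blast
  then obtain e where e: "e > 0" "cball z e \<subseteq> C n" by (meson mem_interior_cball)
  have key: "\<bar>rip (S y) w\<bar> \<le> 2 * real n / e" if y: "norm y \<le> 1" and w: "norm w \<le> 1" for y w
  proof -
    \<comment> \<open>The centre and a point of the ball both satisfy the bound \<open>n\<close>;
      their difference gives \<open>2 * n / e\<close> in every direction \<open>w\<close>.\<close>
    have 1: "z \<in> C n" "z + e *\<^sub>R w \<in> C n"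
      using e w by (auto intro!: subsetD[OF e(2)] simp: dist_norm mult_le_cancel_left1)
    have "\<bar>rip (S y) z\<bar> \<le> real n" "\<bar>rip (S y) (z + e *\<^sub>R w)\<bar> \<le> real n"
      using 1 y by (auto simp: C_def)
    then have "\<bar>e * rip (S y) w\<bar> \<le> 2 * real n" by (simp add: rip_add_right rip_scaleR_right)
    then show ?thesis using e(1) by (simp add: abs_mult field_simps)
  qed
  have bd: "norm (S y) \<le> 2 * real n / e" if y: "norm y \<le> 1" for y
  proof (cases "S y = 0")
    case False
    have "\<bar>rip (S y) (S y /\<^sub>R norm (S y))\<bar> \<le> 2 * real n / e"
      by (rule key[OF y]) (simp add: False)
    then show ?thesis using False by (simp add: rip_scaleR_right rip_self power2_eq_square flip: mult.assoc)
  qed (use e in simp)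
  have "norm (S x) \<le> norm x * (2 * real n / e)" for x
  proof (cases "x = 0")
    case True
    then show ?thesis using sc[of 0 0] by simp
  next
    case False
    have "norm (S (x /\<^sub>R norm x)) \<le> 2 * real n / e" using False by (intro bd) simp
    then show ?thesis using False by (simp add: sc field_simps)
  qed
  then show ?thesis by (rule bounded_linear_intro[OF add sc])
qed

lemma module_scale2: "module scale2"
  using hilbert_space_product by (simp add: hilbert_space_def module_iff_vector_space)

lemma
  assumes "T \<in> closed_operators"
  shows closed_op_add: "(x, y) \<in> T \<Longrightarrow> (x', y') \<in> T \<Longrightarrow> (x + x', y + y') \<in> T"
    and closed_op_scale: "(x, y) \<in> T \<Longrightarrow> (c *\<^sub>K x, c *\<^sub>K y) \<in> T"
    and closed_op_zero: "(0, 0) \<in> T"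
    and closed_op_unique: "(x, y) \<in> T \<Longrightarrow> (x, y') \<in> T \<Longrightarrow> y = y'"
    and closed_op_closed: "closed T"
    and closed_op_dense: "closure (Domain T) = UNIV"
proof -
  have T: "module.subspace scale2 T" "single_valued T" "closed T" "closure (Domain T) = UNIV"
    using assms by (auto simp: closed_operators_def)
  note sub = T(1)[unfolded module.subspace_def[OF module_scale2]]
  show "(x, y) \<in> T \<Longrightarrow> (x', y') \<in> T \<Longrightarrow> (x + x', y + y') \<in> T" using sub by (metis add_Pair)
  show "(x, y) \<in> T \<Longrightarrow> (c *\<^sub>K x, c *\<^sub>K y) \<in> T" using sub by (force simp: scale2_def)
  show "(0, 0) \<in> T" using sub by (simp add: zero_prod_def)
  show "(x, y) \<in> T \<Longrightarrow> (x, y') \<in> T \<Longrightarrow> y = y'" using T(2) by (auto dest: single_valuedD)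
qed (use assms in \<open>auto simp: closed_operators_def\<close>)

lemma closed_operatorsI:
  assumes "\<And>x y x' y'. (x, y) \<in> T \<Longrightarrow> (x', y') \<in> T \<Longrightarrow> (x + x', y + y') \<in> T"
    and "\<And>c x y. (x, y) \<in> T \<Longrightarrow> (c *\<^sub>K x, c *\<^sub>K y) \<in> T" and "(0, 0) \<in> T"
    and "\<And>x y y'. (x, y) \<in> T \<Longrightarrow> (x, y') \<in> T \<Longrightarrow> y = y'" and "closed T" and "closure (Domain T) = UNIV"
  shows "T \<in> closed_operators"
  using assms unfolding closed_operators_def module.subspace_def[OF module_scale2]
  by (auto simp: scale2_def zero_prod_def single_valued_def)

section \<open>The graph of a fixed selfadjoint operator\<close>

context
  fixes T :: "'h operator"
  assumes sa: "selfadjoint T"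
begin

lemma sa_closed_op: "T \<in> closed_operators"
  using sa by (simp add: selfadjoint_def)

lemmas sa_add = closed_op_add[OF sa_closed_op]
  and sa_scale = closed_op_scale[OF sa_closed_op]
  and sa_zero = closed_op_zero[OF sa_closed_op]
  and sa_unique = closed_op_unique[OF sa_closed_op]
  and sa_closed = closed_op_closed[OF sa_closed_op]
  and sa_dense = closed_op_dense[OF sa_closed_op]

lemma sa_scaleR: "(x, y) \<in> T \<Longrightarrow> (r *\<^sub>R x, r *\<^sub>R y) \<in> T"
  by (metis sa_scale scale_of_real)

lemma sa_diff: "(x, y) \<in> T \<Longrightarrow> (x', y') \<in> T \<Longrightarrow> (x - x', y - y') \<in> T"
  using sa_add[of x y "- x'" "- y'"] sa_scaleR[of x' y' "- 1"] by simp

lemma sa_sym: "(x, y) \<in> T \<Longrightarrow> (x', y') \<in> T \<Longrightarrow> ip y x' = ip x y'"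
proof -
  assume a: "(x, y) \<in> T" "(x', y') \<in> T"
  then have "(x', y') \<in> adjoint_op T" using sa by (simp add: selfadjoint_def)
  then show ?thesis using a(1) by (auto simp: adjoint_op_def)
qed

lemma sa_adj: "(\<And>x w. (x, w) \<in> T \<Longrightarrow> ip w y = ip x z) \<Longrightarrow> (y, z) \<in> T"
proof -
  assume "\<And>x w. (x, w) \<in> T \<Longrightarrow> ip w y = ip x z"
  then have "(y, z) \<in> adjoint_op T" by (auto simp: adjoint_op_def)
  then show ?thesis using sa by (simp add: selfadjoint_def)
qed

lemma sa_lim:
  assumes "\<And>n :: nat. (f n, g n) \<in> T" "f \<longlonglongrightarrow> x" "g \<longlonglongrightarrow> y"
  shows "(x, y) \<in> T"
  using closed_sequentially[OF sa_closed, of "\<lambda>n. (f n, g n)"] assms by (auto intro: tendsto_Pair)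

lemma sa_orth_range: "(\<And>x y. (x, y) \<in> T \<Longrightarrow> ip y w = 0) \<Longrightarrow> (w, 0) \<in> T"
  by (rule sa_adj) simp

definition reduces :: "('h \<Rightarrow> 'h) \<Rightarrow> bool" where
  "reduces Q \<longleftrightarrow> orthogonal_projection Q \<and> (\<forall>x y. (x, y) \<in> T \<longrightarrow> (Q x, Q y) \<in> T)"

text \<open>The range of the restriction is closed by the lower bound, and a vector orthogonal to it
  lies in the kernel of \<open>T\<close>.\<close>

lemma surj_of_bounded_below:
  assumes Q: "reduces Q" and "\<kappa> > 0"
    and below: "\<And>x y. (x, y) \<in> T \<Longrightarrow> Q x = x \<Longrightarrow> \<kappa> * norm x \<le> norm y"
    and z: "Q z = z"
  shows "\<exists>x. (x, z) \<in> T \<and> Q x = x"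
proof -
  have op: "orthogonal_projection Q" and red: "\<And>x y. (x, y) \<in> T \<Longrightarrow> (Q x, Q y) \<in> T"
    using Q by (auto simp: reduces_def)
  note Qlin = op_add[OF op] op_scale[OF op] op_diff[OF op]
  define R where "R = {y. \<exists>x. (x, y) \<in> T \<and> Q x = x}"
  have QR: "Q y = y" if "y \<in> R" for y
  proof -
    obtain x where x: "(x, y) \<in> T" "Q x = x" using \<open>y \<in> R\<close> by (auto simp: R_def)
    then have "(x, Q y) \<in> T" using red[OF x(1)] by simp
    then show ?thesis using sa_unique x(1) by blast
  qed
  have sub: "subspace R"
  proof (rule subspaceI)
    show "0 \<in> R" using sa_zero op_0[OF op] by (auto simp: R_def)
    show "x + y \<in> R" if "x \<in> R" "y \<in> R" for x y
    proof -
      obtain a b where "(a, x) \<in> T" "Q a = a" "(b, y) \<in> T" "Q b = b"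
        using \<open>x \<in> R\<close> \<open>y \<in> R\<close> by (auto simp: R_def)
      then have "(a + b, x + y) \<in> T" "Q (a + b) = a + b" using sa_add Qlin by auto
      then show ?thesis unfolding R_def by blast
    qed
    show "c *\<^sub>K x \<in> R" if "x \<in> R" for c x
    proof -
      obtain a where "(a, x) \<in> T" "Q a = a" using \<open>x \<in> R\<close> by (auto simp: R_def)
      then have "(c *\<^sub>K a, c *\<^sub>K x) \<in> T" "Q (c *\<^sub>K a) = c *\<^sub>K a" using sa_scale Qlin by auto
      then show ?thesis unfolding R_def by blast
    qed
  qed
  have cl: "closed R"
  proof (rule closed_sequential_limits[THEN iffD2])
    show "\<forall>f l. (\<forall>n. f n \<in> R) \<and> f \<longlonglongrightarrow> l \<longrightarrow> l \<in> R"
    proof (intro allI impI)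
    fix f l assume "(\<forall>n. f n \<in> R) \<and> f \<longlonglongrightarrow> l"
    then have f: "\<forall>n. f n \<in> R" "f \<longlonglongrightarrow> l" by auto
    then obtain g where g: "\<And>n. (g n, f n) \<in> T" "\<And>n. Q (g n) = g n"
      unfolding R_def mem_Collect_eq by metis
    have "\<kappa> * norm (g m - g n) \<le> norm (f m - f n)" for m n
      by (rule below) (use g sa_diff Qlin in auto)
    moreover have "Cauchy f" using f(2) by (rule LIMSEQ_imp_Cauchy)
    ultimately have "Cauchy g"
      unfolding Cauchy_def dist_norm using \<open>\<kappa> > 0\<close>
      by (meson le_less_trans mult_less_cancel_left_pos mult_pos_pos)
    then obtain x where x: "g \<longlonglongrightarrow> x" by (meson Cauchy_convergent convergent_def)
    have "(x, l) \<in> T" by (rule sa_lim[OF g(1) x f(2)])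
    moreover have "(\<lambda>n. Q (g n)) \<longlonglongrightarrow> Q x" by (rule bounded_linear.tendsto[OF op_bounded_linear[OF op] x])
    then have "Q x = x" using g(2) x LIMSEQ_unique by auto
    ultimately show "l \<in> R" by (auto simp: R_def)
    qed
  qed
  define w where "w = z - proj R z"
  have pR: "proj R z \<in> R" using proj_in[OF sub cl] .
  have Qw: "Q w = w" using z QR[OF pR] by (simp add: w_def Qlin)
  have "(w, 0) \<in> T"
  \<comment> \<open>By construction \<open>w\<close> is orthogonal only to images of vectors fixed
    by \<open>Q\<close>; since \<open>Q w = w\<close>, a general image may be replaced by its
    projection, which is of that kind.\<close>
  proof (rule sa_orth_range)
    fix x y assume xy: "(x, y) \<in> T"
    have "ip y w = ip (Q y) w" by (metis Qw op_sym[OF op])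
    also have "Q y \<in> R" using red[OF xy] op_idem[OF op] by (auto simp: R_def)
    then have "ip (Q y) w = 0" using proj_orth[OF sub cl, of "Q y" z] ip_commute_zero by (simp add: w_def)
    finally show "ip y w = 0" .
  qed
  from below[OF this Qw] \<open>\<kappa> > 0\<close> have "w = 0" by (simp add: mult_le_0_iff)
  then have "z \<in> R" using pR by (simp add: w_def)
  then show ?thesis by (auto simp: R_def)
qed

section \<open>Kernel, closed range and pseudo-inverse\<close>

definition kern :: "'h set" where "kern = {x. (x, 0) \<in> T}"

lemma kern_subspace: "subspace kern"
  unfolding kern_def using sa_zero sa_add[of _ 0 _ 0] sa_scale[of _ 0] by (intro subspaceI) auto

lemma kern_closed: "closed kern"
proof -
  have "closed ((\<lambda>x. (x, 0)) -` T)"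
    by (intro closed_vimage sa_closed continuous_intros)
  then show ?thesis by (simp add: kern_def vimage_def)
qed

lemma kern_orth: "(x, y) \<in> T \<Longrightarrow> k \<in> kern \<Longrightarrow> ip y k = 0"
  using sa_sym[of x y k 0] by (simp add: kern_def)

abbreviation "Pk \<equiv> proj kern"

lemma Pk_op: "orthogonal_projection Pk"
  by (rule orthogonal_projection_proj[OF kern_subspace kern_closed])

lemma Pk_range: "(x, y) \<in> T \<Longrightarrow> Pk y = 0"
  using kern_orth kern_subspace by (intro proj_eqI) (auto simp: subspace_0)

lemma Pk_kern: "(Pk x, 0) \<in> T"
  using proj_in[OF kern_subspace kern_closed, of x] by (simp add: kern_def)

lemma Pk_sub: "(x, y) \<in> T \<Longrightarrow> (x - Pk x, y) \<in> T"
  using sa_diff[OF _ Pk_kern, of x y x] by simp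

context
  assumes closed_range: "closed (Range T)"
begin

text \<open>The distance vector from \<open>y\<close> to the closed range lies in the kernel, while
  \<open>Pk\<close> annihilates both \<open>y\<close> and the range; so it vanishes.\<close>

lemma range_surj:
  assumes "Pk y = 0"
  shows "\<exists>x. (x, y) \<in> T \<and> Pk x = 0"
proof -
  have sub: "subspace (Range T)"
  proof (rule subspaceI)
    show "0 \<in> Range T" using sa_zero by blast
    show "x + y \<in> Range T" if "x \<in> Range T" "y \<in> Range T" for x y using that sa_add by blast
    show "c *\<^sub>K x \<in> Range T" if "x \<in> Range T" for c x using that sa_scale by blast
  qed
  define w where "w = y - proj (Range T) y"
  have pR: "proj (Range T) y \<in> Range T" using proj_in[OF sub closed_range] .
  have "(w, 0) \<in> T"
    using proj_orth[OF sub closed_range] ip_commute_zero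
    by (intro sa_orth_range) (auto simp: w_def)
  then have "Pk w = w" by (intro proj_id kern_subspace) (simp add: kern_def)
  moreover have "Pk w = 0" using assms pR Pk_range op_diff[OF Pk_op] by (auto simp: w_def)
  ultimately have "y \<in> Range T" using pR by (simp add: w_def)
  then obtain x where "(x, y) \<in> T" by blast
  from Pk_sub[OF this] show ?thesis using op_diff[OF Pk_op] op_idem[OF Pk_op] by (metis cancel_comm_monoid_add_class.diff_cancel)
qed

text \<open>The Moore-Penrose inverse: it inverts \<open>T\<close> off the kernel and is zero on the
  kernel.\<close>

definition pinv :: "'h \<Rightarrow> 'h" where
  "pinv y = (THE x. (x, y - Pk y) \<in> T \<and> Pk x = 0)"

lemma pinv_unique: "(x, y) \<in> T \<Longrightarrow> Pk x = 0 \<Longrightarrow> (x', y) \<in> T \<Longrightarrow> Pk x' = 0 \<Longrightarrow> x = x'"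
proof -
  assume a: "(x, y) \<in> T" "Pk x = 0" "(x', y) \<in> T" "Pk x' = 0"
  have "(x - x', 0) \<in> T" using sa_diff[OF a(1) a(3)] by simp
  then have "Pk (x - x') = x - x'" by (intro proj_id kern_subspace) (simp add: kern_def)
  then show ?thesis using a op_diff[OF Pk_op] by simp
qed

lemma pinv: "(pinv y, y - Pk y) \<in> T" and Pk_pinv: "Pk (pinv y) = 0"
proof -
  have "Pk (y - Pk y) = 0" using op_diff[OF Pk_op] op_idem[OF Pk_op] by simp
  then have "\<exists>!x. (x, y - Pk y) \<in> T \<and> Pk x = 0" using range_surj pinv_unique by blast
  from theI'[OF this] show "(pinv y, y - Pk y) \<in> T" "Pk (pinv y) = 0" by (auto simp: pinv_def)
qed

lemma pinv_eqI: "(x, y - Pk y) \<in> T \<Longrightarrow> Pk x = 0 \<Longrightarrow> pinv y = x"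
  using pinv Pk_pinv pinv_unique by blast

lemma pinv_add: "pinv (x + y) = pinv x + pinv y"
proof (rule pinv_eqI)
  have "(pinv x + pinv y, (x - Pk x) + (y - Pk y)) \<in> T" by (intro sa_add pinv)
  then show "(pinv x + pinv y, x + y - Pk (x + y)) \<in> T" by (simp add: op_add[OF Pk_op] algebra_simps)
  show "Pk (pinv x + pinv y) = 0" by (simp add: op_add[OF Pk_op] Pk_pinv)
qed

lemma pinv_scale: "pinv (c *\<^sub>K y) = c *\<^sub>K pinv y"
proof (rule pinv_eqI)
  have "(c *\<^sub>K pinv y, c *\<^sub>K (y - Pk y)) \<in> T" by (intro sa_scale pinv)
  then show "(c *\<^sub>K pinv y, c *\<^sub>K y - Pk (c *\<^sub>K y)) \<in> T"
    by (simp add: op_scale[OF Pk_op] scale_right_diff_distrib)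
  show "Pk (c *\<^sub>K pinv y) = 0" by (simp add: op_scale[OF Pk_op] Pk_pinv)
qed

lemma pinv_sym: "ip (pinv x) y = ip x (pinv y)"
proof -
  have 1: "ip (pinv x) (Pk y) = 0" for x y by (metis Pk_pinv ip_zero_left op_sym[OF Pk_op])
  have 2: "ip (Pk x) (pinv y) = 0" for x y by (simp add: Pk_pinv op_sym[OF Pk_op])
  have "ip (x - Pk x) (pinv y) = ip (pinv x) (y - Pk y)" by (rule sa_sym[OF pinv pinv])
  then show ?thesis by (simp add: ip_diff_left ip_diff_right 1 2)
qed

lemma bounded_linear_pinv: "bounded_linear pinv"
proof (rule hellinger_toeplitz)
  show "pinv (r *\<^sub>R x) = r *\<^sub>R pinv x" for r x by (metis pinv_scale scale_of_real)
  show "rip (pinv x) y = rip x (pinv y)" for x y by (rule rip_of_ip_eq) (rule pinv_sym)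
qed (rule pinv_add)

lemma sa_pinv: "(x, y) \<in> T \<Longrightarrow> x = Pk x + pinv y"
proof -
  assume xy: "(x, y) \<in> T"
  have "pinv y = x - Pk x"
    using Pk_sub[OF xy] Pk_range[OF xy] op_diff[OF Pk_op] op_idem[OF Pk_op] by (intro pinv_eqI) auto
  then show ?thesis by simp
qed

lemma pinv_zero_iff: "pinv y = 0 \<longleftrightarrow> y \<in> kern"
proof
  assume "pinv y = 0"
  then have "(0, y - Pk y) \<in> T" using pinv[of y] by simp
  then have "y = Pk y" using sa_unique[OF sa_zero] by fastforce
  then show "y \<in> kern" using proj_in[OF kern_subspace kern_closed, of y] by simp
next
  assume "y \<in> kern"
  then have "Pk y = y" by (intro proj_id kern_subspace)
  then show "pinv y = 0" using sa_zero op_0[OF Pk_op] by (intro pinv_eqI) auto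
qed

text \<open>The constant is the reciprocal of a bound for the pseudo-inverse. This is the source of
  the spectral gap around 0, and around \<open>c\<close> after a shift.\<close>

lemma bounded_below_off_kern:
  obtains \<kappa> where "\<kappa> > 0" "\<And>x y. (x, y) \<in> T \<Longrightarrow> Pk x = 0 \<Longrightarrow> \<kappa> * norm x \<le> norm y"
proof -
  obtain M where M: "M > 0" "\<And>y. norm (pinv y) \<le> norm y * M"
    using bounded_linear.pos_bounded[OF bounded_linear_pinv] by blast
  have "(1 / M) * norm x \<le> norm y" if "(x, y) \<in> T" "Pk x = 0" for x y
    using sa_pinv[OF that(1)] that(2) M(2)[of y] M(1) by (simp add: field_simps)
  then show ?thesis using that[of "1 / M"] M(1) by simp
qed

end

end

text \<open>Makes the facts on selfadjoint graphs, notably \<open>surj_of_bounded_below\<close>,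
  applicable to the pseudo-inverse itself.\<close>

lemma selfadjoint_bounded_graph:
  assumes S: "bounded_linear S" and sc: "\<And>c x. S (c *\<^sub>K x) = c *\<^sub>K S x"
    and sym: "\<And>x y. ip (S x) y = ip x (S y)"
  shows "selfadjoint {(x, S x) | x. True}" (is "selfadjoint ?G")
  unfolding selfadjoint_def
proof
  have add: "S (x + y) = S x + S y" for x y using S by (rule linear_add[OF bounded_linear.linear])
  have "?G = {z. snd z = S (fst z)}" by auto
  moreover have "closed \<dots>"
    by (intro closed_Collect_eq continuous_intros bounded_linear.continuous_on[OF S])
  ultimately show "?G \<in> closed_operators"
    using linear_0[OF bounded_linear.linear[OF S]]
    by (intro closed_operatorsI) (auto simp: add sc Domain_unfold)
  show "adjoint_op ?G = ?G"
  proof (intro set_eqI iffI; clarify)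
    fix y z assume "(y, z) \<in> adjoint_op ?G"
    then have "ip (S x) y = ip x z" for x by (auto simp: adjoint_op_def)
    then have "ip x (S y - z) = 0" for x by (simp add: sym ip_diff_right)
    then have "rip (S y - z) (S y - z) = 0" by (intro rip_of_ip_0)
    then show "\<exists>x. (y, z) = (x, S x) \<and> True" by (simp add: rip_self)
  qed (auto simp: adjoint_op_def sym)
qed

end


section \<open>Existence of spectral measures\<close>

context hilbert_space
begin

text \<open>\<open>E\<close> belongs to a rescaled operator between 0 and 1. The function
  \<open>s\<close> undoes the rescaling under the integral, so the measure need not be transported
  at this stage.\<close>

theorem bounded_spectral_theorem:
  assumes S: "bounded_linear S" and sc: "\<And>c x. S (c *\<^sub>K x) = c *\<^sub>K S x"
    and sym: "\<And>x y. ip (S x) y = ip x (S y)"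
  obtains E and s :: "real \<Rightarrow> real" and c where "projection_valued_measure E"
    "s \<in> borel_measurable borel" "\<And>B x. B \<in> sets borel \<Longrightarrow> E B (S x) = S (E B x)"
    "\<And>x. AE t in diag_measure E x. \<bar>s t\<bar> \<le> c"
    "\<And>x. integral\<^sup>L (diag_measure E x) s = rip (S x) x"
    "\<And>x. integral\<^sup>L (diag_measure E x) (\<lambda>t. (s t)\<^sup>2) = (norm (S x))\<^sup>2"
proof -
  obtain M where M: "M > 0" "\<And>y. norm (S y) \<le> norm y * M"
    using bounded_linear.pos_bounded[OF S] by blast
  have add: "S (x + y) = S x + S y" for x y using S by (rule linear_add[OF bounded_linear.linear])
  \<comment> \<open>With \<open>M\<close> a bound for the norm of \<open>S\<close>, the affine map
    taking \<open>-M\<close> to 0 and \<open>M\<close> to 1; the polynomial \<open>p\<close> below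
    is its inverse.\<close>
  define A where "A x = (1 / (2 * M)) *\<^sub>R (S x + M *\<^sub>R x)" for x
  have rA: "rip (A x) x = (rip (S x) x + M * (norm x)\<^sup>2) / (2 * M)" for x
    by (simp add: A_def rip_scaleR_left rip_add_left rip_self)
  have rS: "\<bar>rip (S x) x\<bar> \<le> M * (norm x)\<^sup>2" for x
  proof -
    have "\<bar>rip (S x) x\<bar> \<le> norm (S x) * norm x" by (rule rip_le)
    also have "\<dots> \<le> (norm x * M) * norm x" by (intro mult_right_mono M) simp
    finally show ?thesis by (simp add: power2_eq_square mult_ac)
  qed
  interpret U: unit_selfadjoint scale ip A
  proof
    show "A (x + y) = A x + A y" for x y by (simp add: A_def add algebra_simps)
    show "A (c *\<^sub>K x) = c *\<^sub>K A x" for c x by (simp add: A_def sc scale_scaleR_commute scale_right_distrib)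
    show "ip (A x) y = ip x (A y)" for x y
      by (simp add: A_def ip_scaleR_left ip_scaleR_right ip_add_left ip_add_right sym)
    show "0 \<le> rip (A x) x" for x
      using rS[of x] M(1) unfolding rA by (intro divide_nonneg_pos) auto
    show "rip (A x) x \<le> (norm x)\<^sup>2" for x
      using rS[of x] M(1) unfolding rA by (simp add: field_simps)
  qed
  obtain E where E: "projection_valued_measure E" "\<And>B x. B \<in> sets borel \<Longrightarrow> E B (A x) = A (E B x)"
    "\<And>x. AE t in diag_measure E x. t \<in> {0..1}"
    "\<And>x p. integral\<^sup>L (diag_measure E x) (poly p) = rip (U.pA p x) x"
    using U.spectral_theorem_unit by blast
  define p where "p = [:- M, 2 * M:]"
  have SA: "S x = (2 * M) *\<^sub>R A x - M *\<^sub>R x" for x using M(1) by (simp add: A_def)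
  have pS: "U.pA p x = S x" for x
    by (simp add: p_def U.pA_pCons SA U.A_scaleR)
  have rsym: "rip (S x) y = rip x (S y)" for x y using sym by (rule rip_of_ip_eq)
  obtain c where c: "\<And>t. t \<in> {0..1} \<Longrightarrow> \<bar>poly p t\<bar> \<le> c" using poly_bounded_unit by blast
  show ?thesis
  proof (rule that[of E "poly p" c])
    show "E B (S x) = S (E B x)" if B: "B \<in> sets borel" for B x
      by (simp add: SA op_diff[OF pvm_op[OF E(1) B]] op_scaleR[OF pvm_op[OF E(1) B]] E(2)[OF B])
    show "AE t in diag_measure E x. \<bar>poly p t\<bar> \<le> c" for x
      using E(3)[of x] by (rule AE_mp) (use c in auto)
    show "integral\<^sup>L (diag_measure E x) (poly p) = rip (S x) x" for x by (simp add: E(4) pS)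
    have "(\<lambda>t. (poly p t)\<^sup>2) = poly (p * p)" by (simp add: fun_eq_iff power2_eq_square)
    then show "integral\<^sup>L (diag_measure E x) (\<lambda>t. (poly p t)\<^sup>2) = (norm (S x))\<^sup>2" for x
      by (simp only: E(4) U.pA_mult pS rsym rip_self[symmetric])
  qed (use E in auto)
qed

text \<open>\<open>T\<close> is the inverse of its bounded pseudo-inverse \<open>S\<close>, so its spectral measure is the image
  of the one of \<open>S\<close> under \<open>t \<mapsto> 1 / t\<close>; the convention \<open>1 / 0 = 0\<close> takes care of the kernel.\<close>

theorem spectral_measure_exists:
  assumes sa: "selfadjoint T" and cr: "closed (Range T)"
  shows "\<exists>E. spectral_measure_of T E"
proof -
  define S where "S = pinv T"
  have S_bl: "bounded_linear S" unfolding S_def by (rule bounded_linear_pinv[OF sa cr])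
  have S_sc: "S (c *\<^sub>K x) = c *\<^sub>K S x" for c x unfolding S_def by (rule pinv_scale[OF sa cr])
  have S_sym: "ip (S x) y = ip x (S y)" for x y unfolding S_def by (rule pinv_sym[OF sa cr])
  have S_diff: "S (x - y) = S x - S y" for x y using S_bl by (rule linear_diff[OF bounded_linear.linear])
  obtain E s c where E: "projection_valued_measure E" and [measurable]: "s \<in> borel_measurable borel"
    and ES: "\<And>B x. B \<in> sets borel \<Longrightarrow> E B (S x) = S (E B x)"
    and sc: "\<And>x. AE t in diag_measure E x. \<bar>s t\<bar> \<le> c"
    and int1: "\<And>x. integral\<^sup>L (diag_measure E x) s = rip (S x) x"
    and int2: "\<And>x. integral\<^sup>L (diag_measure E x) (\<lambda>t. (s t)\<^sup>2) = (norm (S x))\<^sup>2"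
    by (rule bounded_spectral_theorem[OF S_bl S_sc S_sym]) (rule that)
  let ?\<mu> = "diag_measure E"
  note fin = finite_measure_diag[OF E] and sets [simp, measurable_cong] = sets_diag_measure[OF E]
    and space [simp] = space_diag_measure[OF E] and op = pvm_op[OF E] and EI = pvm_Int[OF E]
  define g where "g u = inverse (s u)" for u
  have [measurable]: "g \<in> borel_measurable borel" unfolding g_def by measurable
  \<comment> \<open>\<open>E Z\<close> turns out to be the projection onto the kernel of
    \<open>S\<close>, which is the kernel of \<open>T\<close>: \<open>S_EZ\<close> gives one
    inclusion, \<open>EZ_of_S0\<close> the other.\<close>
  define Z where "Z = {u. s u = 0}"
  have [measurable]: "Z \<in> sets borel" unfolding Z_def by measurable
  have nZ [measurable]: "- Z \<in> sets borel" by (simp add: borel_comp)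
  have int_s2: "integrable (?\<mu> x) (\<lambda>t. (s t)\<^sup>2)" for x
  proof -
    have "AE t in ?\<mu> x. norm ((s t)\<^sup>2) \<le> c\<^sup>2" using sc[of x] by (rule AE_mp) (auto intro: abs_square_le)
    then show ?thesis by (intro finite_measure.integrable_const_bound[OF fin]) auto
  qed
  \<comment> \<open>Applying \<open>S\<close> multiplies the measure by \<open>s\<close> squared:
    \<open>E B\<close> commutes with \<open>S\<close>, so \<open>int2\<close> can be used for the
    vector \<open>E B y\<close>.\<close>
  have dens: "?\<mu> (S y) = density (?\<mu> y) (\<lambda>t. ennreal ((s t)\<^sup>2))" for y
  proof (rule measure_eqI)
    fix B assume "B \<in> sets (?\<mu> (S y))"
    then have B [measurable]: "B \<in> sets borel" by simp
    have "(norm (E B (S y)))\<^sup>2 = (norm (S (E B y)))\<^sup>2" by (simp add: ES)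
    also have "\<dots> = integral\<^sup>L (?\<mu> y) (\<lambda>t. indicator B t * (s t)\<^sup>2)"
      unfolding int2[symmetric] by (rule integral_diag_proj[OF E]) auto
    finally have 1: "(norm (E B (S y)))\<^sup>2 = integral\<^sup>L (?\<mu> y) (\<lambda>t. indicator B t * (s t)\<^sup>2)" .
    have "emeasure (density (?\<mu> y) (\<lambda>t. ennreal ((s t)\<^sup>2))) B = (\<integral>\<^sup>+t. ennreal ((s t)\<^sup>2) * indicator B t \<partial>?\<mu> y)"
      by (rule emeasure_density) auto
    also have "\<dots> = (\<integral>\<^sup>+t. ennreal (indicator B t * (s t)\<^sup>2) \<partial>?\<mu> y)"
      by (rule nn_integral_cong) (auto split: split_indicator)
    also have "\<dots> = ennreal (integral\<^sup>L (?\<mu> y) (\<lambda>t. indicator B t * (s t)\<^sup>2))"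
    proof (rule nn_integral_eq_integral)
      show "integrable (?\<mu> y) (\<lambda>t. indicator B t * (s t)\<^sup>2)"
        by (rule Bochner_Integration.integrable_bound[OF int_s2[of y]]) (auto split: split_indicator)
    qed simp
    finally show "emeasure (?\<mu> (S y)) B = emeasure (density (?\<mu> y) (\<lambda>t. ennreal ((s t)\<^sup>2))) B"
      by (simp add: emeasure_diag_measure[OF E B] 1)
  qed simp
  have int_dens: "integral\<^sup>L (?\<mu> (S y)) f = integral\<^sup>L (?\<mu> y) (\<lambda>t. (s t)\<^sup>2 * f t)"
    and intg_dens: "integrable (?\<mu> (S y)) f \<longleftrightarrow> integrable (?\<mu> y) (\<lambda>t. (s t)\<^sup>2 * f t)"
    if [measurable]: "f \<in> borel_measurable borel" for y and f :: "real \<Rightarrow> real"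
    using integral_density[of f "?\<mu> y" "\<lambda>t. (s t)\<^sup>2"] integrable_density[of f "?\<mu> y" "\<lambda>t. (s t)\<^sup>2"]
    by (simp_all add: dens)
  have sg2: "(s t)\<^sup>2 * (g t)\<^sup>2 = indicator (- Z) t" and sg: "(s t)\<^sup>2 * g t = s t" for t
    by (auto simp: g_def Z_def power2_eq_square field_simps split: split_indicator)
  have gZ: "indicator (- Z) t * (g t)\<^sup>2 = (g t)\<^sup>2" "indicator (- Z) t * g t = g t" for t
    by (auto simp: g_def Z_def split: split_indicator)
  have S_EZ: "S (E Z x) = 0" for x
  proof -
    have "(norm (S (E Z x)))\<^sup>2 = integral\<^sup>L (?\<mu> x) (\<lambda>t. indicator Z t * (s t)\<^sup>2)"
      unfolding int2[symmetric] by (rule integral_diag_proj[OF E]) auto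
    also have "(\<lambda>t. indicator Z t * (s t)\<^sup>2) = (\<lambda>t. 0)" by (auto simp: Z_def split: split_indicator)
    finally show ?thesis by simp
  qed
  have EZ_of_S0: "E Z k = k" if "S k = 0" for k
  proof -
    have "AE t in ?\<mu> k. (s t)\<^sup>2 = 0"
      using integral_nonneg_eq_0_iff_AE[OF int_s2[of k]] int2[of k] that by simp
    then have "AE t in ?\<mu> k. t \<notin> - Z" by (rule AE_mp) (simp add: Z_def)
    then have "emeasure (?\<mu> k) (- Z) = 0" by (subst (asm) AE_iff_measurable[OF _ refl]) (auto simp: Compl_eq)
    then have "E (- Z) k = 0" by (simp add: emeasure_diag_measure[OF E nZ])
    then show ?thesis using pvm_Compl[OF E, of Z k] by simp
  qed
  have split: "x = E Z x + E (- Z) x" for x by (simp add: pvm_Compl[OF E])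
  define F where "F B = E (g -` B)" for B
  have gB: "g -` B \<in> sets borel" if "B \<in> sets borel" for B
    using measurable_sets[of g borel borel B] that by simp
  have F: "projection_valued_measure F"
    unfolding projection_valued_measure_def
  proof (intro conjI ballI allI impI)
    show "orthogonal_projection (F B)" if "B \<in> sets borel" for B using op gB[OF that] by (simp add: F_def)
    show "F {} = (\<lambda>x. 0)" "F UNIV = id" by (simp_all add: F_def fun_eq_iff pvm_empty[OF E] pvm_UNIV[OF E])
    show "F (B \<inter> C) = F B \<circ> F C" if "B \<in> sets borel" "C \<in> sets borel" for B C
      using gB[OF that(1)] gB[OF that(2)] by (simp add: F_def fun_eq_iff EI)
    show "(\<lambda>n. F (A n) x) sums F (\<Union>n. A n) x" if A: "range A \<subseteq> sets borel" "disjoint_family A"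
      for A :: "nat \<Rightarrow> real set" and x
    proof -
      have "range (\<lambda>n. g -` A n) \<subseteq> sets borel" using A(1) gB by auto
      moreover have "disjoint_family (\<lambda>n. g -` A n)" using A(2) by (fastforce simp: disjoint_family_on_def)
      ultimately show ?thesis unfolding F_def vimage_UN by (rule pvm_sums[OF E])
    qed
  qed
  have dF: "diag_measure F x = distr (?\<mu> x) borel g" for x
  proof (rule measure_eqI)
    fix B assume "B \<in> sets (diag_measure F x)"
    then have [measurable]: "B \<in> sets borel" using sets_diag_measure[OF F] by simp
    have "emeasure (distr (?\<mu> x) borel g) B = emeasure (?\<mu> x) (g -` B)"
      by (subst emeasure_distr) auto
    then show "emeasure (diag_measure F x) B = emeasure (distr (?\<mu> x) borel g) B"
      by (simp add: emeasure_diag_measure[OF F] emeasure_diag_measure[OF E gB] F_def)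
  qed (simp add: sets_diag_measure[OF F])
  have iF: "integrable (diag_measure F x) (\<lambda>t. t\<^sup>2) \<longleftrightarrow> integrable (?\<mu> x) (\<lambda>t. (g t)\<^sup>2)" for x
    unfolding dF by (rule integrable_distr_eq) auto
  have iF1: "integral\<^sup>L (diag_measure F x) (\<lambda>t. t) = integral\<^sup>L (?\<mu> x) g" for x
    unfolding dF by (subst integral_distr) auto
  \<comment> \<open>\<open>x\<close> is its kernel part plus \<open>S y\<close>; \<open>E Z\<close>
    fixes the first summand and annihilates the second. So the splitting along \<open>Z\<close> is
    the splitting along the kernel.\<close>
  have dom: "E (- Z) x = S y \<and> Pk T x = E Z x" if xy: "(x, y) \<in> T" for x y
  proof -
    define k where "k = Pk T x"
    have x: "x = k + S y" unfolding k_def S_def by (rule sa_pinv[OF sa cr xy])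
    have "S k = 0" unfolding S_def k_def
      using pinv_zero_iff[OF sa cr] proj_in[OF kern_subspace[OF sa] kern_closed[OF sa]] by blast
    then have k: "E Z k = k" by (rule EZ_of_S0)
    have "E Z (S y) = 0" using ES[of Z y] S_EZ by simp
    then have "E Z x = k" by (simp add: x op_add[OF op[of Z]] k)
    then show ?thesis using split[of x] x k_def by (metis add_left_cancel)
  qed
  have i01: "integrable (?\<mu> x) (indicator (- Z) :: real \<Rightarrow> real)" for x
    by (rule finite_measure.integrable_const_bound[OF fin, of _ 1]) (auto split: split_indicator)
  have sub1: "integrable (diag_measure F x) (\<lambda>t. t\<^sup>2)" if xy: "(x, y) \<in> T" for x y
  proof -
    have "integrable (?\<mu> (S y)) (\<lambda>t. (g t)\<^sup>2)"
      by (subst intg_dens) (simp_all add: sg2 i01)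
    then have "integrable (?\<mu> (E (- Z) x)) (\<lambda>t. (g t)\<^sup>2)" using dom[OF xy] by simp
    then have "integrable (?\<mu> x) (\<lambda>t. indicator (- Z) t * (g t)\<^sup>2)"
      by (subst (asm) integrable_diag_proj[OF E]) auto
    then show ?thesis unfolding iF gZ .
  qed
  have val: "ip y x = of_real (integral\<^sup>L (diag_measure F x) (\<lambda>t. t))" if xy: "(x, y) \<in> T" for x y
  proof -
    have "integral\<^sup>L (?\<mu> x) g = integral\<^sup>L (?\<mu> x) (\<lambda>t. indicator (- Z) t * g t)" by (simp add: gZ)
    also have "\<dots> = integral\<^sup>L (?\<mu> (E (- Z) x)) g" by (rule integral_diag_proj[OF E, symmetric]) auto
    also have "\<dots> = integral\<^sup>L (?\<mu> (S y)) g" using dom[OF xy] by simp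
    also have "\<dots> = integral\<^sup>L (?\<mu> y) s" by (subst int_dens) (simp_all add: sg)
    also have "\<dots> = rip y (S y)" by (simp add: int1 rip_commute)
    finally have "integral\<^sup>L (diag_measure F x) (\<lambda>t. t) = rip y (S y)" by (simp add: iF1)
    moreover have "ip y x = ip y (S y)"
    proof -
      have "x = Pk T x + S y" using dom[OF xy] split[of x] by simp
      moreover have "ip y (Pk T x) = 0"
        using kern_orth[OF sa xy] proj_in[OF kern_subspace[OF sa] kern_closed[OF sa]] by blast
      ultimately show ?thesis by (metis add_0 ip_add_right)
    qed
    moreover have "ip y (S y) = of_real (rip y (S y))"
      by (rule ip_self_adjoint_real) (simp add: S_sym)
    ultimately show ?thesis by simp
  qed
  \<comment> \<open>The harder inclusion: square integrability of \<open>g\<close> bounds the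
    preimages under \<open>S\<close> of truncations of \<open>x\<close>, and closedness of
    \<open>T\<close> takes the limit.\<close>
  have sub2: "x \<in> Domain T" if ix: "integrable (diag_measure F x) (\<lambda>t. t\<^sup>2)" for x
  proof -
    have ig: "integrable (?\<mu> x) (\<lambda>t. (g t)\<^sup>2)" using ix iF by simp
    \<comment> \<open>On the range of \<open>E (B n)\<close> the operator \<open>S\<close> is
      bounded below by \<open>1 / Suc n\<close>, so the truncation \<open>E (B n) x\<close> has a
      preimage \<open>y n\<close> there.\<close>
    define B where "B n = {u. 1 / real (Suc n) \<le> \<bar>s u\<bar>}" for n
    have B [measurable]: "B n \<in> sets borel" for n unfolding B_def by measurable
    have BZ: "B n \<subseteq> - Z" for n by (auto simp: B_def Z_def)
    have Bmono: "m \<le> n \<Longrightarrow> B m \<subseteq> B n" for m n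
      unfolding B_def by (auto intro: order_trans[rotated] simp: frac_le)
    have Bun: "(\<Union>n. B n) = - Z"
    proof (rule equalityI)
      show "- Z \<subseteq> (\<Union>n. B n)"
      proof
        fix u assume "u \<in> - Z"
        then have "\<bar>s u\<bar> > 0" by (simp add: Z_def)
        then obtain n where "inverse (real (Suc n)) < \<bar>s u\<bar>" using reals_Archimedean by blast
        then show "u \<in> (\<Union>n. B n)" by (auto simp: B_def inverse_eq_divide intro!: exI[of _ n])
      qed
    qed (use BZ in blast)
    have saS: "selfadjoint {(x, S x) |x. True}" by (rule selfadjoint_bounded_graph[OF S_bl S_sc S_sym])
    have low: "(1 / real (Suc n)) * norm z \<le> norm (S z)" if z: "E (B n) z = z" for n z
    proof (rule power2_le_imp_le)
      have "((1 / real (Suc n)) * norm z)\<^sup>2 = integral\<^sup>L (?\<mu> z) (\<lambda>t. (1 / real (Suc n))\<^sup>2 * indicator (B n) t)"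
        by (simp add: measure_diag[OF E] z power_mult_distrib power_divide)
      also have "\<dots> \<le> integral\<^sup>L (?\<mu> z) (\<lambda>t. (s t)\<^sup>2)"
      proof (rule integral_mono)
        show "(1 / real (Suc n))\<^sup>2 * indicator (B n) t \<le> (s t)\<^sup>2" for t
        proof (cases "t \<in> B n")
          case True
          then have "(1 / real (Suc n))\<^sup>2 \<le> \<bar>s t\<bar>\<^sup>2" by (intro power_mono) (auto simp: B_def)
          then show ?thesis using True by simp
        qed simp
        show "integrable (?\<mu> z) (\<lambda>t. (1 / real (Suc n))\<^sup>2 * indicator (B n) t)"
          by (intro integrable_mult_right finite_measure.integrable_const_bound[OF fin, of _ 1]) auto
      qed (rule int_s2)
      finally show "((1 / real (Suc n)) * norm z)\<^sup>2 \<le> (norm (S z))\<^sup>2" by (simp add: int2)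
    qed simp
    have "\<exists>y. S y = E (B n) x \<and> E (B n) y = y" for n
    proof -
      have "\<exists>y. (y, E (B n) x) \<in> {(x, S x) |x. True} \<and> E (B n) y = y"
      proof (rule surj_of_bounded_below[OF saS])
        show "reduces {(x, S x) |x. True} (E (B n))"
          unfolding reduces_def[OF saS] using op[OF B] ES[OF B] by auto
        show "E (B n) (E (B n) x) = E (B n) x" by (rule op_idem[OF op[OF B]])
        show "0 < 1 / real (Suc n)" by simp
        show "(x, y) \<in> {(x, S x) |x. True} \<Longrightarrow> E (B n) x = x \<Longrightarrow> 1 / real (Suc n) * norm x \<le> norm y" for x y
          using low[of n x] by auto
      qed
      then show ?thesis by auto
    qed
    then obtain y where y: "\<And>n. S (y n) = E (B n) x" "\<And>n. E (B n) (y n) = y n" by metis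
    have yT: "(E (B n) x, y n) \<in> T" for n
    proof -
      let ?k = "Pk T (y n)"
      have "S ?k = 0" unfolding S_def
        using pinv_zero_iff[OF sa cr] proj_in[OF kern_subspace[OF sa] kern_closed[OF sa]] by blast
      then have "E Z ?k = ?k" by (rule EZ_of_S0)
      moreover have "E Z (y n) = 0"
      proof -
        have "Z \<inter> B n = {}" using BZ by blast
        then show ?thesis using EI[of Z "B n" "y n"] y(2) by (simp add: pvm_empty[OF E])
      qed
      ultimately have "ip ?k (y n) = 0" using op_sym[OF op[of Z], of ?k "y n"] by simp
      then have "(norm ?k)\<^sup>2 = 0" using op_norm_sq[OF Pk_op[OF sa], of "y n"] rip_of_ip_0 by metis
      then have "?k = 0" by simp
      then show ?thesis using pinv[OF sa cr, of "y n"] y(1)[of n] by (simp add: S_def)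
    qed
    \<comment> \<open>The preimages are compatible: cutting \<open>y n\<close> down to
      \<open>B m\<close> gives the preimage at stage \<open>m\<close>, as \<open>S\<close> is
      injective on that subspace.\<close>
    have yE: "E (B m) (y n) = y m" if "m \<le> n" for m n
    proof -
      have "E (B m) (E (B m) (y n) - y m) = E (B m) (y n) - y m"
        using op_diff[OF op[OF B]] op_idem[OF op[OF B]] y(2) by simp
      note low[OF this]
      moreover have "S (E (B m) (y n) - y m) = 0"
      proof -
        have "B m \<inter> B n = B m" using Bmono[OF that] by blast
        then show ?thesis using EI[of "B m" "B n" x] by (simp add: S_diff y ES[OF B, symmetric])
      qed
      ultimately have "norm (E (B m) (y n) - y m) \<le> 0" by (simp add: field_simps)
      then show ?thesis by simp
    qed
    have ynorm: "(norm (y n))\<^sup>2 \<le> integral\<^sup>L (?\<mu> x) (\<lambda>t. (g t)\<^sup>2)" for n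
    proof -
      have "E (- Z) (y n) = y n" by (rule pvm_mono[OF E B nZ BZ y(2)])
      then have "(norm (y n))\<^sup>2 = integral\<^sup>L (?\<mu> (y n)) (indicator (- Z))" by (simp add: measure_diag[OF E nZ])
      also have "\<dots> = integral\<^sup>L (?\<mu> (S (y n))) (\<lambda>t. (g t)\<^sup>2)" by (subst int_dens) (simp_all add: sg2)
      also have "\<dots> = integral\<^sup>L (?\<mu> x) (\<lambda>t. indicator (B n) t * (g t)\<^sup>2)"
        unfolding y(1) by (rule integral_diag_proj[OF E]) auto
      also have "\<dots> \<le> integral\<^sup>L (?\<mu> x) (\<lambda>t. (g t)\<^sup>2)"
      proof (intro integral_mono ig)
        show "integrable (?\<mu> x) (\<lambda>t. indicator (B n) t * (g t)\<^sup>2)"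
          by (rule Bochner_Integration.integrable_bound[OF ig]) (auto split: split_indicator)
      qed (auto split: split_indicator)
      finally show ?thesis .
    qed
    \<comment> \<open>Pythagoras turns convergence of the increasing bounded norms into the Cauchy
      property of the vectors.\<close>
    have diff: "(norm (y n - y m))\<^sup>2 = (norm (y n))\<^sup>2 - (norm (y m))\<^sup>2" if "m \<le> n" for m n
      using op_pythagoras[OF op[OF B[of m]], of "y n"] yE[OF that] by simp
    have "incseq (\<lambda>n. (norm (y n))\<^sup>2)"
      unfolding incseq_def using diff by (metis diff_ge_0_iff_ge zero_le_power2)
    then have "Cauchy (\<lambda>n. (norm (y n))\<^sup>2)"
      using incseq_convergent[of "\<lambda>n. (norm (y n))\<^sup>2"] ynorm by (metis LIMSEQ_imp_Cauchy)
    have "Cauchy y"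
    proof (rule CauchyI)
      fix e :: real assume e: "e > 0"
      with \<open>Cauchy (\<lambda>n. (norm (y n))\<^sup>2)\<close> obtain N where
        N: "\<And>m n. m \<ge> N \<Longrightarrow> n \<ge> N \<Longrightarrow> norm ((norm (y m))\<^sup>2 - (norm (y n))\<^sup>2) < e\<^sup>2"
        unfolding Cauchy_iff by (metis zero_less_power)
      have "norm (y m - y n) < e" if "m \<ge> N" "n \<ge> N" for m n
      proof (rule power2_less_imp_less)
        show "(norm (y m - y n))\<^sup>2 < e\<^sup>2"
          using N[OF that] diff[of m n] diff[of n m] by (cases "m \<le> n") (auto simp: norm_minus_commute)
      qed (use e in simp)
      then show "\<exists>N. \<forall>m\<ge>N. \<forall>n\<ge>N. norm (y m - y n) < e" by blast
    qed
    then obtain l where l: "y \<longlonglongrightarrow> l" by (meson Cauchy_convergent convergent_def)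
    have "(\<lambda>n. E (B n) x) \<longlonglongrightarrow> E (- Z) x"
      unfolding Bun[symmetric] by (rule pvm_incseq[OF E]) (use Bmono in \<open>auto simp: incseq_def\<close>)
    from sa_lim[OF sa yT this l] have "(E (- Z) x, l) \<in> T" .
    moreover have "(E Z x, 0) \<in> T"
      using S_EZ[of x] pinv_zero_iff[OF sa cr] unfolding S_def kern_def[OF sa] by simp
    ultimately have "(E Z x + E (- Z) x, 0 + l) \<in> T" by (intro sa_add[OF sa])
    then show ?thesis unfolding split[of x, symmetric] by blast
  qed
  have "spectral_measure_of T F"
    unfolding spectral_measure_of_def using F sub1 sub2 val by auto
  then show ?thesis by blast
qed

end


section \<open>Spectral subspaces and the gap metric\<close>

context hilbert_space
begin

section \<open>Reduction of an operator by its spectral projections\<close>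

context
  fixes T :: "'h operator" and E :: "real set \<Rightarrow> 'h \<Rightarrow> 'h"
  assumes sa: "selfadjoint T" and sm: "spectral_measure_of T E"
begin

lemma sm_pvm: "projection_valued_measure E"
  using sm by (simp add: spectral_measure_of_def)

lemmas sm_op = pvm_op[OF sm_pvm]

lemma sm_dom: "x \<in> Domain T \<longleftrightarrow> integrable (diag_measure E x) (\<lambda>t. t\<^sup>2)"
  using sm by (simp add: spectral_measure_of_def)

lemma sm_val: "(x, y) \<in> T \<Longrightarrow> rip y x = integral\<^sup>L (diag_measure E x) (\<lambda>t. t)"
proof -
  assume "(x, y) \<in> T"
  then have "ip y x = of_real (integral\<^sup>L (diag_measure E x) (\<lambda>t. t))"
    using sm unfolding spectral_measure_of_def by blast
  then show ?thesis by (simp add: rip_def)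
qed

lemma sm_bounded_dom:
  assumes [measurable]: "B \<in> sets borel" and B: "\<And>t. t \<in> B \<Longrightarrow> \<bar>t\<bar> \<le> c"
  shows "E B x \<in> Domain T"
proof -
  have "integrable (diag_measure E x) (\<lambda>t. indicator B t * t\<^sup>2)"
  proof (rule finite_measure.integrable_const_bound[OF finite_measure_diag[OF sm_pvm], of _ "c\<^sup>2"])
    have "norm (indicator B t * t\<^sup>2) \<le> c\<^sup>2" for t
      using abs_square_le[OF B, of t] by (auto split: split_indicator)
    then show "AE t in diag_measure E x. norm (indicator B t * t\<^sup>2) \<le> c\<^sup>2" by simp
    show "(\<lambda>t. indicator B t * t\<^sup>2) \<in> borel_measurable (diag_measure E x)"
      using sets_diag_measure[OF sm_pvm, measurable_cong] by measurable
  qed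
  then show ?thesis unfolding sm_dom by (subst integrable_diag_proj[OF sm_pvm]) auto
qed

lemma sm_proj_dom:
  assumes [measurable]: "B \<in> sets borel" and x: "x \<in> Domain T"
  shows "E B x \<in> Domain T"
proof -
  note [measurable_cong] = sets_diag_measure[OF sm_pvm]
  have "integrable (diag_measure E x) (\<lambda>t. indicator B t * t\<^sup>2)"
    by (rule Bochner_Integration.integrable_bound[OF x[unfolded sm_dom]]) (auto split: split_indicator)
  then show ?thesis unfolding sm_dom by (subst integrable_diag_proj[OF sm_pvm]) auto
qed

lemma sm_trunc_lim:
  assumes "B \<in> sets borel"
  shows "(\<lambda>n. E (B \<inter> {- real n..real n}) x) \<longlonglongrightarrow> E B x"
proof -
  have "(\<Union>n. B \<inter> {- real n..real n}) = B"
  proof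
    show "B \<subseteq> (\<Union>n. B \<inter> {- real n..real n})"
    proof
      fix t assume "t \<in> B"
      obtain n where "\<bar>t\<bar> \<le> real n" using real_arch_simple by blast
      then show "t \<in> (\<Union>n. B \<inter> {- real n..real n})" using \<open>t \<in> B\<close> by (auto intro!: exI[of _ n])
    qed
  qed blast
  moreover have "(\<lambda>n. E (B \<inter> {- real n..real n}) x) \<longlonglongrightarrow> E (\<Union>n. B \<inter> {- real n..real n}) x"
    using assms by (intro pvm_incseq[OF sm_pvm]) (auto simp: incseq_def)
  ultimately show ?thesis by simp
qed

text \<open>The spectral measure determines only the quadratic form, so polarise: for
  \<open>x\<close> in the range and \<open>z\<close> in the kernel of \<open>E B\<close>, the
  vectors \<open>x + z\<close> and \<open>x - z\<close> have the same diagonal measure, and the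
  mixed term drops out.\<close>

lemma sm_orth_rip:
  assumes B: "B \<in> sets borel" and xy: "(x, y) \<in> T" and Bx: "E B x = x" and zw: "(z, w) \<in> T" and Bz: "E B z = 0"
  shows "rip y z = 0"
proof -
  have cross: "rip (E C x) (E C z) = 0" if C: "C \<in> sets borel" for C
  proof -
    have "E C x = E B (E C x)" using pvm_Int[OF sm_pvm B C] pvm_Int[OF sm_pvm C B] Bx by (metis Int_commute)
    then have "rip (E C x) (E C z) = rip (E B (E C x)) z"
      by (metis op_idem[OF sm_op[OF C]] op_rsym[OF sm_op[OF C]])
    then show ?thesis by (simp add: op_rsym[OF sm_op[OF B]] Bz)
  qed
  have "diag_measure E (x + z) = diag_measure E (x - z)"
  proof (rule measure_eqI)
    fix C assume "C \<in> sets (diag_measure E (x + z))"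
    then have C: "C \<in> sets borel" using sets_diag_measure[OF sm_pvm] by simp
    show "emeasure (diag_measure E (x + z)) C = emeasure (diag_measure E (x - z)) C"
      using cross[OF C]
      by (simp add: emeasure_diag_measure[OF sm_pvm C] op_add[OF sm_op[OF C]] op_diff[OF sm_op[OF C]]
          norm_add_sq norm_diff_sq)
  qed (simp add: sets_diag_measure[OF sm_pvm])
  then have "rip (y + w) (x + z) = rip (y - w) (x - z)"
    using sm_val[OF sa_add[OF sa xy zw]] sm_val[OF sa_diff[OF sa xy zw]] by simp
  moreover have "rip w x = rip y z"
    using rip_of_ip_eq[OF sa_sym[OF sa zw xy]] by (simp add: rip_commute)
  ultimately show ?thesis by (simp add: rip_add_left rip_add_right rip_diff_left rip_diff_right)
qed

lemma sm_orth:
  assumes B: "B \<in> sets borel" and xy: "(x, y) \<in> T" and Bx: "E B x = x" and zw: "(z, w) \<in> T" and Bz: "E B z = 0"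
  shows "ip z y = 0"
proof -
  let ?c = "sconj (ip z y)"
  have "rip y (?c *\<^sub>K z) = 0"
    by (rule sm_orth_rip[OF B xy Bx sa_scale[OF sa zw]]) (simp add: op_scale[OF sm_op[OF B]] Bz)
  then have "(norm (ip z y))\<^sup>2 = 0" using rip_sconj_scale[of z y] by (simp add: rip_commute)
  then show ?thesis by simp
qed

text \<open>By \<open>sm_orth\<close>, \<open>y\<close> is orthogonal to all domain vectors in the
  complementary subspace. The part of \<open>y\<close> outside \<open>B\<close> is a limit of such
  vectors, truncations to bounded sets being in the domain.\<close>

lemma sm_inv:
  assumes B: "B \<in> sets borel" and xy: "(x, y) \<in> T" and Bx: "E B x = x"
  shows "E B y = y"
proof -
  have nB: "- B \<in> sets borel" using B by (simp add: borel_comp)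
  have "ip (E (- B \<inter> {- real n..real n}) y) y = 0" for n
  proof -
    let ?C = "- B \<inter> {- real n..real n}"
    have C: "?C \<in> sets borel" using nB by auto
    have "E ?C y \<in> Domain T" by (rule sm_bounded_dom[OF C, of "real n"]) auto
    then obtain w where w: "(E ?C y, w) \<in> T" by blast
    have "B \<inter> ?C = {}" by blast
    then have "E B (E ?C y) = 0" using pvm_Int[OF sm_pvm B C, of y] pvm_empty[OF sm_pvm] by simp
    then show ?thesis using sm_orth[OF B xy Bx w] by simp
  qed
  moreover have "(\<lambda>n. ip (E (- B \<inter> {- real n..real n}) y) y) \<longlonglongrightarrow> ip (E (- B) y) y"
    by (intro tendsto_intros sm_trunc_lim nB)
  ultimately have "ip (E (- B) y) y = 0" by (simp add: LIMSEQ_const_iff)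
  then have "(norm (E (- B) y))\<^sup>2 = 0" using op_norm_sq[OF sm_op[OF nB]] rip_of_ip_0 by metis
  then show ?thesis using pvm_Compl[OF sm_pvm B, of y] by simp
qed

lemma sm_reduces: 
  assumes B: "B \<in> sets borel" and xy: "(x, y) \<in> T"
  shows "(E B x, E B y) \<in> T"
proof -
  have nB: "- B \<in> sets borel" using B by (simp add: borel_comp)
  have "E B x \<in> Domain T" using sm_proj_dom[OF B] xy by blast
  then obtain u where u: "(E B x, u) \<in> T" by blast
  have "E B u = u" by (rule sm_inv[OF B u op_idem[OF sm_op[OF B]]])
  have "(x - E B x, y - u) \<in> T" by (rule sa_diff[OF sa xy u])
  moreover have "E (- B) (x - E B x) = x - E B x"
    by (simp add: pvm_Compl[OF sm_pvm B] op_diff[OF sm_op[OF B]] op_idem[OF sm_op[OF B]])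
  ultimately have "E (- B) (y - u) = y - u" by (rule sm_inv[OF nB])
  then have "E B (y - u) = 0" by (simp add: pvm_Compl[OF sm_pvm B])
  then show ?thesis using u \<open>E B u = u\<close> by (simp add: op_diff[OF sm_op[OF B]])
qed

section \<open>Form and norm bounds on spectral subspaces\<close>

lemma sm_int:
  assumes "x \<in> Domain T"
  shows "integrable (diag_measure E x) (\<lambda>t. t)"
proof -
  interpret finite_measure "diag_measure E x" by (rule finite_measure_diag[OF sm_pvm])
  note [measurable_cong] = sets_diag_measure[OF sm_pvm]
  show ?thesis
  proof (rule Bochner_Integration.integrable_bound)
    show "integrable (diag_measure E x) (\<lambda>t. t\<^sup>2 + 1)" using assms sm_dom by simp
    have "\<bar>t\<bar> \<le> t\<^sup>2 + 1" for t :: real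
    proof -
      have "0 \<le> (\<bar>t\<bar> - 1)\<^sup>2" by simp
      then have "2 * \<bar>t\<bar> \<le> t\<^sup>2 + 1" by (simp add: power2_diff)
      then show ?thesis using zero_le_power2[of t] by linarith
    qed
    then show "AE t in diag_measure E x. norm t \<le> norm (t\<^sup>2 + 1)" by simp
  qed measurable
qed

lemma sm_int_diff: "(x, y) \<in> T \<Longrightarrow> integrable (diag_measure E x) (\<lambda>t. t - m)"
  using sm_int[of x] finite_measure.integrable_const[OF finite_measure_diag[OF sm_pvm]]
  by (intro Bochner_Integration.integrable_diff) auto

lemma sm_form:
  assumes xy: "(x, y) \<in> T"
  shows "rip (y - m *\<^sub>R x) x = integral\<^sup>L (diag_measure E x) (\<lambda>t. t - m)"
proof -
  interpret finite_measure "diag_measure E x" by (rule finite_measure_diag[OF sm_pvm])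
  have "integral\<^sup>L (diag_measure E x) (\<lambda>t. t - m) = integral\<^sup>L (diag_measure E x) (\<lambda>t. t) - m * (norm x)\<^sup>2"
    using sm_int xy by (subst Bochner_Integration.integral_diff)
      (auto simp: space_diag_measure[OF sm_pvm] measure_diag_UNIV[OF sm_pvm] Domain.DomainI)
  then show ?thesis using sm_val[OF xy] by (simp add: rip_diff_left rip_scaleR_left rip_self)
qed

lemma sm_AE:
  assumes "B \<in> sets borel" "E B x = x"
  shows "AE t in diag_measure E x. t \<in> B"
  using AE_diag_proj[OF sm_pvm assms(1), of x] unfolding assms(2) .

lemma sm_form_ge:
  assumes B: "B \<in> sets borel" and xy: "(x, y) \<in> T" and Bx: "E B x = x" and r: "\<And>t. t \<in> B \<Longrightarrow> r \<le> t - m"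
  shows "r * (norm x)\<^sup>2 \<le> rip (y - m *\<^sub>R x) x"
proof -
  interpret finite_measure "diag_measure E x" by (rule finite_measure_diag[OF sm_pvm])
  have "r * (norm x)\<^sup>2 = integral\<^sup>L (diag_measure E x) (\<lambda>t. r)"
    by (simp add: space_diag_measure[OF sm_pvm] measure_diag_UNIV[OF sm_pvm])
  also have "\<dots> \<le> integral\<^sup>L (diag_measure E x) (\<lambda>t. t - m)"
  proof (rule integral_mono_AE)
    show "AE t in diag_measure E x. r \<le> t - m" using sm_AE[OF B Bx] by (rule AE_mp) (use r in auto)
  qed (use sm_int_diff[OF xy] in auto)
  finally show ?thesis by (simp add: sm_form[OF xy])
qed

lemma sm_form_le:
  assumes B: "B \<in> sets borel" and xy: "(x, y) \<in> T" and Bx: "E B x = x" and r: "\<And>t. t \<in> B \<Longrightarrow> t - m \<le> r"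
  shows "rip (y - m *\<^sub>R x) x \<le> r * (norm x)\<^sup>2"
proof -
  interpret finite_measure "diag_measure E x" by (rule finite_measure_diag[OF sm_pvm])
  have "r * (norm x)\<^sup>2 = integral\<^sup>L (diag_measure E x) (\<lambda>t. r)"
    by (simp add: space_diag_measure[OF sm_pvm] measure_diag_UNIV[OF sm_pvm])
  also have "\<dots> \<ge> integral\<^sup>L (diag_measure E x) (\<lambda>t. t - m)"
  proof (rule integral_mono_AE)
    show "AE t in diag_measure E x. t - m \<le> r" using sm_AE[OF B Bx] by (rule AE_mp) (use r in auto)
  qed (use sm_int_diff[OF xy] in auto)
  finally show ?thesis by (simp add: sm_form[OF xy])
qed

text \<open>For a symmetric operator the norm is controlled by the quadratic form, by polarisation:
  the form is tested at \<open>x + z\<close> and \<open>x - z\<close> with \<open>z\<close> in the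
  direction of the image \<open>v\<close>.\<close>

lemma sm_upper:
  assumes B: "B \<in> sets borel" and BI: "B \<subseteq> {m - r..m + r}" and xy: "(x, y) \<in> T" and Bx: "E B x = x"
  shows "norm (y - m *\<^sub>R x) \<le> r * norm x"
proof (cases "y - m *\<^sub>R x = 0 \<or> x = 0")
  case True
  then show ?thesis
  proof
    assume "x = 0"
    then show ?thesis using sa_unique[OF sa sa_zero[OF sa]] xy by auto
  next
    assume 0: "y - m *\<^sub>R x = 0"
    \<comment> \<open>A negative \<open>r\<close> would make \<open>B\<close> empty and hence
      \<open>x = 0\<close>.\<close>
    have "r \<ge> 0 \<or> x = 0"
    proof (rule ccontr)
      assume "\<not> ?thesis"
      then have "B = {}" using BI by auto
      then show False using Bx pvm_empty[OF sm_pvm, of x] \<open>\<not> (r \<ge> 0 \<or> x = 0)\<close> by simp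
    qed
    then show ?thesis using 0 by auto
  qed
next
  case False
  define v where "v = y - m *\<^sub>R x"
  have q: "\<bar>rip (y' - m *\<^sub>R x') x'\<bar> \<le> r * (norm x')\<^sup>2" if "(x', y') \<in> T" "E B x' = x'" for x' y'
    using sm_form_ge[OF B that, of "- r" m] sm_form_le[OF B that, of m r] BI by (force simp: abs_le_iff)
  define a where "a = norm x / norm v"
  have v0: "norm v > 0" "norm x > 0" using False by (auto simp: v_def)
  define z where "z = a *\<^sub>R v"
  have nz: "norm z = norm x" using v0 by (simp add: z_def a_def)
  have Ev: "E B v = v"
    using sm_inv[OF B xy Bx] Bx by (simp add: v_def op_diff[OF sm_op[OF B]] op_scaleR[OF sm_op[OF B]])
  then have Ez: "E B z = z" by (simp add: z_def op_scaleR[OF sm_op[OF B]])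
  have "\<bar>t\<bar> \<le> \<bar>m\<bar> + \<bar>r\<bar>" if "t \<in> B" for t
  proof -
    have "m - r \<le> t \<and> t \<le> m + r" using BI that by auto
    then show ?thesis by arith
  qed
  from sm_bounded_dom[OF B this, of z] have "z \<in> Domain T" using Ez by simp
  then obtain w where w: "(z, w) \<in> T" by blast
  let ?L = "\<lambda>y x. y - m *\<^sub>R x"
  have 1: "rip (?L (y + w) (x + z)) (x + z) \<le> r * (norm (x + z))\<^sup>2"
    using q[OF sa_add[OF sa xy w]] by (simp add: op_add[OF sm_op[OF B]] Bx Ez)
  have 2: "- (r * (norm (x - z))\<^sup>2) \<le> rip (?L (y - w) (x - z)) (x - z)"
    using q[OF sa_diff[OF sa xy w]] by (simp add: op_diff[OF sm_op[OF B]] Bx Ez)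
  have 3: "rip w x = rip y z"
    using rip_of_ip_eq[OF sa_sym[OF sa w xy]] by (simp add: rip_commute)
  have "rip (?L (y + w) (x + z)) (x + z) - rip (?L (y - w) (x - z)) (x - z) = 4 * rip v z"
    by (simp add: v_def rip_add_left rip_add_right rip_diff_left rip_diff_right rip_scaleR_left 3
        rip_commute[of z x] algebra_simps)
  moreover have "(norm (x + z))\<^sup>2 + (norm (x - z))\<^sup>2 = 4 * (norm x)\<^sup>2"
    unfolding norm_add_sq norm_diff_sq nz by simp
  then have "r * (norm (x + z))\<^sup>2 + r * (norm (x - z))\<^sup>2 = 4 * (r * (norm x)\<^sup>2)"
    by (metis distrib_left mult.left_commute)
  ultimately have "rip v z \<le> r * (norm x)\<^sup>2" using 1 2 by linarith
  also have "rip v z = norm x * norm v"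
    using v0 by (simp add: z_def rip_scaleR_right rip_self a_def power2_eq_square)
  finally show ?thesis using v0 by (simp add: v_def power2_eq_square mult.commute)
qed

lemma norm_ge_of_form:
  assumes "r * (norm x)\<^sup>2 \<le> \<bar>rip v x\<bar>"
  shows "r * norm x \<le> norm v"
proof (cases "x = 0")
  case False
  have "r * (norm x)\<^sup>2 \<le> norm v * norm x" using assms rip_le[of v x] by linarith
  then show ?thesis using False by (simp add: power2_eq_square)
qed simp

text \<open>The form is not definite on all of \<open>B\<close>. Above \<open>m + r\<close> and
  below \<open>m - r\<close> it has a definite sign and yields the bound; the two parts are
  orthogonal and the squares add.\<close>

lemma sm_lower:
  assumes B: "B \<in> sets borel" and BI: "B \<inter> {m - r<..<m + r} = {}" and xy: "(x, y) \<in> T" and Bx: "E B x = x"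
  shows "r * norm x \<le> norm (y - m *\<^sub>R x)"
proof (cases "r > 0")
  case False
  then have "r * norm x \<le> 0" by (simp add: mult_nonpos_nonneg)
  then show ?thesis using norm_ge_zero order_trans by blast
next
  case r: True
  let ?B1 = "B \<inter> {m + r..}" and ?B2 = "B \<inter> {..m - r}"
  have B1: "?B1 \<in> sets borel" and B2: "?B2 \<in> sets borel" using B by auto
  have B12: "B = ?B1 \<union> ?B2" "?B1 \<inter> ?B2 = {}" using BI r by force+
  define v where "v = y - m *\<^sub>R x"
  have "r * norm (E ?B1 x) \<le> norm (E ?B1 y - m *\<^sub>R E ?B1 x)"
    using sm_form_ge[OF B1 sm_reduces[OF B1 xy] op_idem[OF sm_op[OF B1]], of r m]
    by (intro norm_ge_of_form) auto
  then have 1: "r * norm (E ?B1 x) \<le> norm (E ?B1 v)"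
    by (simp add: v_def op_diff[OF sm_op[OF B1]] op_scaleR[OF sm_op[OF B1]])
  have "r * norm (E ?B2 x) \<le> norm (E ?B2 y - m *\<^sub>R E ?B2 x)"
    using sm_form_le[OF B2 sm_reduces[OF B2 xy] op_idem[OF sm_op[OF B2]], of m "- r"]
    by (intro norm_ge_of_form) auto
  then have 2: "r * norm (E ?B2 x) \<le> norm (E ?B2 v)"
    by (simp add: v_def op_diff[OF sm_op[OF B2]] op_scaleR[OF sm_op[OF B2]])
  have Ev: "E B v = v"
    using sm_inv[OF B xy Bx] Bx by (simp add: v_def op_diff[OF sm_op[OF B]] op_scaleR[OF sm_op[OF B]])
  have sq: "(norm u)\<^sup>2 = (norm (E ?B1 u))\<^sup>2 + (norm (E ?B2 u))\<^sup>2" if "E B u = u" for u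
  proof -
    have "u = E ?B1 u + E ?B2 u" using pvm_Un[OF sm_pvm B1 B2 B12(2), of u] that B12(1) by simp
    then have "u - E ?B1 u = E ?B2 u" by (metis add_diff_cancel_left')
    then show ?thesis using op_pythagoras[OF sm_op[OF B1], of u] by simp
  qed
  have "(r * norm x)\<^sup>2 = (r * norm (E ?B1 x))\<^sup>2 + (r * norm (E ?B2 x))\<^sup>2"
    by (simp add: power_mult_distrib sq[OF Bx] distrib_left)
  also have "\<dots> \<le> (norm (E ?B1 v))\<^sup>2 + (norm (E ?B2 v))\<^sup>2"
    using r 1 2 by (intro add_mono power_mono) auto
  also have "\<dots> = (norm v)\<^sup>2" by (rule sq[OF Ev, symmetric])
  finally show ?thesis unfolding v_def by (rule power2_le_imp_le) simp
qed

end

section \<open>The gap distance and nearby spectral subspaces\<close>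

lemma
  assumes S: "S \<in> closed_operators"
  shows graph_proj_in: "graph_proj S z \<in> S" and bounded_linear_graph_proj: "bounded_linear (graph_proj S)"
    and graph_proj_id: "z \<in> S \<Longrightarrow> graph_proj S z = z"
proof -
  interpret H2: hilbert_space scale2 ip2 by (rule hilbert_space_product)
  have eq: "graph_proj S = H2.proj S" by (simp add: fun_eq_iff graph_proj_def H2.proj_def)
  have S': "H2.subspace S" "closed S" using S by (auto simp: closed_operators_def)
  show "graph_proj S z \<in> S" unfolding eq by (rule H2.proj_in[OF S'])
  show "bounded_linear (graph_proj S)"
    unfolding eq by (intro H2.op_bounded_linear H2.orthogonal_projection_proj S')
  show "z \<in> S \<Longrightarrow> graph_proj S z = z" unfolding eq by (rule H2.proj_id[OF S'(1)])
qed

text \<open>The form in which the gap enters estimates: a vector and its image under one operator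
  are approximated simultaneously by such a pair of the other.\<close>

lemma gap_dist_approx:
  assumes "T \<in> closed_operators" "S \<in> closed_operators" "z \<in> T"
  obtains z' where "z' \<in> S" "norm (z - z') \<le> gap_dist T S * norm z"
proof
  show "graph_proj S z \<in> S" by (rule graph_proj_in[OF assms(2)])
  have "norm (graph_proj T z - graph_proj S z) \<le> gap_dist T S * norm z"
    unfolding gap_dist_def
    by (rule onorm) (intro bounded_linear_sub bounded_linear_graph_proj assms)
  then show "norm (z - graph_proj S z) \<le> gap_dist T S * norm z" by (simp add: graph_proj_id[OF assms(1,3)])
qed

lemma gap_dist_nonneg:
  assumes "T \<in> closed_operators" "S \<in> closed_operators"
  shows "0 \<le> gap_dist T S"
  unfolding gap_dist_def by (intro onorm_pos_le bounded_linear_sub bounded_linear_graph_proj assms)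

lemma gap_dist_commute: "gap_dist T S = gap_dist S T"
proof -
  have "(\<lambda>z. graph_proj T z - graph_proj S z) = (\<lambda>z. - (graph_proj S z - graph_proj T z))" by simp
  then show ?thesis unfolding gap_dist_def by (simp only: onorm_neg)
qed

lemma gap_dist_self [simp]: "gap_dist T T = 0"
  by (simp add: gap_dist_def onorm_zero)

text \<open>Moving from \<open>T\<close> to \<open>S\<close> costs a multiple of the gap; on the two spectral subspaces the operators
  \<open>T - m\<close> and \<open>S - m\<close> are bounded by \<open>r\<^sub>0\<close> and bounded below by \<open>r\<^sub>1\<close>. Hence the norm \<open>q\<close> of the
  product satisfies \<open>r\<^sub>1 q \<le> r\<^sub>0 q + C \<delta>\<close>.\<close>

lemma spectral_subspaces_close:
  fixes m r0 r1 :: real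
  assumes T: "selfadjoint T" "spectral_measure_of T E" and S: "selfadjoint S" "spectral_measure_of S F"
    and r: "0 \<le> r0" "r0 < r1"
  defines "C \<equiv> (1 + \<bar>m\<bar> + r1) * (1 + \<bar>m\<bar> + r0) / (r1 - r0)"
  shows "norm (E {m - r0..m + r0} x - F {m - r1<..<m + r1} (E {m - r0..m + r0} x)) \<le> C * gap_dist T S * norm x"
proof -
  let ?I = "{m - r0..m + r0}" and ?J = "{m - r1<..<m + r1}"
  let ?d = "gap_dist T S"
  have I: "?I \<in> sets borel" and J: "?J \<in> sets borel" and nJ: "- ?J \<in> sets borel" by (auto simp: borel_comp)
  note E = sm_pvm[OF T] and F = sm_pvm[OF S]
  note opI = sm_op[OF T I] and opnJ = sm_op[OF S nJ]
  define Q where "Q x = F (- ?J) x" for x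
  have Q: "Q x = x - F ?J x" for x unfolding Q_def by (rule pvm_Compl[OF F J])
  have Qle: "norm (Q x) \<le> norm x" for x unfolding Q_def by (rule op_norm_le[OF opnJ])
  have Qdiff: "Q (x - y) = Q x - Q y" for x y unfolding Q_def by (rule op_diff[OF opnJ])
  have Qsc: "Q (a *\<^sub>R x) = a *\<^sub>R Q x" for a x unfolding Q_def by (rule op_scaleR[OF opnJ])
  define P where "P = E ?I"
  have bl: "bounded_linear (\<lambda>x. Q (P x))"
    unfolding Q_def P_def using bounded_linear_compose[OF op_bounded_linear[OF opnJ] op_bounded_linear[OF opI]] .
  define q where "q = onorm (\<lambda>x. Q (P x))"
  have q0: "q \<ge> 0" unfolding q_def by (rule onorm_pos_le[OF bl])
  have qb: "norm (Q (P x)) \<le> q * norm x" for x unfolding q_def by (rule onorm[OF bl])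
  have cT: "T \<in> closed_operators" and cS: "S \<in> closed_operators" using sa_closed_op T(1) S(1) by auto
  have d0: "?d \<ge> 0" by (rule gap_dist_nonneg[OF cT cS])
  define c where "c = (1 + \<bar>m\<bar> + r1) * (1 + \<bar>m\<bar> + r0) * ?d"
  have c0: "c \<ge> 0" using r d0 by (auto simp: c_def)
  have main: "r1 * norm (Q (P x)) \<le> (q * r0 + c) * norm x" for x
  proof -
    define x0 where "x0 = P x"
    have Px0: "E ?I x0 = x0" by (simp add: x0_def P_def op_idem[OF opI])
    have nx0: "norm x0 \<le> norm x" unfolding x0_def P_def by (rule op_norm_le[OF opI])
    have "\<bar>t\<bar> \<le> \<bar>m\<bar> + r0" if "t \<in> ?I" for t using that by auto
    from sm_bounded_dom[OF T I this, of x0] obtain y0 where y0: "(x0, y0) \<in> T" using Px0 by auto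
    have up: "norm (y0 - m *\<^sub>R x0) \<le> r0 * norm x0" by (rule sm_upper[OF T I _ y0 Px0]) simp
    have ny0: "norm y0 \<le> (\<bar>m\<bar> + r0) * norm x0"
      using norm_triangle_ineq[of "y0 - m *\<^sub>R x0" "m *\<^sub>R x0"] up by (simp add: algebra_simps)
    have "norm (x0, y0) \<le> norm x0 + norm y0" by (rule norm_Pair_le)
    then have nz: "norm (x0, y0) \<le> (1 + \<bar>m\<bar> + r0) * norm x0" using ny0 by (simp add: algebra_simps)
    obtain x' y' where S': "(x', y') \<in> S" and close: "norm ((x0, y0) - (x', y')) \<le> ?d * norm (x0, y0)"
      using gap_dist_approx[OF cT cS y0] by (metis surj_pair)
    define e where "e = ?d * norm (x0, y0)"
    have e: "norm (x0 - x') \<le> e" "norm (y0 - y') \<le> e"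
      using close norm_fst_le[of "x0 - x'" "y0 - y'"] norm_snd_le[of "y0 - y'" "x0 - x'"]
      by (auto simp: e_def)
    have red: "(F (- ?J) x', F (- ?J) y') \<in> S" by (rule sm_reduces[OF S nJ S'])
    have "r1 * norm (Q x') \<le> norm (Q y' - m *\<^sub>R Q x')"
      unfolding Q_def by (rule sm_lower[OF S nJ _ red]) (auto simp: op_idem[OF opnJ])
    also have "Q y' - m *\<^sub>R Q x' = Q (y0 - m *\<^sub>R x0) - Q ((y0 - y') - m *\<^sub>R (x0 - x'))"
      by (simp add: Qdiff Qsc scaleR_diff_right)
    also have "norm \<dots> \<le> norm (Q (y0 - m *\<^sub>R x0)) + norm (Q ((y0 - y') - m *\<^sub>R (x0 - x')))"
      by (rule norm_triangle_ineq4)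
    \<comment> \<open>\<open>y0\<close> minus \<open>m\<close> times \<open>x0\<close> lies in the
      range of \<open>P\<close> again, so the norm \<open>q\<close> being estimated reappears, but
      with the smaller factor \<open>r0\<close>.\<close>
    also have "norm (Q (y0 - m *\<^sub>R x0)) \<le> q * (r0 * norm x0)"
    proof -
      have "P (y0 - m *\<^sub>R x0) = y0 - m *\<^sub>R x0"
        using sm_inv[OF T I y0 Px0] Px0 by (simp add: P_def op_diff[OF opI] op_scaleR[OF opI])
      then have "norm (Q (y0 - m *\<^sub>R x0)) \<le> q * norm (y0 - m *\<^sub>R x0)" using qb by metis
      also have "\<dots> \<le> q * (r0 * norm x0)" using up q0 by (rule mult_left_mono)
      finally show ?thesis .
    qed
    also have "norm (Q ((y0 - y') - m *\<^sub>R (x0 - x'))) \<le> (1 + \<bar>m\<bar>) * e"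
    proof -
      have "norm (Q ((y0 - y') - m *\<^sub>R (x0 - x'))) \<le> norm (y0 - y') + norm (m *\<^sub>R (x0 - x'))"
        using Qle norm_triangle_ineq4 order_trans by blast
      also have "\<dots> \<le> e + \<bar>m\<bar> * e" using e by (intro add_mono) (auto intro: mult_left_mono)
      finally show ?thesis by (simp add: algebra_simps)
    qed
    finally have 1: "r1 * norm (Q x') \<le> q * (r0 * norm x0) + (1 + \<bar>m\<bar>) * e" by simp
    have "norm (Q x0) \<le> norm (Q x') + norm (Q (x0 - x'))"
      using norm_triangle_ineq[of "Q x'" "Q (x0 - x')"] by (simp add: Qdiff)
    also have "norm (Q (x0 - x')) \<le> e" using Qle e(1) order_trans by blast
    finally have "r1 * norm (Q x0) \<le> r1 * (norm (Q x') + e)" using r by (intro mult_left_mono) auto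
    then have "r1 * norm (Q x0) \<le> q * r0 * norm x0 + (1 + \<bar>m\<bar> + r1) * e" using 1 by (simp add: algebra_simps)
    also have "(1 + \<bar>m\<bar> + r1) * e \<le> (1 + \<bar>m\<bar> + r1) * (?d * ((1 + \<bar>m\<bar> + r0) * norm x0))"
      unfolding e_def using nz d0 r by (intro mult_left_mono) auto
    also have "\<dots> = c * norm x0" by (simp add: c_def)
    finally have "r1 * norm (Q x0) \<le> (q * r0 + c) * norm x0" by (simp add: algebra_simps)
    also have "\<dots> \<le> (q * r0 + c) * norm x" using nx0 q0 r c0 by (intro mult_left_mono) auto
    finally show ?thesis by (simp add: x0_def)
  qed
  \<comment> \<open>Take the supremum over \<open>x\<close> in \<open>main\<close>. Since
    \<open>q\<close> is a finite operator norm and \<open>r0 < r1\<close>, its occurrence on the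
    right can be absorbed.\<close>
  have "q \<le> (q * r0 + c) / r1"
    unfolding q_def[symmetric]
    by (subst (1) q_def, rule onorm_bound) (use main q0 c0 r in \<open>auto simp: field_simps\<close>)
  then have "q * (r1 - r0) \<le> c" using r by (simp add: field_simps)
  then have "q \<le> c / (r1 - r0)" using r by (simp add: field_simps)
  also have "\<dots> = C * ?d" by (simp add: c_def C_def)
  finally have "q * norm x \<le> C * ?d * norm x" by (rule mult_right_mono) simp
  then show ?thesis using qb[of x] by (simp add: Q P_def)
qed

text \<open>The gap of \<open>T\<close> to itself is 0, so \<open>spectral_subspaces_close\<close>
  puts the range of \<open>E\<close> on the closed interval inside the range of \<open>F\<close> on
  every larger open interval; these shrink to the closed one.\<close>

lemma spectral_measure_interval_unique:
  assumes T: "selfadjoint T" and E: "spectral_measure_of T E" and F: "spectral_measure_of T F" and "\<alpha> \<le> \<beta>"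
  shows "E {\<alpha>..\<beta>} = F {\<alpha>..\<beta>}"
proof -
  define m where "m = (\<alpha> + \<beta>) / 2"
  define r where "r = (\<beta> - \<alpha>) / 2"
  have ab: "\<alpha> = m - r" "\<beta> = m + r" "0 \<le> r" using assms(4) by (auto simp: m_def r_def field_simps)
  have I: "{\<alpha>..\<beta>} \<in> sets borel" by simp
  have sub: "F {\<alpha>..\<beta>} (E {\<alpha>..\<beta>} x) = E {\<alpha>..\<beta>} x"
    if E: "spectral_measure_of T E" and F: "spectral_measure_of T F" for E F x
  proof -
    let ?J = "\<lambda>n. {\<alpha> - 1 / real (Suc n)<..<\<beta> + 1 / real (Suc n)}"
    let ?y = "E {\<alpha>..\<beta>} x"
    have "norm (?y - F (?J n) ?y) \<le> 0" for n
      using spectral_subspaces_close[OF T E T F, of r "r + 1 / real (Suc n)" m x] ab(3)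
      by (simp add: ab(1,2) diff_diff_eq add.assoc)
    then have eq: "F (?J n) ?y = ?y" for n by simp
    have "(\<Inter>n. ?J n) = {\<alpha>..\<beta>}"
    proof (intro equalityI subsetI)
      fix t assume t: "t \<in> (\<Inter>n. ?J n)"
      have "\<not> t < \<alpha>"
      proof
        assume "t < \<alpha>"
        then obtain n where "1 / real (Suc n) < \<alpha> - t" using nat_approx_posE[of "\<alpha> - t"] by auto
        moreover have "t \<in> ?J n" using t by blast
        ultimately show False by simp
      qed
      moreover have "\<not> \<beta> < t"
      proof
        assume "\<beta> < t"
        then obtain n where "1 / real (Suc n) < t - \<beta>" using nat_approx_posE[of "t - \<beta>"] by auto
        moreover have "t \<in> ?J n" using t by blast
        ultimately show False by simp
      qed
      ultimately show "t \<in> {\<alpha>..\<beta>}" by simp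
    next
      fix t assume t: "t \<in> {\<alpha>..\<beta>}"
      have "t \<in> ?J n" for n
      proof -
        have "1 / real (Suc n) > 0" by simp
        then show ?thesis using t unfolding greaterThanLessThan_iff atLeastAtMost_iff by linarith
      qed
      then show "t \<in> (\<Inter>n. ?J n)" by blast
    qed
    moreover have "(\<lambda>n. F (?J n) ?y) \<longlonglongrightarrow> F (\<Inter>n. ?J n) ?y"
    proof (rule pvm_decseq[OF sm_pvm[OF T F]])
      have "?J n \<subseteq> ?J k" if "k \<le> n" for k n
      proof -
        have "1 / real (Suc n) \<le> 1 / real (Suc k)" using that by (simp add: frac_le)
        then show ?thesis unfolding subset_iff greaterThanLessThan_iff by (auto simp del: of_nat_Suc)
      qed
      then show "decseq ?J" unfolding decseq_def by blast
    qed auto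
    ultimately show ?thesis using eq by (simp add: LIMSEQ_const_iff)
  qed
  show ?thesis
  proof (rule orthogonal_projection_eqI[OF sm_op[OF T E I] sm_op[OF T F I]])
    show "range (E {\<alpha>..\<beta>}) = range (F {\<alpha>..\<beta>})"
    proof (intro equalityI image_subsetI)
      show "E {\<alpha>..\<beta>} x \<in> range (F {\<alpha>..\<beta>})" for x using sub[OF E F, of x] by (metis rangeI)
      show "F {\<alpha>..\<beta>} x \<in> range (E {\<alpha>..\<beta>})" for x using sub[OF F E, of x] by (metis rangeI)
    qed
  qed
qed

lemma spectral_proj_eq:
  assumes "selfadjoint T" "spectral_measure_of T E" "\<alpha> \<le> \<beta>"
  shows "spectral_proj {\<alpha>..\<beta>} T = E {\<alpha>..\<beta>}"
  unfolding spectral_proj_def using spectral_measure_interval_unique assms by (intro the_equality) blast+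

end


section \<open>Spectrum, Fredholm property and isolated spectral parts\<close>

context hilbert_space
begin

section \<open>Finite-dimensional subspaces\<close>

definition fin_dim :: "'h set \<Rightarrow> bool" where
  "fin_dim V \<longleftrightarrow> (\<exists>F. finite F \<and> V \<subseteq> span F)"

lemma fin_dim_mono: "V \<subseteq> W \<Longrightarrow> fin_dim W \<Longrightarrow> fin_dim V"
  unfolding fin_dim_def by blast

lemma fin_dim_basis:
  assumes "fin_dim V"
  obtains B where "finite B" "B \<subseteq> V" "independent B" "V \<subseteq> span B" "card B = dim V"
proof -
  obtain F where F: "finite F" "V \<subseteq> span F" using assms by (auto simp: fin_dim_def)
  obtain B where B: "B \<subseteq> V" "independent B" "V \<subseteq> span B" "card B = dim V" by (rule basis_exists)
  have "finite B" using independent_span_bound[OF F(1) B(2)] B(1) F(2) by blast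
  then show ?thesis using that B by blast
qed

lemma fin_dim_inj:
  assumes add: "\<And>x y. f (x + y) = f x + f y" and sc: "\<And>c x. f (c *\<^sub>K x) = c *\<^sub>K f x"
    and V: "subspace V" and inj: "\<And>x. x \<in> V \<Longrightarrow> f x = 0 \<Longrightarrow> x = 0"
    and im: "f ` V \<subseteq> W" and W: "fin_dim W"
  shows "fin_dim V" "dim V \<le> dim W"
proof -
  obtain C where C: "finite C" "C \<subseteq> W" "independent C" "W \<subseteq> span C" "card C = dim W"
    using fin_dim_basis[OF W] .
  obtain B where B: "B \<subseteq> V" "independent B" "V \<subseteq> span B" "card B = dim V" by (rule basis_exists)
  have spB: "span B \<subseteq> V" using B(1) V by (rule span_minimal)
  interpret f: module_hom scale scale f
    unfolding module_hom_iff using add sc module_axioms by auto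
  have injB: "inj_on f (span B)"
    unfolding f.inj_on_iff_eq_0[OF subspace_span] using inj spB by blast
  have "independent (f ` B)" using B(2) injB by (rule f.independent_injective_image)
  moreover have "f ` B \<subseteq> span C" using B(1) im C(4) by blast
  ultimately have fB: "finite (f ` B)" "card (f ` B) \<le> card C"
    using independent_span_bound[OF C(1)] by blast+
  have "inj_on f B" using injB span_superset inj_on_subset by blast
  then have "finite B" "card B \<le> card C" using fB by (auto simp: finite_image_iff card_image)
  then show "fin_dim V" "dim V \<le> dim W" using B C by (auto simp: fin_dim_def)
qed

lemma closed_span_finite: "finite F \<Longrightarrow> closed (span F)"
proof (induction F rule: finite_induct)
  case (insert v F)
  let ?M = "span F"
  define p where "p = proj ?M v"
  define w where "w = v - p"
  have p: "p \<in> ?M" unfolding p_def by (rule proj_in[OF subspace_span insert.IH])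
  have orth: "ip m w = 0" if "m \<in> ?M" for m
    using proj_orth[OF subspace_span insert.IH that, of v] ip_commute_zero by (simp add: w_def p_def)
  have ipv: "ip v w = of_real ((norm w)\<^sup>2)"
    using orth[OF p] ip_self[of w] by (simp add: w_def ip_diff_left)
  show ?case
  proof (cases "w = 0")
    case True
    then have "v \<in> ?M" using p by (simp add: w_def)
    then show ?thesis using insert.IH by (simp add: span_redundant)
  next
    case False
    \<comment> \<open>The coefficient of \<open>z\<close> along \<open>w\<close>, the part of
      \<open>v\<close> orthogonal to the old span. Membership in the new span becomes a condition on
      the continuous map sending \<open>z\<close> to \<open>z\<close> minus \<open>k z\<close> times
      \<open>w\<close>.\<close>
    define k where "k z = ip z w / of_real ((norm w)\<^sup>2)" for z
    have eq: "z - k z *\<^sub>K w = (z - k z *\<^sub>K v) + k z *\<^sub>K p" for z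
      by (simp add: w_def scale_right_diff_distrib)
    have "span (insert v F) = {z. z - k z *\<^sub>K w \<in> ?M}"
    proof (intro set_eqI iffI)
      fix z assume "z \<in> span (insert v F)"
      then obtain c where c: "z - c *\<^sub>K v \<in> ?M" unfolding span_breakdown_eq by blast
      have "ip z w = c * of_real ((norm w)\<^sup>2)"
        using orth[OF c] by (simp add: ip_diff_left ip_scale_left ipv del: of_real_power)
      then have "k z = c" using False by (simp add: k_def)
      then show "z \<in> {z. z - k z *\<^sub>K w \<in> ?M}" using c p by (simp add: eq span_add span_scale)
    next
      fix z assume "z \<in> {z. z - k z *\<^sub>K w \<in> ?M}"
      then have "(z - k z *\<^sub>K w) - k z *\<^sub>K p \<in> ?M" using p span_diff span_scale by blast
      then have "z - k z *\<^sub>K v \<in> ?M" by (simp add: eq)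
      then show "z \<in> span (insert v F)" unfolding span_breakdown_eq by blast
    qed
    moreover have "bounded_linear (\<lambda>c. c *\<^sub>K w)"
    proof (rule bounded_linear_intro[where K = "norm w"])
      show "(r *\<^sub>R c) *\<^sub>K w = r *\<^sub>R (c *\<^sub>K w)" for r c
        by (metis scaleR_conv_of_real scale_of_real scale_scale)
    qed (simp_all add: scale_left_distrib norm_scale)
    note ct = bounded_linear.continuous_on[OF this]
    have "continuous_on UNIV (\<lambda>z. z - k z *\<^sub>K w)"
      unfolding k_def using False
      by (intro ct continuous_on_diff continuous_on_divide continuous_on_id continuous_on_const continuous_on_ip) auto
    then have "closed ((\<lambda>z. z - k z *\<^sub>K w) -` ?M)" by (intro closed_vimage insert.IH)
    ultimately show ?thesis by (simp add: vimage_def)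
  qed
qed simp

lemma closed_fin_dim:
  assumes "fin_dim V" "subspace V"
  shows "closed V"
proof -
  obtain B where B: "finite B" "B \<subseteq> V" "V \<subseteq> span B" using fin_dim_basis[OF assms(1)] by metis
  then have "V = span B" using span_minimal[OF B(2) assms(2)] by blast
  then show ?thesis using closed_span_finite[OF B(1)] by simp
qed

lemma dim_orthogonal_sum:
  assumes P: "orthogonal_projection P" and R: "orthogonal_projection R"
    and PR: "\<And>x. P (R x) = 0" and RP: "\<And>x. R (P x) = 0"
    and fP: "fin_dim (range P)" and fR: "fin_dim (range R)"
  shows "dim (range (\<lambda>x. P x + R x)) = dim (range P) + dim (range R)"
proof -
  obtain B where B: "finite B" "B \<subseteq> range P" "independent B" "range P \<subseteq> span B" "card B = dim (range P)"
    using fin_dim_basis[OF fP] .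
  obtain C where C: "finite C" "C \<subseteq> range R" "independent C" "range R \<subseteq> span C" "card C = dim (range R)"
    using fin_dim_basis[OF fR] .
  have PB: "P b = b" if "b \<in> B" for b using that B(2) op_range[OF P] by blast
  have RC: "R c = c" if "c \<in> C" for c using that C(2) op_range[OF R] by blast
  have RB: "R b = 0" if "b \<in> B" for b using PB[OF that] RP by metis
  have PC: "P c = 0" if "c \<in> C" for c using RC[OF that] PR by metis
  have n0: "0 \<notin> B" using B(3) dependent_zero by blast
  have disj: "B \<inter> C = {}" using PB PC n0 by fastforce
  interpret P: module_hom scale scale P
    unfolding module_hom_iff using op_add[OF P] op_scale[OF P] module_axioms by auto
  interpret R: module_hom scale scale R
    unfolding module_hom_iff using op_add[OF R] op_scale[OF R] module_axioms by auto
  have ind: "independent (B \<union> C)"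
  proof
    assume "dependent (B \<union> C)"
    then obtain u where u: "\<exists>v\<in>B \<union> C. u v \<noteq> 0" "(\<Sum>v\<in>B \<union> C. u v *\<^sub>K v) = 0"
      using dependent_finite[of "B \<union> C"] B(1) C(1) by auto
    have s: "(\<Sum>v\<in>B. u v *\<^sub>K v) + (\<Sum>v\<in>C. u v *\<^sub>K v) = 0"
      using u(2) sum.union_disjoint[OF B(1) C(1) disj, of "\<lambda>v. u v *\<^sub>K v"] by simp
    have "P ((\<Sum>v\<in>B. u v *\<^sub>K v) + (\<Sum>v\<in>C. u v *\<^sub>K v)) = (\<Sum>v\<in>B. u v *\<^sub>K v)"
      by (simp add: P.add P.sum P.scale PB PC cong: sum.cong)
    then have "(\<Sum>v\<in>B. u v *\<^sub>K v) = 0" by (simp add: s)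
    then have 1: "\<forall>v\<in>B. u v = 0" using B(3) dependent_finite[OF B(1)] by blast
    have "R ((\<Sum>v\<in>B. u v *\<^sub>K v) + (\<Sum>v\<in>C. u v *\<^sub>K v)) = (\<Sum>v\<in>C. u v *\<^sub>K v)"
      by (simp add: R.add R.sum R.scale RC RB cong: sum.cong)
    then have "(\<Sum>v\<in>C. u v *\<^sub>K v) = 0" by (simp add: s)
    then have "\<forall>v\<in>C. u v = 0" using C(3) dependent_finite[OF C(1)] by blast
    then show False using u(1) 1 by blast
  qed
  have "dim (range (\<lambda>x. P x + R x)) = card (B \<union> C)"
  proof (rule dim_unique[OF _ _ ind])
    show "B \<union> C \<subseteq> range (\<lambda>x. P x + R x)"
    proof
      fix v assume "v \<in> B \<union> C"
      then have "v = P v + R v" using PB RC RB PC by auto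
      then show "v \<in> range (\<lambda>x. P x + R x)" by (rule range_eqI)
    qed
    show "range (\<lambda>x. P x + R x) \<subseteq> span (B \<union> C)"
      using B(4) C(4) span_mono[of B "B \<union> C"] span_mono[of C "B \<union> C"]
      by (auto intro!: span_add)
  qed simp
  then show ?thesis using B(1,5) C(1,5) disj by (simp add: card_Un_disjoint)
qed

section \<open>Shifted operators\<close>

lemma shift_iff: "(x, z) \<in> shift T (of_real c) \<longleftrightarrow> (x, z + c *\<^sub>R x) \<in> T"
proof
  show "(x, z) \<in> shift T (of_real c) \<Longrightarrow> (x, z + c *\<^sub>R x) \<in> T" by (auto simp: shift_def scale_of_real)
  show "(x, z + c *\<^sub>R x) \<in> T \<Longrightarrow> (x, z) \<in> shift T (of_real c)"
    unfolding shift_def by (auto intro!: exI[of _ "z + c *\<^sub>R x"] simp: scale_of_real)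
qed

lemma shiftI: "(x, y) \<in> T \<Longrightarrow> (x, y - c *\<^sub>R x) \<in> shift T (of_real c)"
  by (simp add: shift_iff)

lemma selfadjoint_shift:
  assumes sa: "selfadjoint T"
  shows "selfadjoint (shift T (of_real c))"
  unfolding selfadjoint_def
proof
  show "shift T (of_real c) \<in> closed_operators"
  proof (rule closed_operatorsI)
    show "(x + x', y + y') \<in> shift T (of_real c)"
      if "(x, y) \<in> shift T (of_real c)" "(x', y') \<in> shift T (of_real c)" for x y x' y'
      using sa_add[OF sa, of x "y + c *\<^sub>R x" x' "y' + c *\<^sub>R x'"] that
      unfolding shift_iff by (simp add: algebra_simps)
    show "(k *\<^sub>K x, k *\<^sub>K y) \<in> shift T (of_real c)" if "(x, y) \<in> shift T (of_real c)" for k x y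
      using sa_scale[OF sa, of x "y + c *\<^sub>R x" k] that
      unfolding shift_iff by (simp add: scale_right_distrib scale_scaleR_commute)
    show "(0, 0) \<in> shift T (of_real c)" using sa_zero[OF sa] by (simp add: shift_iff)
    show "y = y'" if "(x, y) \<in> shift T (of_real c)" "(x, y') \<in> shift T (of_real c)" for x y y'
      using sa_unique[OF sa] that unfolding shift_iff by fastforce
    have "shift T (of_real c) = (\<lambda>z. (fst z, snd z + c *\<^sub>R fst z)) -` T"
      by (auto simp: shift_iff)
    moreover have "closed \<dots>" by (intro closed_vimage sa_closed[OF sa] continuous_intros)
    ultimately show "closed (shift T (of_real c))" by simp
    have "Domain (shift T (of_real c)) = Domain T" using shiftI shift_iff by blast
    then show "closure (Domain (shift T (of_real c))) = UNIV" using sa_dense[OF sa] by simp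
  qed
  show "adjoint_op (shift T (of_real c)) = shift T (of_real c)"
  proof (intro set_eqI iffI; clarify)
    fix y z assume a: "(y, z) \<in> adjoint_op (shift T (of_real c))"
    have "(y, z + c *\<^sub>R y) \<in> T"
    proof (rule sa_adj[OF sa])
      fix x w assume "(x, w) \<in> T"
      then have "ip (w - c *\<^sub>R x) y = ip x z" using a shiftI[of x w T c] by (auto simp: adjoint_op_def)
      then show "ip w y = ip x (z + c *\<^sub>R y)"
        by (simp add: ip_diff_left ip_add_right ip_scaleR_left ip_scaleR_right algebra_simps)
    qed
    then show "(y, z) \<in> shift T (of_real c)" by (simp add: shift_iff)
  next
    fix y z assume a: "(y, z) \<in> shift T (of_real c)"
    show "(y, z) \<in> adjoint_op (shift T (of_real c))"
      unfolding adjoint_op_def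
    proof clarify
      fix x w assume "(x, w) \<in> shift T (of_real c)"
      then have "ip (w + c *\<^sub>R x) y = ip x (z + c *\<^sub>R y)"
        using sa_sym[OF sa] a unfolding shift_iff by blast
      then show "ip w y = ip x z"
        by (simp add: ip_add_left ip_add_right ip_scaleR_left ip_scaleR_right)
    qed
  qed
qed

section \<open>Resolvent and Fredholm points in terms of the spectral measure\<close>

context
  fixes T :: "'h operator" and E :: "real set \<Rightarrow> 'h \<Rightarrow> 'h"
  assumes sa: "selfadjoint T" and sm: "spectral_measure_of T E"
begin

lemma null_mono:
  assumes "C \<in> sets borel" "B \<in> sets borel" "B \<subseteq> C" "\<And>x. E C x = 0"
  shows "E B x = 0"
proof -
  have "B \<inter> C = B" using assms(3) by blast
  then show ?thesis using pvm_Int[OF sm_pvm[OF sa sm] assms(2,1), of x] assms(4) op_0[OF sm_op[OF sa sm assms(2)]] by simp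
qed

text \<open>Used to move the end points of an interval within spectral gaps.\<close>

lemma null_eq:
  assumes B: "B \<in> sets borel" and C: "C \<in> sets borel" and N: "N \<in> sets borel" "\<And>x. E N x = 0"
    and eq: "B - N = C - N"
  shows "E B = E C"
proof
  fix x
  have "E B x = E (B - N) x" if B: "B \<in> sets borel" for B
  proof -
    have "E ((B - N) \<union> (B \<inter> N)) x = E (B - N) x + E (B \<inter> N) x"
      using B N(1) by (intro pvm_Un[OF sm_pvm[OF sa sm]]) auto
    moreover have "(B - N) \<union> (B \<inter> N) = B" by blast
    moreover have "E (B \<inter> N) x = 0" by (rule null_mono[OF N(1) _ _ N(2)]) (use B N(1) in auto)
    ultimately show ?thesis by simp
  qed
  from this[OF B] this[OF C] eq show "E B x = E C x" by simp
qed

lemma null_Un: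
  assumes "B \<in> sets borel" "C \<in> sets borel" "\<And>x. E B x = 0" "\<And>x. E C x = 0"
  shows "E (B \<union> C) x = 0"
proof -
  have "E (B \<union> C) = E B" by (rule null_eq[OF _ _ assms(2) assms(4)]) (use assms(1,2) in auto)
  then show ?thesis using assms(3) by simp
qed

lemma fin_dim_range_mono:
  assumes "C \<in> sets borel" "B \<in> sets borel" "B \<subseteq> C" "fin_dim (range (E C))"
  shows "fin_dim (range (E B))"
proof (rule fin_dim_mono[OF _ assms(4)])
  have "C \<inter> B = B" using assms(3) by blast
  then have "E B x = E C (E B x)" for x using pvm_Int[OF sm_pvm[OF sa sm] assms(1,2), of x] by simp
  then show "range (E B) \<subseteq> range (E C)" by (metis image_subsetI rangeI)
qed

lemma fin_dim_range_Un:
  assumes B: "B \<in> sets borel" and C: "C \<in> sets borel"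
    and f: "fin_dim (range (E B))" "fin_dim (range (E C))"
  shows "fin_dim (range (E (B \<union> C)))"
proof -
  obtain F where F: "finite F" "range (E B) \<subseteq> span F" using f(1) by (auto simp: fin_dim_def)
  obtain G where G: "finite G" "range (E C) \<subseteq> span G" using f(2) by (auto simp: fin_dim_def)
  have "E (B \<union> C) x \<in> span (F \<union> G)" for x
  proof -
    have "E (B \<union> C) x = E B x + E (C - B) x"
      using pvm_Un[OF sm_pvm[OF sa sm] B, of "C - B" x] B C by (auto simp: Un_Diff_cancel)
    moreover have "C \<inter> (C - B) = C - B" by blast
    then have "E (C - B) x = E C (E (C - B) x)" using pvm_Int[OF sm_pvm[OF sa sm] C, of "C - B" x] B C by simp
    ultimately show ?thesis
      using F(2) G(2) span_mono[of F "F \<union> G"] span_mono[of G "F \<union> G"]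
      by (metis Un_upper1 Un_upper2 rangeI span_add subsetD)
  qed
  then show ?thesis using F(1) G(1) unfolding fin_dim_def by blast
qed

text \<open>On the spectral subspace of the interval, \<open>T - c\<close> is bounded by \<kappa>,
  while a bound \<open>K\<close> for the resolvent makes it at least \<open>1 / K\<close>. With
  \<kappa> half of that, the subspace is trivial.\<close>

lemma resolvent_null:
  assumes "of_real c \<notin> spectrum T"
  obtains \<kappa> where "\<kappa> > 0" "\<And>x. E {c - \<kappa><..<c + \<kappa>} x = 0"
proof -
  obtain R where R: "bounded_linear R" "(shift T (of_real c))\<inverse> = {(y, R y) | y. True}"
    using assms by (auto simp: spectrum_def resolvent_set_def)
  obtain K where K: "K > 0" "\<And>x. norm (R x) \<le> norm x * K" using bounded_linear.pos_bounded[OF R(1)] by blast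
  have low: "norm x \<le> norm (y - c *\<^sub>R x) * K" if "(x, y) \<in> T" for x y
  proof -
    have "(y - c *\<^sub>R x, x) \<in> (shift T (of_real c))\<inverse>" using shiftI[OF that] by simp
    then have "x = R (y - c *\<^sub>R x)" unfolding R(2) by auto
    then show ?thesis using K(2) by metis
  qed
  define \<kappa> where "\<kappa> = 1 / (2 * K)"
  have k: "\<kappa> > 0" using K by (simp add: \<kappa>_def)
  have "E {c - \<kappa><..<c + \<kappa>} x = 0" for x
  proof -
    let ?B = "{c - \<kappa><..<c + \<kappa>}"
    let ?x = "E ?B x"
    have B: "?B \<in> sets borel" by simp
    have "?x \<in> Domain T" by (rule sm_bounded_dom[OF sa sm B, of "\<bar>c\<bar> + \<kappa>"]) auto
    then obtain y where y: "(?x, y) \<in> T" by blast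
    have "norm (y - c *\<^sub>R ?x) \<le> \<kappa> * norm ?x"
      by (rule sm_upper[OF sa sm B _ y]) (auto simp: op_idem[OF sm_op[OF sa sm B]])
    then have "norm (y - c *\<^sub>R ?x) * K \<le> \<kappa> * norm ?x * K" using K(1) by (intro mult_right_mono) auto
    also have "\<dots> = norm ?x / 2" using K(1) by (simp add: \<kappa>_def)
    finally have "norm ?x \<le> norm ?x / 2" using low[OF y] by linarith
    then show ?thesis by simp
  qed
  then show ?thesis using that k by blast
qed

lemma reduces_shift:
  assumes B: "B \<in> sets borel"
  shows "reduces (shift T (of_real c)) (E B)"
  unfolding reduces_def[OF selfadjoint_shift[OF sa]]
proof (intro conjI allI impI sm_op[OF sa sm B])
  fix x z assume "(x, z) \<in> shift T (of_real c)"
  then have "(E B x, E B (z + c *\<^sub>R x)) \<in> T" unfolding shift_iff by (rule sm_reduces[OF sa sm B])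
  then show "(E B x, E B z) \<in> shift T (of_real c)"
    by (simp add: shift_iff op_add[OF sm_op[OF sa sm B]] op_scaleR[OF sm_op[OF sa sm B]])
qed

lemma shift_lower:
  assumes B: "B \<in> sets borel" "B \<inter> {c - \<kappa><..<c + \<kappa>} = {}" and xz: "(x, z) \<in> shift T (of_real c)" and "E B x = x"
  shows "\<kappa> * norm x \<le> norm z"
  using sm_lower[OF sa sm B, of x "z + c *\<^sub>R x"] assms by (simp add: shift_iff)

lemma shift_surj:
  assumes B: "B \<in> sets borel" "B \<inter> {c - \<kappa><..<c + \<kappa>} = {}" and k: "\<kappa> > 0" and "E B z = z"
  shows "\<exists>x. (x, z) \<in> shift T (of_real c) \<and> E B x = x"
  using assms(4)
  by (intro surj_of_bounded_below[OF selfadjoint_shift[OF sa] reduces_shift[OF B(1)] k])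
     (auto intro: shift_lower[OF B])

lemma null_resolvent:
  assumes k: "\<kappa> > 0" and null: "\<And>x. E {c - \<kappa><..<c + \<kappa>} x = 0"
  shows "of_real c \<notin> spectrum T"
proof -
  let ?S = "shift T (of_real c)"
  let ?B = "- {c - \<kappa><..<c + \<kappa>}"
  have B: "?B \<in> sets borel" "?B \<inter> {c - \<kappa><..<c + \<kappa>} = {}" by (auto simp: borel_comp)
  have EB: "E ?B x = x" for x using pvm_Compl[OF sm_pvm[OF sa sm], of "{c - \<kappa><..<c + \<kappa>}" x] null by simp
  note saS = selfadjoint_shift[OF sa, of c]
  have low: "(x, z) \<in> ?S \<Longrightarrow> \<kappa> * norm x \<le> norm z" for x z using shift_lower[OF B _ EB] .
  have surj: "\<exists>x. (x, z) \<in> ?S" for z using shift_surj[OF B k EB] by blast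
  then obtain R where R: "\<And>z. (R z, z) \<in> ?S" by metis
  have uniq: "x = R z" if "(x, z) \<in> ?S" for x z
  proof -
    have "(x - R z, 0) \<in> ?S" using sa_diff[OF saS that R[of z]] by simp
    from low[OF this] k show ?thesis by (simp add: mult_le_0_iff)
  qed
  have "bounded_linear R"
  proof (rule bounded_linear_intro[where K = "1 / \<kappa>"])
    show "R (x + y) = R x + R y" for x y using uniq[OF sa_add[OF saS R R]] by simp
    show "R (r *\<^sub>R x) = r *\<^sub>R R x" for r x using uniq[OF sa_scaleR[OF saS R]] by simp
    show "norm (R x) \<le> norm x * (1 / \<kappa>)" for x using low[OF R[of x]] k by (simp add: field_simps)
  qed
  moreover have "?S\<inverse> = {(y, R y) | y. True}"
  proof (intro set_eqI iffI)
    fix p assume "p \<in> ?S\<inverse>"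
    then show "p \<in> {(y, R y) | y. True}" using uniq by (cases p) auto
  next
    fix p assume "p \<in> {(y, R y) | y. True}"
    then show "p \<in> ?S\<inverse>" using R by auto
  qed
  ultimately show ?thesis by (auto simp: spectrum_def resolvent_set_def)
qed

text \<open>Off \<open>B\<close> the shifted operator is boundedly invertible, so kernel and
  cokernel are confined to the finite-dimensional range of \<open>E B\<close>.\<close>

lemma fredholm_shift:
  assumes B: "B \<in> sets borel" and f: "fin_dim (range (E B))" and k: "\<kappa> > 0" and BI: "{c - \<kappa><..<c + \<kappa>} \<subseteq> B"
  shows "fredholm (shift T (of_real c))"
proof -
  let ?S = "shift T (of_real c)"
  note saS = selfadjoint_shift[OF sa, of c]
  have nB: "- B \<in> sets borel" "- B \<inter> {c - \<kappa><..<c + \<kappa>} = {}" using B BI by (auto simp: borel_comp)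
  obtain F where F: "finite F" "range (E B) \<subseteq> span F" using f by (auto simp: fin_dim_def)
  have EnB: "E (- B) x = x - E B x" for x by (rule pvm_Compl[OF sm_pvm[OF sa sm] B])
  have red: "(x, y) \<in> ?S \<Longrightarrow> (E C x, E C y) \<in> ?S" if "C \<in> sets borel" for x y C
    using reduces_shift[OF that, of c] by (simp add: reduces_def[OF saS])
  have idem: "E (- B) (E (- B) x) = E (- B) x" for x by (rule op_idem[OF sm_op[OF sa sm nB(1)]])
  have co: "E (- B) z \<in> Range ?S" for z using shift_surj[OF nB k idem] by blast
  have ker: "{x. (x, 0) \<in> ?S} \<subseteq> span F"
  proof
    fix x assume "x \<in> {x. (x, 0) \<in> ?S}"
    then have "(E (- B) x, 0) \<in> ?S" using red[OF nB(1), of x 0] op_0[OF sm_op[OF sa sm nB(1)]] by simp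
    from shift_lower[OF nB this idem] k have "E (- B) x = 0" by (simp add: mult_le_0_iff)
    then have "x = E B x" by (simp add: EnB)
    then show "x \<in> span F" using F(2) by (metis rangeI subsetD)
  qed
  have subR: "subspace (Range ?S)"
  proof (rule subspaceI)
    show "0 \<in> Range ?S" using sa_zero[OF saS] by blast
    show "x + y \<in> Range ?S" if "x \<in> Range ?S" "y \<in> Range ?S" for x y using that sa_add[OF saS] by blast
    show "a *\<^sub>K x \<in> Range ?S" if "x \<in> Range ?S" for a x using that sa_scale[OF saS] by blast
  qed
  \<comment> \<open>The range contains everything in the range of \<open>E (- B)\<close>, so only
    the \<open>E B\<close> part of \<open>z\<close> matters. It is thus the preimage of a
    finite-dimensional, hence closed, subspace.\<close>
  have "Range ?S = E B -` (Range ?S \<inter> range (E B))"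
  proof (intro set_eqI iffI)
    fix z assume "z \<in> Range ?S"
    then show "z \<in> E B -` (Range ?S \<inter> range (E B))" using red[OF B] by auto
  next
    fix z assume "z \<in> E B -` (Range ?S \<inter> range (E B))"
    then have "E B z + E (- B) z \<in> Range ?S" using co subspace_add[OF subR] by blast
    then show "z \<in> Range ?S" by (simp add: EnB)
  qed
  moreover have "closed (Range ?S \<inter> range (E B))"
    by (intro closed_fin_dim fin_dim_mono[OF _ f] subspace_inter subR op_range_subspace sm_op[OF sa sm B]) blast
  ultimately have "closed (Range ?S)"
    by (metis closed_vimage linear_continuous_on op_bounded_linear[OF sm_op[OF sa sm B]])
  moreover have "span (Range ?S \<union> F) = UNIV"
  proof -
    have "z \<in> span (Range ?S \<union> F)" for z
    proof -
      have "E B z + E (- B) z \<in> span (Range ?S \<union> F)"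
        using co[of z] F(2) span_mono[of F "Range ?S \<union> F"] by (intro span_add) (auto intro: span_base)
      then show ?thesis by (simp add: EnB)
    qed
    then show ?thesis by blast
  qed
  ultimately show ?thesis
    unfolding fredholm_def using sa_closed_op[OF saS] F(1) ker by blast
qed

text \<open>Off its kernel the shifted operator is at least \<open>k\<close>, on a narrow spectral
  subspace at most \<open>k / 2\<close>. So the projection onto the kernel is injective on that
  subspace, and the kernel is finite-dimensional.\<close>

lemma fredholm_shift_fin_dim:
  assumes fr: "fredholm (shift T (of_real c))"
  obtains \<kappa> where "\<kappa> > 0" "fin_dim (range (E {c - \<kappa><..<c + \<kappa>}))"
proof -
  let ?S = "shift T (of_real c)"
  note saS = selfadjoint_shift[OF sa, of c]
  have cr: "closed (Range ?S)" using fr by (simp add: fredholm_def)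
  obtain k where k: "k > 0" "\<And>x y. (x, y) \<in> ?S \<Longrightarrow> Pk ?S x = 0 \<Longrightarrow> k * norm x \<le> norm y"
    using bounded_below_off_kern[OF saS cr] by blast
  define \<kappa> where "\<kappa> = k / 2"
  let ?B = "{c - \<kappa><..<c + \<kappa>}"
  have B: "?B \<in> sets borel" by simp
  note op = sm_op[OF sa sm B]
  have "fin_dim (range (E ?B))"
  proof (rule fin_dim_inj(1))
    note oP = Pk_op[OF saS]
    show "Pk ?S (x + y) = Pk ?S x + Pk ?S y" "Pk ?S (a *\<^sub>K x) = a *\<^sub>K Pk ?S x" for x y a
      by (simp_all add: op_add[OF oP] op_scale[OF oP])
    show "subspace (range (E ?B))" by (rule op_range_subspace[OF op])
    show "Pk ?S ` range (E ?B) \<subseteq> kern ?S" using proj_in[OF kern_subspace[OF saS] kern_closed[OF saS]] by blast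
    show "fin_dim (kern ?S)" using fr by (simp add: fredholm_def fin_dim_def kern_def[OF saS])
    fix x assume "x \<in> range (E ?B)" and P: "Pk ?S x = 0"
    then have x: "E ?B x = x" by (simp add: op_range[OF op])
    have "E ?B x \<in> Domain T" by (rule sm_bounded_dom[OF sa sm B, of "\<bar>c\<bar> + \<kappa>"]) auto
    then obtain y where y: "(x, y) \<in> T" using x by auto
    have "norm (y - c *\<^sub>R x) \<le> \<kappa> * norm x" by (rule sm_upper[OF sa sm B _ y x]) auto
    moreover have "k * norm x \<le> norm (y - c *\<^sub>R x)" by (rule k(2)[OF shiftI[OF y] P])
    ultimately have "k * norm x \<le> k / 2 * norm x" by (simp add: \<kappa>_def)
    then show "x = 0" using k(1) by (simp add: mult_le_cancel_right)
  qed
  then show ?thesis using that[of \<kappa>] k(1) by (simp add: \<kappa>_def)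
qed

text \<open>Compactness: finitely many of the open intervals with finite-dimensional spectral
  subspaces cover the given one.\<close>

lemma fin_dim_of_ess:
  assumes "of_real ` {\<alpha>..\<beta>} \<inter> ess_spectrum T = {}"
  shows "fin_dim (range (E {\<alpha>..\<beta>}))"
proof -
  have "\<exists>\<kappa>>0. fin_dim (range (E {c - \<kappa><..<c + \<kappa>}))" if "c \<in> {\<alpha>..\<beta>}" for c
  proof -
    have "(of_real c :: 'k) \<in> of_real ` {\<alpha>..\<beta>}" using that by blast
    then have "fredholm (shift T (of_real c))" using assms by (auto simp: ess_spectrum_def)
    then show ?thesis using fredholm_shift_fin_dim by metis
  qed
  then obtain \<kappa> where \<kappa>: "\<And>c. c \<in> {\<alpha>..\<beta>} \<Longrightarrow> \<kappa> c > 0 \<and> fin_dim (range (E {c - \<kappa> c<..<c + \<kappa> c}))" by metis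
  let ?U = "\<lambda>c. {c - \<kappa> c<..<c + \<kappa> c}"
  have "{\<alpha>..\<beta>} \<subseteq> (\<Union>c\<in>{\<alpha>..\<beta>}. ?U c)"
  proof
    fix c assume "c \<in> {\<alpha>..\<beta>}"
    then show "c \<in> (\<Union>c\<in>{\<alpha>..\<beta>}. ?U c)" using \<kappa>[of c] by (intro UN_I[of c]) auto
  qed
  then obtain D where D: "D \<subseteq> {\<alpha>..\<beta>}" "finite D" "{\<alpha>..\<beta>} \<subseteq> (\<Union>c\<in>D. ?U c)"
    using compactE_image[OF compact_Icc, of "{\<alpha>..\<beta>}" ?U \<alpha> \<beta>] by auto
  have "fin_dim (range (E (\<Union>c\<in>D. ?U c)))" using D(2,1)
  proof (induction D rule: finite_induct)
    case empty
    have "range (E {}) \<subseteq> span {}" using pvm_empty[OF sm_pvm[OF sa sm]] by auto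
    then show ?case unfolding fin_dim_def UN_empty by (intro exI[of _ "{}"]) simp
  next
    case (insert c D)
    have "(\<Union>c\<in>D. ?U c) \<in> sets borel" by (intro borel_open open_UN) auto
    then have "fin_dim (range (E (?U c \<union> (\<Union>c\<in>D. ?U c))))"
      using insert \<kappa>[of c] by (intro fin_dim_range_Un) auto
    then show ?case by simp
  qed
  moreover have "(\<Union>c\<in>D. ?U c) \<in> sets borel" by (intro borel_open open_UN) auto
  ultimately show ?thesis using fin_dim_range_mono[OF _ _ D(3)] by simp
qed

end

text \<open>The conditions of \<open>sf_partition\<close> at a single parameter. Norm continuity of
  the projections is left out, as it follows from gap continuity
  (\<open>sf_partition_iff\<close>).\<close>

definition good :: "'h operator \<Rightarrow> real \<Rightarrow> bool" where
  "good T a \<longleftrightarrow> a > 0 \<and> of_real a \<notin> spectrum T \<and> of_real (- a) \<notin> spectrum T \<and>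
    of_real ` {- a..a} \<inter> ess_spectrum T = {}"

lemma goodI:
  assumes sa: "selfadjoint T" and sm: "spectral_measure_of T E" and a: "a > 0" and k: "\<kappa> > 0"
    and n1: "\<And>x. E {a - \<kappa><..<a + \<kappa>} x = 0" and n2: "\<And>x. E {- a - \<kappa><..<- a + \<kappa>} x = 0"
    and f: "fin_dim (range (E {- a..a}))"
  shows "good T a"
  unfolding good_def
proof (intro conjI a)
  show "of_real a \<notin> spectrum T" by (rule null_resolvent[OF sa sm k n1])
  show "of_real (- a) \<notin> spectrum T" by (rule null_resolvent[OF sa sm k n2])
  \<comment> \<open>Enlarging the interval by \<kappa> adds only null sets, and then each point of
    \<open>{- a..a}\<close> has a whole \<kappa>-neighbourhood inside a set of finite rank.\<close>
  let ?N = "{a - \<kappa><..<a + \<kappa>} \<union> {- a - \<kappa><..<- a + \<kappa>}"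
  let ?B = "{- a - \<kappa><..<a + \<kappa>}"
  have "E ?B = E {- a..a}"
  proof (rule null_eq[OF sa sm, of _ _ ?N])
    show "E ?N x = 0" for x by (rule null_Un[OF sa sm _ _ n1 n2]) auto
    show "?B - ?N = {- a..a} - ?N" using a k by auto
  qed auto
  then have fB: "fin_dim (range (E ?B))" using f by simp
  have "fredholm (shift T (of_real c))" if "c \<in> {- a..a}" for c
    by (rule fredholm_shift[OF sa sm _ fB k]) (use that in auto)
  then show "of_real ` {- a..a} \<inter> ess_spectrum T = {}" by (auto simp: ess_spectrum_def)
qed

lemma good_exists:
  assumes sa: "selfadjoint T" and sm: "spectral_measure_of T E" and fr: "fredholm T"
  shows "\<exists>a. good T a"
proof -
  have cr: "closed (Range T)" using fr by (simp add: fredholm_def)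
  obtain k where k: "k > 0" "\<And>x y. (x, y) \<in> T \<Longrightarrow> Pk T x = 0 \<Longrightarrow> k * norm x \<le> norm y"
    using bounded_below_off_kern[OF sa cr] by blast
  note E = sm_pvm[OF sa sm]
  define \<kappa> where "\<kappa> = k / 2"
  let ?B = "{- \<kappa>..\<kappa>} - {0}"
  have B: "?B \<in> sets borel" and Z: "{0 :: real} \<in> sets borel" and nZ: "- {0 :: real} \<in> sets borel"
    by (auto simp: borel_comp)
  \<comment> \<open>Kernel vectors have no spectral mass off 0, seen by exhausting the complement of
    0. Hence the range of \<open>E ?B\<close> is orthogonal to the kernel and the lower bound
    \<open>k\<close> applies there, against the upper bound \<open>k / 2\<close>.\<close>
  have kB: "E ?B v = 0" if v: "v \<in> kern T" for v
  proof -
    let ?A = "\<lambda>n. - {- (1 / real (Suc n))<..<1 / real (Suc n)}"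
    have A: "?A n \<in> sets borel" for n by (auto simp: borel_comp)
    have "E (?A n) v = 0" for n
    proof -
      have "(E (?A n) v, E (?A n) 0) \<in> T" using sm_reduces[OF sa sm A] v by (simp add: kern_def[OF sa])
      then have "(E (?A n) v, 0) \<in> T" unfolding op_0[OF sm_op[OF sa sm A]] .
      from sm_lower[OF sa sm A _ this op_idem[OF sm_op[OF sa sm A]], of 0 "1 / real (Suc n)"]
      have "norm (E (?A n) v) \<le> 0" by (simp add: divide_le_0_iff del: of_nat_Suc)
      then show ?thesis by simp
    qed
    moreover have "(\<Union>n. ?A n) = - {0}"
    proof (intro equalityI subsetI)
      fix t :: real assume "t \<in> - {0}"
      then obtain n where "1 / real (Suc n) < \<bar>t\<bar>" using nat_approx_posE[of "\<bar>t\<bar>"] by auto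
      then show "t \<in> (\<Union>n. ?A n)" by (intro UN_I[of n]) auto
    next
      fix t :: real assume "t \<in> (\<Union>n. ?A n)"
      then show "t \<in> - {0}" by auto
    qed
    moreover have "(\<lambda>n. E (?A n) v) \<longlonglongrightarrow> E (\<Union>n. ?A n) v"
    proof (rule pvm_incseq[OF E])
      have "?A m \<subseteq> ?A n" if "m \<le> n" for m n
      proof -
        have "1 / real (Suc n) \<le> 1 / real (Suc m)" using that by (simp add: frac_le)
        then show ?thesis unfolding subset_iff Compl_iff greaterThanLessThan_iff by (auto simp del: of_nat_Suc)
      qed
      then show "incseq ?A" unfolding incseq_def by blast
    qed (use A in blast)
    ultimately have "E (- {0}) v = 0" by (simp add: LIMSEQ_const_iff)
    moreover have "?B \<inter> - {0} = ?B" by blast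
    ultimately show ?thesis using pvm_Int[OF E B nZ, of v] op_0[OF sm_op[OF sa sm B]] by simp
  qed
  have nB: "E ?B z = 0" for z
  proof -
    define x where "x = E ?B z"
    have x: "E ?B x = x" by (simp add: x_def op_idem[OF sm_op[OF sa sm B]])
    have "x \<in> Domain T" unfolding x_def by (rule sm_bounded_dom[OF sa sm B, of \<kappa>]) auto
    then obtain y where y: "(x, y) \<in> T" by blast
    have "Pk T x = 0"
    proof (rule proj_eqI[OF kern_subspace[OF sa]])
      show "0 \<in> kern T" by (rule subspace_0[OF kern_subspace[OF sa]])
      fix v assume "v \<in> kern T"
      then have "ip (E ?B x) v = 0" by (simp add: op_sym[OF sm_op[OF sa sm B]] kB)
      then show "ip (x - 0) v = 0" by (simp add: x)
    qed
    then have "k * norm x \<le> norm y" by (rule k(2)[OF y])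
    moreover have "norm (y - 0 *\<^sub>R x) \<le> \<kappa> * norm x" by (rule sm_upper[OF sa sm B _ y x]) auto
    ultimately have "k * norm x \<le> k / 2 * norm x" by (simp add: \<kappa>_def)
    then have "x = 0" using k(1) by (simp add: mult_le_cancel_right)
    then show ?thesis by (simp add: x_def)
  qed
  \<comment> \<open>The intervals of radius \<open>a / 2\<close> around \<open>a\<close> and
    \<open>- a\<close> lie in \<open>?B\<close>, because \<kappa> is \<open>2 * a\<close>.\<close>
  define a where "a = \<kappa> / 2"
  have ka: "\<kappa> > 0" "a > 0" "\<kappa> = 2 * a" using k(1) by (auto simp: \<kappa>_def a_def)
  have "good T a"
  proof (rule goodI[OF sa sm ka(2), of "a / 2"])
    show "E {a - a / 2<..<a + a / 2} x = 0" for x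
      by (rule null_mono[OF sa sm B _ _ nB]) (use ka in auto)
    show "E {- a - a / 2<..<- a + a / 2} x = 0" for x
      by (rule null_mono[OF sa sm B _ _ nB]) (use ka in auto)
    have "E {- a..a} = E {0}" by (rule null_eq[OF sa sm _ _ B nB]) (use ka in auto)
    moreover have "range (E {0}) \<subseteq> kern T"
    proof
      fix x assume "x \<in> range (E {0})"
      then have x: "E {0} x = x" by (simp add: op_range[OF sm_op[OF sa sm Z]])
      have "E {0} x \<in> Domain T" by (rule sm_bounded_dom[OF sa sm Z, of 0]) auto
      then obtain y where y: "(x, y) \<in> T" using x by auto
      have "norm (y - 0 *\<^sub>R x) \<le> 0 * norm x" by (rule sm_upper[OF sa sm Z _ y x]) auto
      then show "x \<in> kern T" using y by (simp add: kern_def[OF sa])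
    qed
    moreover have "fin_dim (kern T)" using fr by (simp add: fredholm_def fin_dim_def kern_def[OF sa])
    ultimately show "fin_dim (range (E {- a..a}))" using fin_dim_mono by simp
  qed (use ka in simp)
  then show ?thesis by blast
qed

text \<open>For \<open>T0\<close> the interval may be shrunk or enlarged by \<rho> without changing
  its projection, so \<open>spectral_subspaces_close\<close> applies in both directions. The
  constant depends on \<open>T0\<close> and the interval only.\<close>

lemma spectral_proj_lipschitz_at:
  assumes T0: "selfadjoint T0" "spectral_measure_of T0 E0" and ab: "\<alpha> < \<beta>" and k: "\<kappa> > 0"
    and n1: "\<And>x. E0 {\<alpha> - \<kappa><..<\<alpha> + \<kappa>} x = 0" and n2: "\<And>x. E0 {\<beta> - \<kappa><..<\<beta> + \<kappa>} x = 0"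
  obtains C where "C \<ge> 0" "\<And>T E x. selfadjoint T \<Longrightarrow> spectral_measure_of T E \<Longrightarrow>
    norm (E {\<alpha>..\<beta>} x - E0 {\<alpha>..\<beta>} x) \<le> C * gap_dist T T0 * norm x"
proof -
  define m where "m = (\<alpha> + \<beta>) / 2"
  define r where "r = (\<beta> - \<alpha>) / 2"
  \<comment> \<open>Below \<kappa>, to move end points inside the gaps only; below \<open>r\<close>,
    to keep the smaller radius positive.\<close>
  define \<rho> where "\<rho> = min (\<kappa> / 2) (r / 2)"
  have r: "r > 0" using ab by (simp add: r_def)
  have rho: "\<rho> > 0" "\<rho> < \<kappa>" "\<rho> < r" using r k by (auto simp: \<rho>_def)
  have al: "\<alpha> = m - r" "\<beta> = m + r" by (auto simp: m_def r_def field_simps)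
  let ?I = "{\<alpha>..\<beta>}" and ?J = "{\<alpha><..<\<beta>}"
  let ?N = "{\<alpha> - \<kappa><..<\<alpha> + \<kappa>} \<union> {\<beta> - \<kappa><..<\<beta> + \<kappa>}"
  have I: "?I \<in> sets borel" and J: "?J \<in> sets borel" by auto
  have N: "E0 ?N x = 0" for x by (rule null_Un[OF T0 _ _ n1 n2]) auto
  have in0: "E0 ?I = E0 {m - (r - \<rho>)..m + (r - \<rho>)}"
  proof (rule null_eq[OF T0 _ _ _ N])
    show "?I - ?N = {m - (r - \<rho>)..m + (r - \<rho>)} - ?N"
      unfolding al using rho r by auto
  qed auto
  have out0: "E0 ?I = E0 {m - (r + \<rho>)<..<m + (r + \<rho>)}"
  proof (rule null_eq[OF T0 _ _ _ N])
    show "?I - ?N = {m - (r + \<rho>)<..<m + (r + \<rho>)} - ?N"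
      unfolding al using rho r by auto
  qed auto
  define C1 where "C1 = (1 + \<bar>m\<bar> + r) * (1 + \<bar>m\<bar> + (r - \<rho>)) / (r - (r - \<rho>))"
  define C2 where "C2 = (1 + \<bar>m\<bar> + (r + \<rho>)) * (1 + \<bar>m\<bar> + r) / ((r + \<rho>) - r)"
  have C: "C1 \<ge> 0" "C2 \<ge> 0" using rho r by (auto simp: C1_def C2_def intro!: divide_nonneg_pos mult_nonneg_nonneg)
  note op0 = sm_op[OF T0 I]
  have "norm (E ?I x - E0 ?I x) \<le> (C1 + C2) * gap_dist T T0 * norm x"
    if T: "selfadjoint T" "spectral_measure_of T E" for T E x
  proof -
    let ?d = "gap_dist T T0"
    note op = sm_op[OF T I]
    have d0: "?d \<ge> 0" using gap_dist_nonneg sa_closed_op T(1) T0(1) by blast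
    have 1: "norm (E0 ?I y - E ?I (E0 ?I y)) \<le> C1 * ?d * norm y" for y
    proof -
      let ?u = "E0 ?I y"
      have close: "norm (?u - E ?J ?u) \<le> C1 * ?d * norm y"
        using spectral_subspaces_close[OF T0 T, of "r - \<rho>" r m y] rho r
        unfolding C1_def in0[symmetric] al[symmetric] gap_dist_commute[of T0 T] by simp
      have "?I \<inter> ?J = ?J" by auto
      then have "E ?I (E ?J ?u) = E ?J ?u" using pvm_Int[OF sm_pvm[OF T] I J, of ?u] by simp
      then have "?u - E ?I ?u = (?u - E ?J ?u) - E ?I (?u - E ?J ?u)" by (simp add: op_diff[OF op])
      then have "norm (?u - E ?I ?u) \<le> norm (?u - E ?J ?u)" using op_co_norm_le[OF op] by metis
      then show ?thesis using close by linarith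
    qed
    have 2: "norm (E ?I y - E0 ?I (E ?I y)) \<le> C2 * ?d * norm y" for y
      using spectral_subspaces_close[OF T T0, of r "r + \<rho>" m y] rho r
      unfolding C2_def out0[symmetric] al[symmetric] by simp
    \<comment> \<open>The adjoint of estimate \<open>2\<close>: a bound for
      \<open>(1 - P0) P\<close> is one for \<open>P (1 - P0)\<close>.\<close>
    have 3: "norm (E ?I (x - E0 ?I x)) \<le> C2 * ?d * norm x"
    proof -
      define u where "u = E ?I (x - E0 ?I x)"
      have Eu: "E ?I u = u" by (simp add: u_def op_idem[OF op])
      have "(norm u)\<^sup>2 = rip u (E ?I (x - E0 ?I x))" by (simp add: rip_self[symmetric] u_def)
      also have "\<dots> = rip u (x - E0 ?I x)" using op_rsym[OF op, of u "x - E0 ?I x"] Eu by simp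
      also have "\<dots> = rip (u - E0 ?I u) x"
        using op_rsym[OF op0, of u x] by (simp add: rip_diff_left rip_diff_right)
      also have "\<dots> \<le> norm (u - E0 ?I u) * norm x" using rip_le[of "u - E0 ?I u" x] by linarith
      also have "\<dots> \<le> (C2 * ?d * norm u) * norm x"
        using 2[of u] Eu by (intro mult_right_mono) auto
      finally have *: "norm u * norm u \<le> norm u * (C2 * ?d * norm x)" by (simp add: power2_eq_square mult_ac)
      show ?thesis
      proof (cases "norm u = 0")
        case True
        then show ?thesis using C d0 by (simp add: u_def)
      next
        case False
        then have "norm u \<le> C2 * ?d * norm x" using * by (simp add: mult_le_cancel_left)
        then show ?thesis by (simp add: u_def)
      qed
    qed
    \<comment> \<open>In short, \<open>P - P0 = P (1 - P0) - (1 - P) P0\<close>.\<close>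
    have "E ?I x - E0 ?I x = E ?I (x - E0 ?I x) - (E0 ?I x - E ?I (E0 ?I x))"
      by (simp add: op_diff[OF op])
    then have "norm (E ?I x - E0 ?I x) \<le> norm (E ?I (x - E0 ?I x)) + norm (E0 ?I x - E ?I (E0 ?I x))"
      using norm_triangle_ineq4 by metis
    also have "\<dots> \<le> (C1 + C2) * ?d * norm x" using 1[of x] 3 by (simp add: algebra_simps)
    finally show ?thesis .
  qed
  then show ?thesis using that[of "C1 + C2"] C by simp
qed

end


section \<open>Local behaviour of the rank of spectral projections\<close>

lemma mult_less_one_of_less:
  fixes C d :: real
  assumes "C \<ge> 0" "d < 1 / (C + 1)"
  shows "C * d < 1"
proof -
  have "C * d \<le> C * (1 / (C + 1))" using assms by (intro mult_left_mono) auto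
  also have "\<dots> < 1" using assms(1) by simp
  finally show ?thesis .
qed

lemma contraction_zero:
  fixes u :: "'a::real_normed_vector"
  assumes "norm u \<le> \<eta> * norm u" "\<eta> < 1"
  shows "u = 0"
proof -
  have "(1 - \<eta>) * norm u \<le> 0" using assms(1) by (simp add: algebra_simps)
  then show ?thesis using assms(2) by (simp add: mult_le_0_iff)
qed

context hilbert_space
begin

lemma CFsaE:
  assumes "T \<in> CFsa"
  obtains E where "selfadjoint T" "spectral_measure_of T E" "fredholm T"
proof -
  have "selfadjoint T" "fredholm T" using assms by (auto simp: CFsa_def)
  then show ?thesis using that spectral_measure_exists[of T] by (auto simp: fredholm_def)
qed

lemma CFsa_good: "T \<in> CFsa \<Longrightarrow> \<exists>a. good T a"
  by (metis CFsaE good_exists)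

lemma spectral_proj_lipschitz:
  assumes T0: "selfadjoint T0" "spectral_measure_of T0 E0" and ab: "\<alpha> < \<beta>"
    and "of_real \<alpha> \<notin> spectrum T0" "of_real \<beta> \<notin> spectrum T0"
  obtains C where "C \<ge> 0" "\<And>T E x. selfadjoint T \<Longrightarrow> spectral_measure_of T E \<Longrightarrow>
    norm (E {\<alpha>..\<beta>} x - E0 {\<alpha>..\<beta>} x) \<le> C * gap_dist T T0 * norm x"
proof -
  obtain k1 where k1: "k1 > 0" "\<And>x. E0 {\<alpha> - k1<..<\<alpha> + k1} x = 0"
    using resolvent_null[OF T0 assms(4)] by blast
  obtain k2 where k2: "k2 > 0" "\<And>x. E0 {\<beta> - k2<..<\<beta> + k2} x = 0"
    using resolvent_null[OF T0 assms(5)] by blast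
  let ?k = "min k1 k2"
  have "E0 {\<alpha> - ?k<..<\<alpha> + ?k} x = 0" for x by (rule null_mono[OF T0 _ _ _ k1(2)]) auto
  moreover have "E0 {\<beta> - ?k<..<\<beta> + ?k} x = 0" for x by (rule null_mono[OF T0 _ _ _ k2(2)]) auto
  ultimately show ?thesis
    using spectral_proj_lipschitz_at[OF T0 ab, of ?k] k1(1) k2(1) that by (metis min_less_iff_conj)
qed

text \<open>On \<open>[c - \<kappa>, c + \<kappa>]\<close> the projection of \<open>T0\<close> is
  zero, so that of a nearby \<open>T\<close> has norm below 1, which forces a projection to
  vanish.\<close>

lemma null_open:
  assumes T0: "selfadjoint T0" "spectral_measure_of T0 E0" and c: "of_real c \<notin> spectrum T0"
  obtains \<delta> \<kappa> where "\<delta> > 0" "\<kappa> > 0" "\<And>T E x. selfadjoint T \<Longrightarrow> spectral_measure_of T E \<Longrightarrow>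
    gap_dist T T0 < \<delta> \<Longrightarrow> E {c - \<kappa><..<c + \<kappa>} x = 0"
proof -
  obtain k where k: "k > 0" "\<And>x. E0 {c - k<..<c + k} x = 0" using resolvent_null[OF T0 c] by blast
  \<comment> \<open>Half of \<open>k\<close>, so that the end points \<open>c - \<kappa>\<close> and
    \<open>c + \<kappa>\<close> have null neighbourhoods of radius \<kappa> themselves.\<close>
  define \<kappa> where "\<kappa> = k / 2"
  have kk: "\<kappa> > 0" "k = 2 * \<kappa>" using k(1) by (auto simp: \<kappa>_def)
  have n1: "E0 {c - \<kappa> - \<kappa><..<c - \<kappa> + \<kappa>} x = 0" for x
    by (rule null_mono[OF T0 _ _ _ k(2)]) (use kk in auto)
  have n2: "E0 {c + \<kappa> - \<kappa><..<c + \<kappa> + \<kappa>} x = 0" for x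
    by (rule null_mono[OF T0 _ _ _ k(2)]) (use kk in auto)
  have n3: "E0 {c - \<kappa>..c + \<kappa>} x = 0" for x
    by (rule null_mono[OF T0 _ _ _ k(2)]) (use kk in auto)
  have "c - \<kappa> < c + \<kappa>" using kk by simp
  from spectral_proj_lipschitz_at[OF T0 this kk(1) n1 n2]
  obtain C where C: "C \<ge> 0" "\<And>T E x. selfadjoint T \<Longrightarrow> spectral_measure_of T E \<Longrightarrow>
    norm (E {c - \<kappa>..c + \<kappa>} x - E0 {c - \<kappa>..c + \<kappa>} x) \<le> C * gap_dist T T0 * norm x" by metis
  have "E {c - \<kappa><..<c + \<kappa>} x = 0"
    if T: "selfadjoint T" "spectral_measure_of T E" and d: "gap_dist T T0 < 1 / (C + 1)" for T E x
  proof (rule null_mono[OF T])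
    fix z
    let ?u = "E {c - \<kappa>..c + \<kappa>} z"
    have "norm ?u \<le> C * gap_dist T T0 * norm ?u"
      using C(2)[OF T, of ?u] by (simp add: n3 op_idem[OF sm_op[OF T]])
    moreover have "C * gap_dist T T0 < 1"
      using C(1) d by (intro mult_less_one_of_less) auto
    ultimately show "?u = 0" by (rule contraction_zero)
  qed auto
  then show ?thesis using that[of "1 / (C + 1)" \<kappa>] C(1) kk(1) by simp
qed

text \<open>A vector of the range of \<open>P\<close> annihilated by \<open>R\<close> satisfies
  \<open>norm x \<le> \<eta> * norm x\<close> and vanishes. So \<open>R\<close> is injective on the
  range of \<open>P\<close>, and conversely.\<close>

lemma close_projections_dim:
  assumes P: "orthogonal_projection P" and R: "orthogonal_projection R"
    and close: "\<And>x. norm (P x - R x) \<le> \<eta> * norm x" and "\<eta> < 1" and f: "fin_dim (range R)"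
  shows "fin_dim (range P)" "dim (range P) = dim (range R)"
proof -
  have inj: "x = 0"
    if P: "orthogonal_projection P" and close: "\<And>x. norm (P x - R x) \<le> \<eta> * norm x"
      and x: "x \<in> range P" "R x = 0" for P R :: "'h \<Rightarrow> 'h" and x
  proof -
    have "P x = x" using x(1) op_range[OF P] by blast
    then have "norm x \<le> \<eta> * norm x" using close[of x] x(2) by simp
    then show ?thesis using \<open>\<eta> < 1\<close> by (rule contraction_zero)
  qed
  have 1: "fin_dim (range P) \<and> dim (range P) \<le> dim (range R)"
    using fin_dim_inj[OF op_add[OF R] op_scale[OF R] op_range_subspace[OF P] inj[OF P close] _ f] by blast
  have close': "norm (R x - P x) \<le> \<eta> * norm x" for x using close[of x] by (simp add: norm_minus_commute)
  have "dim (range R) \<le> dim (range P)"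
    using fin_dim_inj(2)[OF op_add[OF P] op_scale[OF P] op_range_subspace[OF R] inj[OF R close'], of "range P"] 1 by blast
  then show "fin_dim (range P)" "dim (range P) = dim (range R)" using 1 by auto
qed

lemma good_open:
  assumes T0: "T0 \<in> CFsa" and g: "good T0 a"
  obtains \<delta> where "\<delta> > 0" "\<And>T. T \<in> CFsa \<Longrightarrow> gap_dist T T0 < \<delta> \<Longrightarrow> good T a"
proof -
  obtain E0 where E0: "selfadjoint T0" "spectral_measure_of T0 E0" using CFsaE[OF T0] by metis
  have a: "a > 0" "- a < a" and sp: "of_real a \<notin> spectrum T0" "of_real (- a) \<notin> spectrum T0"
    and ess: "of_real ` {- a..a} \<inter> ess_spectrum T0 = {}" using g by (auto simp: good_def)
  obtain d1 k1 where 1: "d1 > 0" "k1 > 0" "\<And>T E x. selfadjoint T \<Longrightarrow> spectral_measure_of T E \<Longrightarrow>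
    gap_dist T T0 < d1 \<Longrightarrow> E {a - k1<..<a + k1} x = 0" using null_open[OF E0 sp(1)] by metis
  obtain d2 k2 where 2: "d2 > 0" "k2 > 0" "\<And>T E x. selfadjoint T \<Longrightarrow> spectral_measure_of T E \<Longrightarrow>
    gap_dist T T0 < d2 \<Longrightarrow> E {- a - k2<..<- a + k2} x = 0" using null_open[OF E0 sp(2)] by metis
  obtain C where C: "C \<ge> 0" "\<And>T E x. selfadjoint T \<Longrightarrow> spectral_measure_of T E \<Longrightarrow>
    norm (E {- a..a} x - E0 {- a..a} x) \<le> C * gap_dist T T0 * norm x"
    using spectral_proj_lipschitz[OF E0 a(2) sp(2) sp(1)] by metis
  define \<delta> where "\<delta> = min (min d1 d2) (1 / (C + 1))"
  have "good T a" if T: "T \<in> CFsa" and d: "gap_dist T T0 < \<delta>" for T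
  proof -
    obtain E where E: "selfadjoint T" "spectral_measure_of T E" using CFsaE[OF T] by metis
    have Cd: "C * gap_dist T T0 < 1"
      using C(1) d by (intro mult_less_one_of_less) (auto simp: \<delta>_def)
    show ?thesis
    proof (rule goodI[OF E a(1), of "min k1 k2"])
      show "E {a - min k1 k2<..<a + min k1 k2} x = 0" for x
        by (rule null_mono[OF E _ _ _ 1(3)[OF E]]) (use d in \<open>auto simp: \<delta>_def\<close>)
      show "E {- a - min k1 k2<..<- a + min k1 k2} x = 0" for x
        by (rule null_mono[OF E _ _ _ 2(3)[OF E]]) (use d in \<open>auto simp: \<delta>_def\<close>)
      show "fin_dim (range (E {- a..a}))"
        by (rule close_projections_dim(1)[OF sm_op[OF E] sm_op[OF E0] C(2)[OF E] Cd fin_dim_of_ess[OF E0 ess]]) auto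
    qed (use 1 2 in auto)
  qed
  then show ?thesis using that[of \<delta>] 1 2 C(1) by (simp add: \<delta>_def)
qed

definition rank_pos :: "'h operator \<Rightarrow> real \<Rightarrow> int" where
  "rank_pos T a = int (dim (range (spectral_proj {0..a} T)))"

text \<open>\<open>[0, b]\<close> splits into \<open>[0, a]\<close> and \<open>(a, b]\<close>; the
  gap at \<open>a\<close> allows replacing the latter by \<open>[a, b]\<close>, whose end points are
  both resolvent points.\<close>

lemma rank_pos_diff:
  assumes E: "selfadjoint T" "spectral_measure_of T E" and a: "good T a" and b: "good T b" and ab: "a < b"
  shows "fin_dim (range (E {a..b}))" "rank_pos T b - rank_pos T a = int (dim (range (E {a..b})))"
proof -
  have a0: "a > 0" and sp: "of_real a \<notin> spectrum T" using a by (auto simp: good_def)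
  have ess: "of_real ` {- b..b} \<inter> ess_spectrum T = {}" using b by (simp add: good_def)
  have fb: "fin_dim (range (E {- b..b}))" by (rule fin_dim_of_ess[OF E ess])
  show f: "fin_dim (range (E {a..b}))" by (rule fin_dim_range_mono[OF E _ _ _ fb]) (use ab a0 in auto)
  have fa: "fin_dim (range (E {0..a}))" by (rule fin_dim_range_mono[OF E _ _ _ fb]) (use ab a0 in auto)
  obtain k where k: "k > 0" "\<And>x. E {a - k<..<a + k} x = 0" using resolvent_null[OF E sp] by blast
  have "E {0..b} x = E {0..a} x + E {a..b} x" for x
  proof -
    have "{0..b} = {0..a} \<union> {a<..b}" using ab a0 by auto
    then have "E {0..b} x = E {0..a} x + E {a<..b} x"
      using pvm_Un[OF sm_pvm[OF E], of "{0..a}" "{a<..b}" x] by (simp add: disjoint_iff)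
    also have "E {a<..b} = E {a..b}"
      by (rule null_eq[OF E _ _ _ k(2)]) (use k(1) in auto)
    finally show ?thesis .
  qed
  then have eq: "E {0..b} = (\<lambda>x. E {0..a} x + E {a..b} x)" by blast
  have z: "E ({0..a} \<inter> {a..b}) x = 0" for x
    by (rule null_mono[OF E _ _ _ k(2)]) (use k(1) in auto)
  have "dim (range (E {0..b})) = dim (range (E {0..a})) + dim (range (E {a..b}))"
    unfolding eq
  proof (rule dim_orthogonal_sum[OF _ _ _ _ fa f])
    show "E {0..a} (E {a..b} x) = 0" for x
      using pvm_Int[OF sm_pvm[OF E], of "{0..a}" "{a..b}" x] z by simp
    show "E {a..b} (E {0..a} x) = 0" for x
      using pvm_Int[OF sm_pvm[OF E], of "{a..b}" "{0..a}" x] z by (simp add: Int_commute del: Int_atLeastAtMost)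
  qed (auto intro: sm_op[OF E])
  then show "rank_pos T b - rank_pos T a = int (dim (range (E {a..b})))"
    using spectral_proj_eq[OF E, of 0 a] spectral_proj_eq[OF E, of 0 b] ab a0 by (simp add: rank_pos_def)
qed

text \<open>The difference is the rank for an interval with both ends in the resolvent set, and that
  projection moves continuously with the operator.\<close>

lemma rank_pos_diff_locally_constant:
  assumes T0: "T0 \<in> CFsa" and a: "good T0 a" and b: "good T0 b"
  obtains \<delta> where "\<delta> > 0" "\<And>T. T \<in> CFsa \<Longrightarrow> gap_dist T T0 < \<delta> \<Longrightarrow>
    rank_pos T a - rank_pos T b = rank_pos T0 a - rank_pos T0 b"
proof -
  have main: "\<exists>\<delta>>0. \<forall>T\<in>CFsa. gap_dist T T0 < \<delta> \<longrightarrow> rank_pos T b - rank_pos T a = rank_pos T0 b - rank_pos T0 a"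
    if ab: "a < b" and a: "good T0 a" and b: "good T0 b" for a b
  proof -
    obtain E0 where E0: "selfadjoint T0" "spectral_measure_of T0 E0" using CFsaE[OF T0] by metis
    obtain d1 where d1: "d1 > 0" "\<And>T. T \<in> CFsa \<Longrightarrow> gap_dist T T0 < d1 \<Longrightarrow> good T a" using good_open[OF T0 a] by metis
    obtain d2 where d2: "d2 > 0" "\<And>T. T \<in> CFsa \<Longrightarrow> gap_dist T T0 < d2 \<Longrightarrow> good T b" using good_open[OF T0 b] by metis
    have sp: "of_real a \<notin> spectrum T0" "of_real b \<notin> spectrum T0" using a b by (auto simp: good_def)
    obtain C where C: "C \<ge> 0" "\<And>T E x. selfadjoint T \<Longrightarrow> spectral_measure_of T E \<Longrightarrow>
      norm (E {a..b} x - E0 {a..b} x) \<le> C * gap_dist T T0 * norm x"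
      using spectral_proj_lipschitz[OF E0 ab sp] by metis
    define \<delta> where "\<delta> = min (min d1 d2) (1 / (C + 1))"
    have "rank_pos T b - rank_pos T a = rank_pos T0 b - rank_pos T0 a"
      if T: "T \<in> CFsa" and d: "gap_dist T T0 < \<delta>" for T
    proof -
      obtain E where E: "selfadjoint T" "spectral_measure_of T E" using CFsaE[OF T] by metis
      have Cd: "C * gap_dist T T0 < 1"
        using C(1) d by (intro mult_less_one_of_less) (auto simp: \<delta>_def)
      have g: "good T a" "good T b" using d1(2) d2(2) T d by (auto simp: \<delta>_def)
      have "dim (range (E {a..b})) = dim (range (E0 {a..b}))"
        by (rule close_projections_dim(2)[OF sm_op[OF E] sm_op[OF E0] C(2)[OF E] Cd rank_pos_diff(1)[OF E0 a b ab]]) auto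
      then show ?thesis using rank_pos_diff(2)[OF E g ab] rank_pos_diff(2)[OF E0 a b ab] by simp
    qed
    then show ?thesis using d1 d2 C(1) by (intro exI[of _ \<delta>]) (simp add: \<delta>_def)
  qed
  consider "a < b" | "a = b" | "b < a" by linarith
  then show ?thesis
  proof cases
    case 1
    from main[OF 1 a b] obtain \<delta> where \<delta>: "\<delta> > 0" "\<forall>T\<in>CFsa. gap_dist T T0 < \<delta> \<longrightarrow>
      rank_pos T b - rank_pos T a = rank_pos T0 b - rank_pos T0 a" by blast
    show ?thesis using \<delta> by (intro that[of \<delta>]) fastforce+
  next
    case 2
    then show ?thesis using that[of 1] by simp
  next
    case 3
    from main[OF 3 b a] obtain \<delta> where \<delta>: "\<delta> > 0" "\<forall>T\<in>CFsa. gap_dist T T0 < \<delta> \<longrightarrow>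
      rank_pos T a - rank_pos T b = rank_pos T0 a - rank_pos T0 b" by blast
    show ?thesis using \<delta> by (intro that[of \<delta>]) auto
  qed
qed

lemma spectral_proj_norm_continuous:
  assumes T0: "T0 \<in> CFsa" and g: "good T0 a"
  obtains C where "C \<ge> 0" "\<And>T. T \<in> CFsa \<Longrightarrow>
    \<bar>onorm (\<lambda>x. spectral_proj {- a..a} T x - spectral_proj {- a..a} T0 x)\<bar> \<le> C * gap_dist T T0"
proof -
  obtain E0 where E0: "selfadjoint T0" "spectral_measure_of T0 E0" using CFsaE[OF T0] by metis
  have a: "- a < a" and sp: "of_real (- a) \<notin> spectrum T0" "of_real a \<notin> spectrum T0"
    using g by (auto simp: good_def)
  obtain C where C: "C \<ge> 0" "\<And>T E x. selfadjoint T \<Longrightarrow> spectral_measure_of T E \<Longrightarrow>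
    norm (E {- a..a} x - E0 {- a..a} x) \<le> C * gap_dist T T0 * norm x"
    using spectral_proj_lipschitz[OF E0 a sp] by metis
  have "\<bar>onorm (\<lambda>x. spectral_proj {- a..a} T x - spectral_proj {- a..a} T0 x)\<bar> \<le> C * gap_dist T T0"
    if T: "T \<in> CFsa" for T
  proof -
    obtain E where E: "selfadjoint T" "spectral_measure_of T E" using CFsaE[OF T] by metis
    have eq: "spectral_proj {- a..a} T = E {- a..a}" "spectral_proj {- a..a} T0 = E0 {- a..a}"
      using spectral_proj_eq[OF E] spectral_proj_eq[OF E0] a by auto
    have "0 \<le> gap_dist T T0" using gap_dist_nonneg sa_closed_op E(1) E0(1) by blast
    then have "onorm (\<lambda>x. E {- a..a} x - E0 {- a..a} x) \<le> C * gap_dist T T0"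
      using C by (intro onorm_bound) (auto intro: C(2)[OF E])
    moreover have "0 \<le> onorm (\<lambda>x. E {- a..a} x - E0 {- a..a} x)"
      by (intro onorm_pos_le bounded_linear_sub op_bounded_linear sm_op[OF E] sm_op[OF E0]) auto
    ultimately show ?thesis by (simp add: eq)
  qed
  then show ?thesis using that C(1) by blast
qed

end


section \<open>Partitions and homotopy invariance\<close>

text \<open>Operators are abstracted away from here on: \<nu> stands for \<open>rank_pos\<close> and
  \<open>G\<close> for \<open>good\<close>, along a path or over the square.\<close>

definition partition_sum :: "(real \<Rightarrow> real \<Rightarrow> int) \<Rightarrow> nat \<Rightarrow> (nat \<Rightarrow> real) \<Rightarrow> (nat \<Rightarrow> real) \<Rightarrow> int" where
  "partition_sum \<nu> N \<tau> a = (\<Sum>i = 1..N. \<nu> (\<tau> i) (a i) - \<nu> (\<tau> (i - 1)) (a i))"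

definition good_partition :: "(real \<Rightarrow> real \<Rightarrow> bool) \<Rightarrow> nat \<Rightarrow> (nat \<Rightarrow> real) \<Rightarrow> (nat \<Rightarrow> real) \<Rightarrow> bool" where
  "good_partition G N \<tau> a \<longleftrightarrow> \<tau> 0 = 0 \<and> \<tau> N = 1 \<and>
     (\<forall>i\<in>{1..N}. \<tau> (i - 1) < \<tau> i \<and> (\<forall>t\<in>{\<tau> (i - 1)..\<tau> i}. G t (a i)))"

lemma good_partition_mono:
  assumes "good_partition G N \<tau> a" "i \<le> j" "j \<le> N"
  shows "\<tau> i \<le> \<tau> j"
  using assms(2,3)
proof (induction j rule: dec_induct)
  case (step n)
  then have "Suc n \<in> {1..N}" by simp
  then have "\<tau> n < \<tau> (Suc n)" using assms(1) unfolding good_partition_def by fastforce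
  then show ?case using step by simp
qed simp

text \<open>The flow accumulated up to time \<open>t\<close>: clamping \<open>t\<close> to each
  piece lets earlier pieces contribute fully and later ones nothing. Partitions with different
  division points can thus be compared at every \<open>t\<close>.\<close>

definition partial_sum :: "(real \<Rightarrow> real \<Rightarrow> int) \<Rightarrow> nat \<Rightarrow> (nat \<Rightarrow> real) \<Rightarrow> (nat \<Rightarrow> real) \<Rightarrow> real \<Rightarrow> int" where
  "partial_sum \<nu> N \<tau> a t =
     (\<Sum>i = 1..N. \<nu> (max (\<tau> (i - 1)) (min t (\<tau> i))) (a i) - \<nu> (\<tau> (i - 1)) (a i))"

context
  fixes G :: "real \<Rightarrow> real \<Rightarrow> bool" and \<nu> :: "real \<Rightarrow> real \<Rightarrow> int" and N \<tau> a
  assumes part: "good_partition G N \<tau> a"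
begin

lemma partial_sum_1: "partial_sum \<nu> N \<tau> a 1 = partition_sum \<nu> N \<tau> a"
  unfolding partial_sum_def partition_sum_def
proof (intro sum.cong refl)
  fix i assume i: "i \<in> {1..N}"
  have "\<tau> N = 1" using part by (simp add: good_partition_def)
  then have "\<tau> (i - 1) \<le> \<tau> i" "\<tau> i \<le> 1"
    using i good_partition_mono[OF part, of "i - 1" i] good_partition_mono[OF part, of i N] by auto
  then show "\<nu> (max (\<tau> (i - 1)) (min 1 (\<tau> i))) (a i) - \<nu> (\<tau> (i - 1)) (a i) = \<nu> (\<tau> i) (a i) - \<nu> (\<tau> (i - 1)) (a i)"
    by (simp add: max_def min_def)
qed

lemma partial_sum_0: "partial_sum \<nu> N \<tau> a 0 = 0"
  unfolding partial_sum_def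
proof (intro sum.neutral ballI)
  fix i assume i: "i \<in> {1..N}"
  have "\<tau> 0 = 0" using part by (simp add: good_partition_def)
  then have "0 \<le> \<tau> (i - 1)" "\<tau> (i - 1) \<le> \<tau> i"
    using i good_partition_mono[OF part, of "i - 1" i] good_partition_mono[OF part, of 0 "i - 1"] by auto
  then show "\<nu> (max (\<tau> (i - 1)) (min 0 (\<tau> i))) (a i) - \<nu> (\<tau> (i - 1)) (a i) = 0"
    by (simp add: max_def min_def)
qed

lemma partial_sum_piece:
  assumes j: "j \<in> {1..N}"
  obtains c where "\<And>t. t \<in> {\<tau> (j - 1)..\<tau> j} \<Longrightarrow> partial_sum \<nu> N \<tau> a t = \<nu> t (a j) + c"
proof
  fix t assume t: "t \<in> {\<tau> (j - 1)..\<tau> j}"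
  let ?f = "\<lambda>i. \<nu> (max (\<tau> (i - 1)) (min t (\<tau> i))) (a i) - \<nu> (\<tau> (i - 1)) (a i)"
  let ?g = "\<lambda>i. if i < j then \<nu> (\<tau> i) (a i) - \<nu> (\<tau> (i - 1)) (a i) else 0"
  have "partial_sum \<nu> N \<tau> a t = ?f j + (\<Sum>i\<in>{1..N} - {j}. ?f i)"
    unfolding partial_sum_def using j by (intro sum.remove) auto
  also have "(\<Sum>i\<in>{1..N} - {j}. ?f i) = (\<Sum>i\<in>{1..N} - {j}. ?g i)"
  proof (intro sum.cong refl)
    fix i assume i: "i \<in> {1..N} - {j}"
    have m: "\<tau> (i - 1) \<le> \<tau> i" using i by (intro good_partition_mono[OF part]) auto
    show "?f i = ?g i"
    proof (cases "i < j")
      case True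
      then have "\<tau> i \<le> \<tau> (j - 1)" using j by (intro good_partition_mono[OF part]) auto
      then have "\<tau> i \<le> t" using t by simp
      then show ?thesis using True m by (simp add: min_absorb2 max_absorb2)
    next
      case False
      then have "\<tau> j \<le> \<tau> (i - 1)" using i by (intro good_partition_mono[OF part]) auto
      then have "t \<le> \<tau> (i - 1)" using t by simp
      then show ?thesis using False by (simp add: max_absorb1 min.coboundedI1)
    qed
  qed
  also have "?f j = \<nu> t (a j) - \<nu> (\<tau> (j - 1)) (a j)" using t by (simp add: max_def min_def)
  finally show "partial_sum \<nu> N \<tau> a t
    = \<nu> t (a j) + ((\<Sum>i\<in>{1..N} - {j}. ?g i) - \<nu> (\<tau> (j - 1)) (a j))" by simp
qed

lemma partial_sum_right:
  assumes t0: "0 \<le> t0" "t0 < 1"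
  obtains \<alpha> c \<delta> where "\<delta> > 0" "G t0 \<alpha>" "\<And>t. t0 \<le> t \<Longrightarrow> t \<le> t0 + \<delta> \<Longrightarrow> partial_sum \<nu> N \<tau> a t = \<nu> t \<alpha> + c"
proof -
  have p: "\<tau> 0 = 0" "\<tau> N = 1" using part by (auto simp: good_partition_def)
  \<comment> \<open>The strict inequality selects the piece reaching to the right of
    \<open>t0\<close>, at a division point the next one. In \<open>partial_sum_left\<close> the weak
    inequality selects the piece to the left; the two levels may differ, so the sides are treated
    separately.\<close>
  define j where "j = (LEAST j. t0 < \<tau> j)"
  have j: "t0 < \<tau> j" unfolding j_def by (rule LeastI[of _ N]) (use p t0 in simp)
  have jN: "j \<le> N" unfolding j_def by (rule Least_le) (use p t0 in simp)
  have j0: "j \<noteq> 0" using j p t0 by (metis not_less)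
  then have "\<not> t0 < \<tau> (j - 1)" unfolding j_def by (intro not_less_Least) simp
  then have jm: "\<tau> (j - 1) \<le> t0" by simp
  have jm1: "j \<in> {1..N}" using j0 jN by simp
  obtain c where c: "\<And>t. t \<in> {\<tau> (j - 1)..\<tau> j} \<Longrightarrow> partial_sum \<nu> N \<tau> a t = \<nu> t (a j) + c"
    using partial_sum_piece[OF jm1] by blast
  have "G t0 (a j)" using part jm1 j jm by (auto simp: good_partition_def)
  then show ?thesis using that[of "\<tau> j - t0" "a j" c] j jm c by simp
qed

lemma partial_sum_left:
  assumes t0: "0 < t0" "t0 \<le> 1"
  obtains \<alpha> c \<delta> where "\<delta> > 0" "G t0 \<alpha>" "\<And>t. t0 - \<delta> \<le> t \<Longrightarrow> t \<le> t0 \<Longrightarrow> partial_sum \<nu> N \<tau> a t = \<nu> t \<alpha> + c"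
proof -
  have p: "\<tau> 0 = 0" "\<tau> N = 1" using part by (auto simp: good_partition_def)
  define j where "j = (LEAST j. t0 \<le> \<tau> j)"
  have j: "t0 \<le> \<tau> j" unfolding j_def by (rule LeastI[of _ N]) (use p t0 in simp)
  have jN: "j \<le> N" unfolding j_def by (rule Least_le) (use p t0 in simp)
  have j0: "j \<noteq> 0" using j p t0 by (metis not_le)
  then have "\<not> t0 \<le> \<tau> (j - 1)" unfolding j_def by (intro not_less_Least) simp
  then have jm: "\<tau> (j - 1) < t0" by simp
  have jm1: "j \<in> {1..N}" using j0 jN by simp
  obtain c where c: "\<And>t. t \<in> {\<tau> (j - 1)..\<tau> j} \<Longrightarrow> partial_sum \<nu> N \<tau> a t = \<nu> t (a j) + c"
    using partial_sum_piece[OF jm1] by blast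
  have "G t0 (a j)" using part jm1 j jm by (auto simp: good_partition_def)
  then show ?thesis using that[of "t0 - \<tau> (j - 1)" "a j" c] j jm c by simp
qed

end

text \<open>The difference of the partial sums of two partitions is locally constant in the end point.\<close>

lemma partition_sum_unique:
  fixes \<nu> :: "real \<Rightarrow> real \<Rightarrow> int"
  assumes loc: "\<And>t0 \<alpha> \<beta>. t0 \<in> {0..1} \<Longrightarrow> G t0 \<alpha> \<Longrightarrow> G t0 \<beta> \<Longrightarrow>
      \<exists>\<delta>>0. \<forall>t\<in>{0..1}. \<bar>t - t0\<bar> < \<delta> \<longrightarrow> \<nu> t \<alpha> - \<nu> t \<beta> = \<nu> t0 \<alpha> - \<nu> t0 \<beta>"
    and P: "good_partition G N \<tau> a" and Q: "good_partition G M \<sigma> b"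
  shows "partition_sum \<nu> N \<tau> a = partition_sum \<nu> M \<sigma> b"
proof -
  define D where "D t = partial_sum \<nu> N \<tau> a t - partial_sum \<nu> M \<sigma> b t" for t
  \<comment> \<open>Near \<open>t0\<close>, on one side, \<open>D\<close> equals \<nu> at one level
    minus \<nu> at another, up to a constant; \<open>loc\<close> applies as both levels are
    admissible at \<open>t0\<close>.\<close>
  have right: "\<exists>\<delta>>0. \<forall>t\<in>{0..1}. t0 \<le> t \<and> t < t0 + \<delta> \<longrightarrow> D t0 = D t" if t0: "t0 \<in> {0..1}" for t0
  proof (cases "t0 < 1")
    case True
    then have b: "0 \<le> t0" "t0 < 1" using t0 by auto
    obtain \<alpha> c d1 where 1: "d1 > 0" "G t0 \<alpha>" "\<And>t. t0 \<le> t \<Longrightarrow> t \<le> t0 + d1 \<Longrightarrow> partial_sum \<nu> N \<tau> a t = \<nu> t \<alpha> + c"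
      using partial_sum_right[OF P b] by metis
    obtain \<beta> c' d2 where 2: "d2 > 0" "G t0 \<beta>" "\<And>t. t0 \<le> t \<Longrightarrow> t \<le> t0 + d2 \<Longrightarrow> partial_sum \<nu> M \<sigma> b t = \<nu> t \<beta> + c'"
      using partial_sum_right[OF Q b] by metis
    obtain d3 where 3: "d3 > 0" "\<forall>t\<in>{0..1}. \<bar>t - t0\<bar> < d3 \<longrightarrow> \<nu> t \<alpha> - \<nu> t \<beta> = \<nu> t0 \<alpha> - \<nu> t0 \<beta>"
      using loc[OF t0 1(2) 2(2)] by blast
    have "D t0 = D t" if "t \<in> {0..1}" "t0 \<le> t" "t < t0 + min d1 (min d2 d3)" for t
    proof -
      have "\<nu> t \<alpha> - \<nu> t \<beta> = \<nu> t0 \<alpha> - \<nu> t0 \<beta>" using 3(2) that by auto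
      then show ?thesis using 1(3)[of t] 1(3)[of t0] 2(3)[of t] 2(3)[of t0] that 1(1) 2(1) by (simp add: D_def)
    qed
    then show ?thesis using 1(1) 2(1) 3(1) by (intro exI[of _ "min d1 (min d2 d3)"]) auto
  next
    case False
    then show ?thesis using t0 by (intro exI[of _ 1]) auto
  qed
  have left: "\<exists>\<delta>>0. \<forall>t\<in>{0..1}. t \<le> t0 \<and> t0 - \<delta> < t \<longrightarrow> D t0 = D t" if t0: "t0 \<in> {0..1}" for t0
  proof (cases "0 < t0")
    case True
    then have b: "0 < t0" "t0 \<le> 1" using t0 by auto
    obtain \<alpha> c d1 where 1: "d1 > 0" "G t0 \<alpha>" "\<And>t. t0 - d1 \<le> t \<Longrightarrow> t \<le> t0 \<Longrightarrow> partial_sum \<nu> N \<tau> a t = \<nu> t \<alpha> + c"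
      using partial_sum_left[OF P b] by metis
    obtain \<beta> c' d2 where 2: "d2 > 0" "G t0 \<beta>" "\<And>t. t0 - d2 \<le> t \<Longrightarrow> t \<le> t0 \<Longrightarrow> partial_sum \<nu> M \<sigma> b t = \<nu> t \<beta> + c'"
      using partial_sum_left[OF Q b] by metis
    obtain d3 where 3: "d3 > 0" "\<forall>t\<in>{0..1}. \<bar>t - t0\<bar> < d3 \<longrightarrow> \<nu> t \<alpha> - \<nu> t \<beta> = \<nu> t0 \<alpha> - \<nu> t0 \<beta>"
      using loc[OF t0 1(2) 2(2)] by blast
    have "D t0 = D t" if "t \<in> {0..1}" "t \<le> t0" "t0 - min d1 (min d2 d3) < t" for t
    proof -
      have "\<nu> t \<alpha> - \<nu> t \<beta> = \<nu> t0 \<alpha> - \<nu> t0 \<beta>" using 3(2) that by auto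
      then show ?thesis using 1(3)[of t] 1(3)[of t0] 2(3)[of t] 2(3)[of t0] that 1(1) 2(1) by (simp add: D_def)
    qed
    then show ?thesis using 1(1) 2(1) 3(1) by (intro exI[of _ "min d1 (min d2 d3)"]) auto
  next
    case False
    then show ?thesis using t0 by (intro exI[of _ 1]) auto
  qed
  have "D 0 = D 1"
  proof (rule connected_local_const[of "{0..1 :: real}" 0 1 D])
    show "connected {0..1 :: real}" by (rule connected_Icc)
    show "\<forall>t0\<in>{0..1}. \<forall>\<^sub>F t in at t0 within {0..1}. D t0 = D t"
    proof
      fix t0 :: real assume t0: "t0 \<in> {0..1}"
      obtain d1 where 1: "d1 > 0" "\<forall>t\<in>{0..1}. t0 \<le> t \<and> t < t0 + d1 \<longrightarrow> D t0 = D t" using right[OF t0] by blast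
      obtain d2 where 2: "d2 > 0" "\<forall>t\<in>{0..1}. t \<le> t0 \<and> t0 - d2 < t \<longrightarrow> D t0 = D t" using left[OF t0] by blast
      show "\<forall>\<^sub>F t in at t0 within {0..1}. D t0 = D t"
        unfolding eventually_at
      proof (intro exI[of _ "min d1 d2"] conjI ballI impI)
        fix t assume t: "t \<in> {0..1}" "t \<noteq> t0 \<and> dist t t0 < min d1 d2"
        then show "D t0 = D t" using 1(2) 2(2) by (cases "t0 \<le> t") (auto simp: dist_real_def)
      qed (use 1 2 in simp)
    qed
  qed auto
  then show ?thesis
    by (simp add: D_def partial_sum_0[OF P] partial_sum_0[OF Q] partial_sum_1[OF P] partial_sum_1[OF Q])
qed

text \<open>A partition for \<open>s\<^sub>0\<close> also serves the neighbouring loops. Since the loops close up, the sum can be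
  rearranged into differences \<open>\<nu> p \<alpha> - \<nu> p \<beta>\<close> at the division points, which are locally constant.\<close>

lemma loop_partition_sum_locally_constant:
  fixes \<nu> :: "real \<times> real \<Rightarrow> real \<Rightarrow> int"
  defines "X \<equiv> {0..1} \<times> {0..1}"
  assumes opn: "\<And>p \<alpha>. p \<in> X \<Longrightarrow> G p \<alpha> \<Longrightarrow> \<exists>\<delta>>0. \<forall>q\<in>X. dist q p < \<delta> \<longrightarrow> G q \<alpha>"
    and loc: "\<And>p \<alpha> \<beta>. p \<in> X \<Longrightarrow> G p \<alpha> \<Longrightarrow> G p \<beta> \<Longrightarrow>
      \<exists>\<delta>>0. \<forall>q\<in>X. dist q p < \<delta> \<longrightarrow> \<nu> q \<alpha> - \<nu> q \<beta> = \<nu> p \<alpha> - \<nu> p \<beta>"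
    and ex: "\<And>p. p \<in> X \<Longrightarrow> \<exists>\<alpha>. G p \<alpha>"
    and loop: "\<And>s \<alpha>. s \<in> {0..1} \<Longrightarrow> G (s, 0) \<alpha> = G (s, 1) \<alpha>"
      "\<And>s \<alpha>. s \<in> {0..1} \<Longrightarrow> \<nu> (s, 0) \<alpha> = \<nu> (s, 1) \<alpha>"
    and s0: "s0 \<in> {0..1}"
  obtains \<delta> N \<tau> a where "\<delta> > 0" "\<And>s. s \<in> {0..1} \<Longrightarrow> \<bar>s - s0\<bar> < \<delta> \<Longrightarrow>
    good_partition (\<lambda>t. G (s, t)) N \<tau> a \<and>
    partition_sum (\<lambda>t. \<nu> (s, t)) N \<tau> a = partition_sum (\<lambda>t. \<nu> (s0, t)) N \<tau> a"
proof -
  let ?K = "{s0} \<times> {0..1 :: real}"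
  have KX: "?K \<subseteq> X" using s0 by (auto simp: X_def)
  have "\<exists>\<alpha> d. d > 0 \<and> (\<forall>q\<in>X. dist q p < d \<longrightarrow> G q \<alpha>)" if "p \<in> X" for p
    using ex[OF that] opn[OF that] by blast
  then obtain al d where ad: "\<And>p. p \<in> X \<Longrightarrow> d p > 0 \<and> (\<forall>q\<in>X. dist q p < d p \<longrightarrow> G q (al p))" by metis
  have "compact ?K" by (intro compact_Times compact_Icc) simp
  moreover have "?K \<subseteq> \<Union> ((\<lambda>p. ball p (d p)) ` ?K)"
  proof
    fix p assume p: "p \<in> ?K"
    then have "d p > 0" using ad KX by blast
    then show "p \<in> \<Union> ((\<lambda>p. ball p (d p)) ` ?K)" using p by (intro UnionI[of "ball p (d p)"]) auto
  qed
  \<comment> \<open>A Lebesgue number: every ball of radius \<open>e\<close> centred on the segment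
    over \<open>s0\<close> has one level admissible throughout.\<close>
  ultimately obtain e where e: "e > 0" "\<And>p. p \<in> ?K \<Longrightarrow> \<exists>B\<in>(\<lambda>p. ball p (d p)) ` ?K. ball p e \<subseteq> B"
    by (rule Heine_Borel_lemma) auto
  \<comment> \<open>The mesh \<open>1 / N\<close> and the deviation of \<open>s\<close> from
    \<open>s0\<close> each take up half of \<open>e\<close>.\<close>
  obtain n where n: "1 / real (Suc n) < e / 2" using nat_approx_posE[of "e / 2"] e(1) by auto
  define N where "N = Suc n"
  define \<tau> where "\<tau> i = real i / real N" for i
  have N0: "real N > 0" by (simp add: N_def)
  have \<tau>01: "\<tau> i \<in> {0..1}" if "i \<le> N" for i using that N0 by (simp add: \<tau>_def)
  have "\<exists>\<alpha>. \<forall>q\<in>X. dist q (s0, \<tau> i) < e \<longrightarrow> G q \<alpha>" if i: "i \<le> N" for i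
  proof -
    have "(s0, \<tau> i) \<in> ?K" using \<tau>01[OF i] by simp
    then obtain p where p: "p \<in> ?K" "ball (s0, \<tau> i) e \<subseteq> ball p (d p)" using e(2) by blast
    have "G q (al p)" if "q \<in> X" "dist q (s0, \<tau> i) < e" for q
    proof -
      have "q \<in> ball p (d p)" using p(2) that(2) by (auto simp: dist_commute)
      then show ?thesis using ad[of p] p(1) KX that(1) by (auto simp: dist_commute)
    qed
    then show ?thesis by blast
  qed
  then obtain a where a: "\<And>i q. i \<le> N \<Longrightarrow> q \<in> X \<Longrightarrow> dist q (s0, \<tau> i) < e \<Longrightarrow> G q (a i)" by metis
  have good: "G (s, t) (a i)"
    if i: "i \<in> {1..N}" and s: "s \<in> {0..1}" "\<bar>s - s0\<bar> < e / 2" and t: "t \<in> {\<tau> (i - 1)..\<tau> i}" for i s t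
  proof (rule a)
    show "i \<le> N" using i by simp
    have "i - 1 \<le> N" "i \<le> N" using i by auto
    then have "t \<in> {0..1}" using t \<tau>01[of "i - 1"] \<tau>01[of i] by auto
    then show "(s, t) \<in> X" using s by (simp add: X_def)
    have "\<tau> i - \<tau> (i - 1) = 1 / real N" using i N0 by (simp add: \<tau>_def field_simps of_nat_diff)
    then have "\<bar>t - \<tau> i\<bar> < e / 2" using t n by (simp add: N_def)
    moreover have "dist (s, t) (s0, \<tau> i) \<le> \<bar>s - s0\<bar> + \<bar>t - \<tau> i\<bar>"
      unfolding dist_prod_def dist_real_def by (rule order_trans[OF sqrt_sum_squares_le_sum_abs]) simp
    ultimately show "dist (s, t) (s0, \<tau> i) < e" using s by linarith
  qed
  have part: "good_partition (\<lambda>t. G (s, t)) N \<tau> a" if "s \<in> {0..1}" "\<bar>s - s0\<bar> < e / 2" for s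
    unfolding good_partition_def
  proof (intro conjI ballI)
    show "\<tau> 0 = 0" "\<tau> N = 1" using N0 by (simp_all add: \<tau>_def)
    show "\<tau> (i - 1) < \<tau> i" if "i \<in> {1..N}" for i using that N0 by (simp add: \<tau>_def divide_strict_right_mono)
  qed (use good that in blast)
  \<comment> \<open>The level in use to the right of \<open>\<tau> i\<close>. At the end point it
    wraps round to the first level, since the values at 1 and 0 agree.\<close>
  define b where "b i = (if i = N then a 1 else a (Suc i))" for i
  have sum_eq: "partition_sum (\<lambda>t. \<nu> (s, t)) N \<tau> a = (\<Sum>i = 1..N. \<nu> (s, \<tau> i) (a i) - \<nu> (s, \<tau> i) (b i))"
    if s: "s \<in> {0..1}" for s
  proof -
    have "(\<Sum>i = 1..N. \<nu> (s, \<tau> (i - 1)) (a i)) = (\<Sum>i<N. \<nu> (s, \<tau> i) (a (Suc i)))"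
      by (rule sum.reindex_bij_witness[of _ Suc "\<lambda>i. i - 1"]) auto
    also have "\<dots> = \<nu> (s, \<tau> 0) (a 1) + (\<Sum>i = 1..<N. \<nu> (s, \<tau> i) (a (Suc i)))"
      by (simp add: N_def sum.atLeast_Suc_lessThan flip: atLeast0LessThan)
    also have "\<nu> (s, \<tau> 0) (a 1) = \<nu> (s, \<tau> N) (b N)"
      using loop(2)[OF s] N0 by (simp add: \<tau>_def b_def)
    also have "(\<Sum>i = 1..<N. \<nu> (s, \<tau> i) (a (Suc i))) = (\<Sum>i = 1..<N. \<nu> (s, \<tau> i) (b i))"
      by (intro sum.cong refl) (simp add: b_def)
    also have "\<nu> (s, \<tau> N) (b N) + (\<Sum>i = 1..<N. \<nu> (s, \<tau> i) (b i)) = (\<Sum>i = 1..N. \<nu> (s, \<tau> i) (b i))"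
      by (simp add: N_def atLeastLessThanSuc_atLeastAtMost[symmetric])
    finally show ?thesis by (simp add: partition_sum_def sum_subtractf)
  qed
  have Ga: "G (s0, \<tau> i) (a i)" if "i \<in> {1..N}" for i
    using good[OF that s0] e(1) that N0 by (simp add: \<tau>_def divide_right_mono)
  have Gb: "G (s0, \<tau> i) (b i)" if i: "i \<in> {1..N}" for i
  proof (cases "i = N")
    case True
    have "G (s0, \<tau> 0) (a 1)" using good[of 1 s0 "\<tau> 0"] s0 e(1) N0 by (simp add: \<tau>_def N_def)
    then show ?thesis using True loop(1)[OF s0] N0 by (simp add: b_def \<tau>_def)
  next
    case False
    then have "Suc i \<in> {1..N}" using i by simp
    from good[OF this s0, of "\<tau> i"] show ?thesis
      using e(1) False N0 by (simp add: b_def \<tau>_def divide_right_mono)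
  qed
  have "\<exists>\<delta>>0. \<forall>q\<in>X. dist q (s0, \<tau> i) < \<delta> \<longrightarrow> \<nu> q (a i) - \<nu> q (b i) = \<nu> (s0, \<tau> i) (a i) - \<nu> (s0, \<tau> i) (b i)"
    if i: "i \<in> {1..N}" for i
  proof (rule loc[OF _ Ga[OF i] Gb[OF i]])
    show "(s0, \<tau> i) \<in> X" using s0 \<tau>01[of i] i by (simp add: X_def)
  qed
  then obtain dd where dd: "\<And>i. i \<in> {1..N} \<Longrightarrow> dd i > 0 \<and> (\<forall>q\<in>X. dist q (s0, \<tau> i) < dd i \<longrightarrow>
     \<nu> q (a i) - \<nu> q (b i) = \<nu> (s0, \<tau> i) (a i) - \<nu> (s0, \<tau> i) (b i))" by metis
  define \<delta> where "\<delta> = min (e / 2) (Min (dd ` {1..N}))"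
  have ne: "dd ` {1..N} \<noteq> {}" by (simp add: N_def)
  have "\<delta> > 0" using e(1) dd ne by (simp add: \<delta>_def)
  moreover have "partition_sum (\<lambda>t. \<nu> (s, t)) N \<tau> a = partition_sum (\<lambda>t. \<nu> (s0, t)) N \<tau> a"
    if s: "s \<in> {0..1}" "\<bar>s - s0\<bar> < \<delta>" for s
    unfolding sum_eq[OF s(1)] sum_eq[OF s0]
  proof (intro sum.cong refl)
    fix i assume i: "i \<in> {1..N}"
    have "(s, \<tau> i) \<in> X" using s \<tau>01[of i] i by (simp add: X_def)
    moreover have "Min (dd ` {1..N}) \<le> dd i" using i by (intro Min_le) auto
    then have "dist (s, \<tau> i) (s0, \<tau> i) < dd i" using s(2) by (simp add: dist_Pair_Pair dist_real_def \<delta>_def)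
    ultimately show "\<nu> (s, \<tau> i) (a i) - \<nu> (s, \<tau> i) (b i) = \<nu> (s0, \<tau> i) (a i) - \<nu> (s0, \<tau> i) (b i)"
      using dd[OF i] by blast
  qed
  moreover have "\<bar>s - s0\<bar> < \<delta> \<Longrightarrow> \<bar>s - s0\<bar> < e / 2" for s by (simp add: \<delta>_def)
  ultimately show ?thesis using that[of \<delta> N \<tau> a] part by blast
qed

section \<open>Spectral flow along gap-continuous paths\<close>

context hilbert_space
begin

lemma gap_continuous_onD:
  assumes "gap_continuous_on X f" "p \<in> X" "e > 0"
  obtains d where "d > 0" "\<And>q. q \<in> X \<Longrightarrow> dist q p < d \<Longrightarrow> gap_dist (f q) (f p) < e"
proof -
  have "((\<lambda>q. gap_dist (f q) (f p)) \<longlongrightarrow> 0) (at p within X)"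
    using assms(1,2) by (simp add: gap_continuous_on_def)
  then have "\<forall>\<^sub>F q in at p within X. gap_dist (f q) (f p) < e" using assms(3) by (rule order_tendstoD(2))
  then obtain d where "d > 0" "\<forall>q\<in>X. q \<noteq> p \<and> dist q p < d \<longrightarrow> gap_dist (f q) (f p) < e"
    unfolding eventually_at by blast
  then show ?thesis using that[of d] assms(3) by (metis gap_dist_self)
qed

lemma sf_partition_iff:
  assumes A: "\<And>t. t \<in> {0..1} \<Longrightarrow> A t \<in> CFsa" and cont: "gap_continuous_on {0..1} A"
  shows "sf_partition A N \<tau> a \<longleftrightarrow> good_partition (\<lambda>t. good (A t)) N \<tau> a"
proof
  assume "sf_partition A N \<tau> a"
  then show "good_partition (\<lambda>t. good (A t)) N \<tau> a"
    unfolding sf_partition_def good_partition_def good_def by blast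
next
  assume P: "good_partition (\<lambda>t. good (A t)) N \<tau> a"
  have p: "\<tau> 0 = 0" "\<tau> N = 1" using P by (auto simp: good_partition_def)
  show "sf_partition A N \<tau> a"
    unfolding sf_partition_def
  proof (intro conjI ballI p)
    fix i assume i: "i \<in> {1..N}"
    have sub: "{\<tau> (i - 1)..\<tau> i} \<subseteq> {0..1}"
      using good_partition_mono[OF P, of 0 "i - 1"] good_partition_mono[OF P, of i N] i p by auto
    show lt: "\<tau> (i - 1) < \<tau> i" using P i by (auto simp: good_partition_def)
    have g: "good (A t) (a i)" if "t \<in> {\<tau> (i - 1)..\<tau> i}" for t using P i that by (auto simp: good_partition_def)
    show "0 < a i" using g[of "\<tau> i"] lt by (simp add: good_def)
    fix t assume t: "t \<in> {\<tau> (i - 1)..\<tau> i}"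
    show "of_real (a i) \<notin> spectrum (A t)" "of_real (- a i) \<notin> spectrum (A t)"
      "of_real ` {- a i..a i} \<inter> ess_spectrum (A t) = {}" using g[OF t] by (auto simp: good_def)
    have t01: "t \<in> {0..1}" using t sub by blast
    obtain C where C: "C \<ge> 0" "\<And>T. T \<in> CFsa \<Longrightarrow>
      \<bar>onorm (\<lambda>x. spectral_proj {- a i..a i} T x - spectral_proj {- a i..a i} (A t) x)\<bar> \<le> C * gap_dist T (A t)"
      using spectral_proj_norm_continuous[OF A[OF t01] g[OF t]] by blast
    show "((\<lambda>u. onorm (\<lambda>x. spectral_proj {- a i..a i} (A u) x - spectral_proj {- a i..a i} (A t) x)) \<longlongrightarrow> 0)
      (at t within {\<tau> (i - 1)..\<tau> i})"
    proof (rule Lim_null_comparison)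
      show "\<forall>\<^sub>F u in at t within {\<tau> (i - 1)..\<tau> i}.
        norm (onorm (\<lambda>x. spectral_proj {- a i..a i} (A u) x - spectral_proj {- a i..a i} (A t) x)) \<le> C * gap_dist (A u) (A t)"
        unfolding eventually_at using C(2) A sub by (intro exI[of _ 1]) (auto simp: subset_iff)
      have "((\<lambda>u. gap_dist (A u) (A t)) \<longlongrightarrow> 0) (at t within {0..1})"
        using cont t01 by (simp add: gap_continuous_on_def)
      then have "((\<lambda>u. gap_dist (A u) (A t)) \<longlongrightarrow> 0) (at t within {\<tau> (i - 1)..\<tau> i})"
        using sub by (rule tendsto_within_subset)
      then show "((\<lambda>u. C * gap_dist (A u) (A t)) \<longlongrightarrow> 0) (at t within {\<tau> (i - 1)..\<tau> i})"
        using tendsto_mult[OF tendsto_const, of _ 0 _ C] by simp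
    qed
  qed
qed

text \<open>Resolves the \<open>THE\<close> in \<open>sf\<close>: each partition by admissible
  levels computes it, uniqueness coming from \<open>partition_sum_unique\<close>.\<close>

lemma sf_eq:
  assumes A: "\<And>t. t \<in> {0..1} \<Longrightarrow> A t \<in> CFsa" and cont: "gap_continuous_on {0..1} A"
    and P: "good_partition (\<lambda>t. good (A t)) N \<tau> a"
  shows "sf A = partition_sum (\<lambda>t. rank_pos (A t)) N \<tau> a"
proof -
  have uniq: "partition_sum (\<lambda>t. rank_pos (A t)) M \<sigma> b = partition_sum (\<lambda>t. rank_pos (A t)) N \<tau> a"
    if Q: "good_partition (\<lambda>t. good (A t)) M \<sigma> b" for M \<sigma> b
  proof (rule partition_sum_unique[OF _ Q P])
    fix t0 \<alpha> \<beta> assume t0: "t0 \<in> {0..1}" and g: "good (A t0) \<alpha>" "good (A t0) \<beta>"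
    obtain \<delta> where \<delta>: "\<delta> > 0" "\<And>T. T \<in> CFsa \<Longrightarrow> gap_dist T (A t0) < \<delta> \<Longrightarrow>
      rank_pos T \<alpha> - rank_pos T \<beta> = rank_pos (A t0) \<alpha> - rank_pos (A t0) \<beta>"
      using rank_pos_diff_locally_constant[OF A[OF t0] g] by metis
    obtain d where "d > 0" "\<And>t. t \<in> {0..1} \<Longrightarrow> dist t t0 < d \<Longrightarrow> gap_dist (A t) (A t0) < \<delta>"
      using gap_continuous_onD[OF cont t0 \<delta>(1)] by metis
    then show "\<exists>\<delta>>0. \<forall>t\<in>{0..1}. \<bar>t - t0\<bar> < \<delta> \<longrightarrow>
      rank_pos (A t) \<alpha> - rank_pos (A t) \<beta> = rank_pos (A t0) \<alpha> - rank_pos (A t0) \<beta>"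
      using \<delta>(2) A by (auto simp: dist_real_def)
  qed
  have iff: "sf_partition A M \<sigma> b \<longleftrightarrow> good_partition (\<lambda>t. good (A t)) M \<sigma> b" for M \<sigma> b
    by (rule sf_partition_iff[OF A cont])
  show ?thesis
    unfolding sf_def rank_pos_def[symmetric] partition_sum_def[of "\<lambda>t. rank_pos (A t)", symmetric] iff
    using P uniq by (intro the_equality) blast+
qed

theorem sf_homotopy:
  fixes h :: "real \<times> real \<Rightarrow> 'h operator"
  assumes h: "\<And>s t. s \<in> {0..1} \<Longrightarrow> t \<in> {0..1} \<Longrightarrow> h (s, t) \<in> CFsa"
    and cont: "gap_continuous_on ({0..1} \<times> {0..1}) h"
    and loop: "\<And>s. s \<in> {0..1} \<Longrightarrow> h (s, 0) = h (s, 1)"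
  shows "sf (\<lambda>t. h (0, t)) = sf (\<lambda>t. h (1, t))"
proof (rule connected_local_const[of "{0..1 :: real}" 0 1 "\<lambda>s. sf (\<lambda>t. h (s, t))"])
  let ?X = "{0..1 :: real} \<times> {0..1 :: real}"
  have hX: "h p \<in> CFsa" if "p \<in> ?X" for p using that h by auto
  have cpath: "gap_continuous_on {0..1} (\<lambda>t. h (s, t))" if s: "s \<in> {0..1}" for s
    unfolding gap_continuous_on_def
  proof
    fix t :: real assume t: "t \<in> {0..1}"
    have "((\<lambda>q. gap_dist (h q) (h (s, t))) \<longlongrightarrow> 0) (at (s, t) within ?X)"
      using cont s t by (simp add: gap_continuous_on_def)
    \<comment> \<open>The inclusion of the slice is injective, so it respects the punctured
      neighbourhoods behind \<open>at\<close>.\<close>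
    moreover have "filterlim (\<lambda>u. (s, u)) (at (s, t) within ?X) (at t within {0..1})"
      unfolding filterlim_at using s
      by (auto intro!: tendsto_intros simp: eventually_at intro: exI[of _ 1])
    ultimately show "((\<lambda>u. gap_dist (h (s, u)) (h (s, t))) \<longlongrightarrow> 0) (at t within {0..1})"
      by (rule filterlim_compose)
  qed
  show "\<forall>s0\<in>{0..1}. \<forall>\<^sub>F s in at s0 within {0..1}. sf (\<lambda>t. h (s0, t)) = sf (\<lambda>t. h (s, t))"
  proof
    fix s0 :: real assume s0: "s0 \<in> {0..1}"
    obtain \<delta> N \<tau> a where \<delta>: "\<delta> > 0" "\<And>s. s \<in> {0..1} \<Longrightarrow> \<bar>s - s0\<bar> < \<delta> \<Longrightarrow>
      good_partition (\<lambda>t. good (h (s, t))) N \<tau> a \<and>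
      partition_sum (\<lambda>t. rank_pos (h (s, t))) N \<tau> a = partition_sum (\<lambda>t. rank_pos (h (s0, t))) N \<tau> a"
    proof (rule loop_partition_sum_locally_constant[of "\<lambda>p. good (h p)" "\<lambda>p. rank_pos (h p)" s0])
      fix p \<alpha> assume p: "p \<in> ?X" and g: "good (h p) \<alpha>"
      obtain e where e: "e > 0" "\<And>T. T \<in> CFsa \<Longrightarrow> gap_dist T (h p) < e \<Longrightarrow> good T \<alpha>"
        using good_open[OF hX[OF p] g] by metis
      show "\<exists>\<delta>>0. \<forall>q\<in>?X. dist q p < \<delta> \<longrightarrow> good (h q) \<alpha>"
        using gap_continuous_onD[OF cont p e(1)] e(2) hX by metis
    next
      fix p \<alpha> \<beta> assume p: "p \<in> ?X" and g: "good (h p) \<alpha>" "good (h p) \<beta>"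
      obtain e where e: "e > 0" "\<And>T. T \<in> CFsa \<Longrightarrow> gap_dist T (h p) < e \<Longrightarrow>
        rank_pos T \<alpha> - rank_pos T \<beta> = rank_pos (h p) \<alpha> - rank_pos (h p) \<beta>"
        using rank_pos_diff_locally_constant[OF hX[OF p] g] by metis
      show "\<exists>\<delta>>0. \<forall>q\<in>?X. dist q p < \<delta> \<longrightarrow>
        rank_pos (h q) \<alpha> - rank_pos (h q) \<beta> = rank_pos (h p) \<alpha> - rank_pos (h p) \<beta>"
        using gap_continuous_onD[OF cont p e(1)] e(2) hX by metis
    next
      show "\<exists>\<alpha>. good (h p) \<alpha>" if "p \<in> ?X" for p using CFsa_good[OF hX[OF that]] .
    qed (use loop s0 in auto)
    have "sf (\<lambda>t. h (s0, t)) = sf (\<lambda>t. h (s, t))" if s: "s \<in> {0..1}" "\<bar>s - s0\<bar> < \<delta>" for s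
    proof -
      \<comment> \<open>The single partition found for \<open>s0\<close> computes the flow of every
        nearby loop, that at \<open>s0\<close> included.\<close>
      have sf: "sf (\<lambda>t. h (s, t)) = partition_sum (\<lambda>t. rank_pos (h (s, t))) N \<tau> a"
        if s: "s \<in> {0..1}" "\<bar>s - s0\<bar> < \<delta>" for s
        using \<delta>(2)[OF s] h[OF s(1)] cpath[OF s(1)] by (intro sf_eq) auto
      show ?thesis using sf[OF s] sf[of s0] \<delta>(1) \<delta>(2)[OF s] s0 by simp
    qed
    then show "\<forall>\<^sub>F s in at s0 within {0..1}. sf (\<lambda>t. h (s0, t)) = sf (\<lambda>t. h (s, t))"
      unfolding eventually_at using \<delta>(1) by (intro exI[of _ \<delta>]) (auto simp: dist_real_def)
  qed
qed auto

end

theorem corollary3p6: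
  fixes scale :: "'k::real_or_complex \<Rightarrow> 'h::banach \<Rightarrow> 'h"
    and ip :: "'h \<Rightarrow> 'h \<Rightarrow> 'k"
    and h :: "real \<times> real \<Rightarrow> 'h operator"
  assumes "hilbert_space scale ip"
    and "separable_space (euclidean :: 'h topology)"
    and "\<forall>s\<in>{0..1}. \<forall>t\<in>{0..1}. h (s, t) \<in> hilbert_space.CFsa scale ip"
    and "hilbert_space.gap_continuous_on ip ({0..1} \<times> {0..1}) h"
    and "\<forall>s\<in>{0..1}. h (s, 0) = h (s, 1)"
  shows "hilbert_space.sf scale ip (\<lambda>t. h (0, t)) = hilbert_space.sf scale ip (\<lambda>t. h (1, t))"
  using hilbert_space.sf_homotopy[OF assms(1), of h] assms(3-5) by blast

end
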